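(* Let $p>3$ be a prime with $p\equiv 1$ or $3\pmod 8$, and write $p=x^2+2y^2$ with $x,y\in\mathbb Z$. Then $$\big(2-(-1)^{\frac{p-1}2}\big)\sum_{k=0}^{p-1}\binom{2k}k^2\frac 1{16^k}\cdot\frac p{8k+1}\equiv \big(2+(-1)^{\frac{p-1}2}\big)\sum_{k=0}^{p-1}\binom{2k}k^2\frac1{16^k}\cdot\frac p{8k+3}\equiv 4x^2-2p\pmod{p^2}.$$
   Context: Congruences are taken in the ring $\mathbb Z_p$ of rational numbers whose denominators are not divisible by $p$. *)

theory Defs
  imports Complex_Main "HOL-Number_Theory.Cong" "HOL-Computational_Algebra.Primes"
begin

text \<open>
  The ring written \<open>\<int>\<^sub>p\<close> here is the subring of the rationals with denominator prime to \<open>p\<close>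
  (not its completion, the \<open>p\<close>-adic integers).  The function \<open>quotient_of\<close> returns the
  numerator and the positive denominator in lowest terms.
\<close>
definition p_integral :: "nat \<Rightarrow> rat set"
  where "p_integral p = {r. \<not> int p dvd snd (quotient_of r)}"

text \<open>Congruence in that ring modulo the ideal generated by \<open>m\<close>; both sides must lie in the ring.\<close>
definition p_integral_cong :: "nat \<Rightarrow> rat \<Rightarrow> rat \<Rightarrow> rat \<Rightarrow> bool"
  where "p_integral_cong p a b m \<longleftrightarrow>
    a \<in> p_integral p \<and> b \<in> p_integral p \<and> (\<exists>c \<in> p_integral p. a - b = m * c)"

end

theory Submission
  imports Defs "HOL-Number_Theory.Number_Theory" "HOL-Computational_Algebra.Formal_Power_Series"
begin

text \<open>
  Write \<open>p = 8 m + 1\<close> (put \<open>d = 1\<close>) or \<open>p = 8 m + 3\<close> (put \<open>d = - 1\<close>), \<open>n = (p - 1) / 2\<close>, and let \<open>Q\<close> be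
  the sum of the binomial coefficients \<open>(p n choose k)\<close> with \<open>k \<equiv> d m (mod p - d)\<close>.

  Modulo \<open>p\<^sup>2\<close> the squares of \<open>(2 k choose k) / 4 ^ k\<close> are the coefficients \<open>(- 1) ^ k (n choose k) (n + k choose k)\<close> of a
  Legendre polynomial, so partial fractions turn both sums into products.  To first order in \<open>p\<close> these
  products are \<open>(n choose m)\<^sup>2\<close> times a correction by harmonic numbers, and the same correction comes
  out of \<open>((p - d) Q)\<^sup>2\<close>.

  On the other hand \<open>Q\<close> is a character sum.  Let \<open>\<chi>\<close> be a character of order 8 of the quadratic algebra
  \<open>A = F\<^sub>p[\<epsilon>]\<close>, \<open>\<epsilon>\<^sup>2 = d\<close>, given by \<open>\<beta> \<mapsto> \<beta> ^ a \<beta>' ^ b\<close> with \<open>a + b = n\<close>, where \<open>\<beta>'\<close> is the conjugate of \<open>\<beta>\<close>.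
  It satisfies \<open>\<chi>(\<beta>') = \<chi>(\<beta>)\<^sup>3\<close>, so \<open>E\<close>, the sum of all \<open>\<chi>(1 + s \<epsilon>)\<close>, lies in \<open>\<int>[\<surd>-2]\<close>, and it has norm \<open>p\<close>;
  hence \<open>E = x + y \<surd>-2\<close> up to signs.  Replacing \<open>\<beta>\<close> by \<open>\<beta> ^ p\<close> (a Teichmueller lift modulo \<open>p\<^sup>2\<close>) and
  expanding \<open>(\<beta> ^ p + \<beta>' ^ p) ^ (p n)\<close> shows that the conjugate of \<open>E\<close> is \<open>\<plusminus>(p - d) Q\<close> modulo \<open>p\<^sup>2\<close>.  As this is a
  unit and \<open>E E' = p\<close>, its square is \<open>E\<^sup>2 + E'\<^sup>2 = 4 x\<^sup>2 - 2 p\<close> modulo \<open>p\<^sup>2\<close>.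
\<close>

section \<open>Congruences between \<open>p\<close>-integral rationals\<close>

text \<open>Two features of \<open>Q\<close> have reasons that the outline only names. The exponent
  \<open>n\<close> in \<open>p n\<close> makes the power of the trace a quadratic character; with
  \<open>a + b = n\<close> this makes the summands invariant under scalars, so that the sum over all
  \<open>1 + s \<epsilon>\<close> extends to all units, where orthogonality of characters applies
  and selects the class of \<open>k\<close>. The factor \<open>p\<close> is there because the trace
  of \<open>\<beta> ^ p\<close> is known only modulo \<open>p\<close>, and a \<open>p\<close>-th
  power is what carries a congruence from \<open>p\<close> to \<open>p\<^sup>2\<close>. There are
  \<open>(p - 1) (p - d)\<close> units, the scalars account for \<open>p - 1\<close>, and the
  remaining \<open>p - d\<close> is the factor in front of \<open>Q\<close>; it also cancels the
  non-harmonic first-order term of \<open>Q\<close>. The norm of \<open>E\<close> requires an exact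
  equation and is found in the complex numbers, while \<open>E\<close> modulo
  \<open>p\<^sup>2\<close> lives in the integers or the Gaussian integers. No homomorphism between
  them is used: only the exponents of the values of \<open>\<chi>\<close> are shared, and they enter
  both sides through the same two integers. No harmonic number is ever evaluated; those on the two
  sides simply agree.\<close>

lemma p_integral_iff:
  assumes "prime p"
  shows "r \<in> p_integral p \<longleftrightarrow> (\<exists>a b. r = of_int a / of_int b \<and> \<not> int p dvd b)"
proof
  assume "r \<in> p_integral p"
  moreover obtain a b where ab: "quotient_of r = (a, b)" by fastforce
  ultimately have "\<not> int p dvd b" "r = of_int a / of_int b"
    using quotient_of_div[OF ab] by (auto simp: p_integral_def)
  then show "\<exists>a b. r = of_int a / of_int b \<and> \<not> int p dvd b" by blast
next
  assume "\<exists>a b. r = of_int a / of_int b \<and> \<not> int p dvd b"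
  then obtain a b where r: "r = of_int a / of_int b" and b: "\<not> int p dvd b" by blast
  obtain c d where cd: "quotient_of r = (c, d)" by fastforce
  then have d: "d > 0" "coprime c d" "r = of_int c / of_int d"
    using quotient_of_denom_pos quotient_of_coprime quotient_of_div by auto
  have "b \<noteq> 0" using b by auto
  then have "(of_int a :: rat) * of_int d = of_int c * of_int b"
    using r d by (simp add: field_simps)
  then have "a * d = c * b" by (metis of_int_eq_iff of_int_mult)
  then have "d dvd c * b" by (metis dvd_triv_right)
  then have "d dvd b" using d(2) by (metis coprime_commute coprime_dvd_mult_right_iff)
  then have "\<not> int p dvd d" using b dvd_trans by blast
  then show "r \<in> p_integral p" using cd by (simp add: p_integral_def)
qed

locale prime_rat =
  fixes p :: nat
  assumes prime_p: "prime p"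
begin

abbreviation Zp :: "rat set" where "Zp \<equiv> p_integral p"

definition pcong :: "nat \<Rightarrow> rat \<Rightarrow> rat \<Rightarrow> bool"
  where "pcong k a b \<longleftrightarrow> p_integral_cong p a b (of_nat p ^ k)"

lemma pcong_iff: "pcong k a b \<longleftrightarrow> a \<in> Zp \<and> b \<in> Zp \<and> (\<exists>c\<in>Zp. a - b = of_nat p ^ k * c)"
  unfolding pcong_def p_integral_cong_def ..

lemma p_nz [simp]: "(of_nat p :: rat) \<noteq> 0" "p > 0" "p \<noteq> 0"
  using prime_p prime_gt_0_nat by auto

lemma Zp_of_int [simp]: "of_int a \<in> Zp"
  unfolding p_integral_iff[OF prime_p]
  by (rule exI[of _ a], rule exI[of _ 1]) (use prime_p prime_nat_int_transfer not_prime_unit in auto)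

lemma Zp_of_nat [simp]: "of_nat a \<in> Zp"
  using Zp_of_int[of "int a"] by simp

lemma Zp_numeral [simp]: "numeral a \<in> Zp" "0 \<in> Zp" "1 \<in> Zp"
  using Zp_of_int[of "numeral a"] Zp_of_int[of 0] Zp_of_int[of 1] by auto

lemma not_dvd_mult: "\<not> int p dvd a \<Longrightarrow> \<not> int p dvd b \<Longrightarrow> \<not> int p dvd a * b"
  using prime_p prime_dvd_mult_iff[of "int p" a b] by simp

lemma Zp_add [simp]:
  assumes "a \<in> Zp" "b \<in> Zp"
  shows "a + b \<in> Zp"
proof -
  obtain x y u v where *: "a = of_int x / of_int y" "\<not> int p dvd y"
    "b = of_int u / of_int v" "\<not> int p dvd v"
    using assms unfolding p_integral_iff[OF prime_p] by blast
  then have "y \<noteq> 0" "v \<noteq> 0" by auto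
  then have "a + b = of_int (x * v + u * y) / of_int (y * v)" using * by (simp add: field_simps)
  then show ?thesis using * not_dvd_mult unfolding p_integral_iff[OF prime_p] by blast
qed

lemma Zp_mult [simp]:
  assumes "a \<in> Zp" "b \<in> Zp"
  shows "a * b \<in> Zp"
proof -
  obtain x y u v where *: "a = of_int x / of_int y" "\<not> int p dvd y"
    "b = of_int u / of_int v" "\<not> int p dvd v"
    using assms unfolding p_integral_iff[OF prime_p] by blast
  then have "a * b = of_int (x * u) / of_int (y * v)" by simp
  then show ?thesis using * not_dvd_mult unfolding p_integral_iff[OF prime_p] by blast
qed

lemma Zp_minus [simp]: "a \<in> Zp \<Longrightarrow> - a \<in> Zp"
  using Zp_mult[of "of_int (-1)" a] Zp_of_int[of "-1"] by simp

lemma Zp_diff [simp]: "a \<in> Zp \<Longrightarrow> b \<in> Zp \<Longrightarrow> a - b \<in> Zp"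
  using Zp_add[of a "-b"] by simp

lemma Zp_power [simp]: "a \<in> Zp \<Longrightarrow> a ^ k \<in> Zp"
  by (induction k) auto

lemma Zp_sum [simp]: "(\<And>i. i \<in> A \<Longrightarrow> f i \<in> Zp) \<Longrightarrow> sum f A \<in> Zp"
  by (induction A rule: infinite_finite_induct) auto

lemma Zp_inverse_of_int: "\<not> int p dvd b \<Longrightarrow> inverse (of_int b) \<in> Zp"
  unfolding p_integral_iff[OF prime_p]
  by (rule exI[of _ 1], rule exI[of _ b]) (auto simp: divide_inverse)

lemma Zp_inverse_of_nat: "\<not> p dvd b \<Longrightarrow> inverse (of_nat b) \<in> Zp"
  using Zp_inverse_of_int[of "int b"] by simp

lemma Zp_inverse_small: "0 < b \<Longrightarrow> b < p \<Longrightarrow> inverse (of_nat b) \<in> Zp"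
  using Zp_inverse_of_nat[of b] nat_dvd_not_less by blast

lemma Zp_divide: "a \<in> Zp \<Longrightarrow> inverse b \<in> Zp \<Longrightarrow> a / b \<in> Zp"
  by (simp add: divide_inverse)

lemma Zp_prod [simp]: "(\<And>i. i \<in> A \<Longrightarrow> f i \<in> Zp) \<Longrightarrow> prod f A \<in> Zp"
  by (induction A rule: infinite_finite_induct) auto

lemma pcong_refl [simp]: "a \<in> Zp \<Longrightarrow> pcong k a a"
  by (auto simp: pcong_iff intro!: bexI[of _ 0])

lemma pcong_sym: "pcong k a b \<Longrightarrow> pcong k b a"
  unfolding pcong_iff
  by (metis Zp_minus minus_diff_eq mult_minus_right)

lemma pcong_trans [trans]:
  assumes "pcong k a b" "pcong k b c" shows "pcong k a c"
proof -
  obtain x y where *: "x \<in> Zp" "y \<in> Zp" "a - b = of_nat p ^ k * x" "b - c = of_nat p ^ k * y"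
    using assms unfolding pcong_iff by blast
  then have "a - c = of_nat p ^ k * (x + y)" by (simp add: algebra_simps)
  then show ?thesis using assms * Zp_add unfolding pcong_iff by blast
qed

lemma pcong_eq_trans [trans]: "pcong k a b \<Longrightarrow> b = c \<Longrightarrow> pcong k a c"
  and eq_pcong_trans [trans]: "a = b \<Longrightarrow> pcong k b c \<Longrightarrow> pcong k a c"
  by simp_all

lemma pcong_Zp: "pcong k a b \<Longrightarrow> a \<in> Zp \<and> b \<in> Zp"
  unfolding pcong_iff by blast

lemma pcong_add:
  assumes "pcong k a b" "pcong k c d" shows "pcong k (a + c) (b + d)"
proof -
  obtain x y where *: "x \<in> Zp" "y \<in> Zp" "a - b = of_nat p ^ k * x" "c - d = of_nat p ^ k * y"
    using assms unfolding pcong_iff by blast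
  then have "(a + c) - (b + d) = of_nat p ^ k * (x + y)" by (simp add: algebra_simps)
  then show ?thesis using assms * Zp_add unfolding pcong_iff by blast
qed

lemma pcong_mult:
  assumes "pcong k a b" "pcong k c d" shows "pcong k (a * c) (b * d)"
proof -
  obtain x y where *: "x \<in> Zp" "y \<in> Zp" "a - b = of_nat p ^ k * x" "c - d = of_nat p ^ k * y"
    using assms unfolding pcong_iff by blast
  have "a * c - b * d = (a - b) * c + b * (c - d)" by (simp add: algebra_simps)
  then have "a * c - b * d = of_nat p ^ k * (x * c + b * y)"
    unfolding * by (simp add: algebra_simps)
  moreover have "x * c + b * y \<in> Zp" using * assms pcong_Zp by auto
  ultimately show ?thesis using assms Zp_mult unfolding pcong_iff by blast
qed

lemma pcong_minus: "pcong k a b \<Longrightarrow> pcong k (- a) (- b)"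
  using pcong_mult[of k "-1" "-1" a b] Zp_of_int[of "-1"] by simp

lemma pcong_diff: "pcong k a b \<Longrightarrow> pcong k c d \<Longrightarrow> pcong k (a - c) (b - d)"
  using pcong_add[of k a b "-c" "-d"] pcong_minus by simp

lemma pcong_power: "pcong k a b \<Longrightarrow> pcong k (a ^ j) (b ^ j)"
  by (induction j) (auto intro: pcong_mult)

lemma pcong_sum: "(\<And>i. i \<in> A \<Longrightarrow> pcong k (f i) (g i)) \<Longrightarrow> pcong k (sum f A) (sum g A)"
  by (induction A rule: infinite_finite_induct) (auto intro: pcong_add)

lemma pcong_mult_left: "c \<in> Zp \<Longrightarrow> pcong k a b \<Longrightarrow> pcong k (c * a) (c * b)"
  by (intro pcong_mult pcong_refl)

lemma pcong_mult_right: "c \<in> Zp \<Longrightarrow> pcong k a b \<Longrightarrow> pcong k (a * c) (b * c)"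
  by (intro pcong_mult pcong_refl)

text \<open>How a term with an explicit factor \<open>p\<close> gains its second power: the cofactor
  has to be known only modulo \<open>p\<close>.\<close>

lemma pcong_p_mult:
  assumes "pcong k a b" shows "pcong (Suc k) (of_nat p * a) (of_nat p * b)"
proof -
  obtain x where *: "x \<in> Zp" "a - b = of_nat p ^ k * x"
    using assms unfolding pcong_iff by blast
  then have "of_nat p * a - of_nat p * b = of_nat p ^ Suc k * x"
    by (metis mult.assoc power_Suc right_diff_distrib)
  then show ?thesis using assms * Zp_mult Zp_of_nat unfolding pcong_iff by blast
qed

lemma pcong_mono:
  assumes "pcong k a b" "j \<le> k" shows "pcong j a b"
proof -
  obtain x where *: "x \<in> Zp" "a - b = of_nat p ^ k * x"
    using assms unfolding pcong_iff by blast
  then have "a - b = of_nat p ^ j * (of_nat p ^ (k - j) * x)"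
    using assms(2) by (simp flip: power_add mult.assoc)
  then show ?thesis using assms * Zp_mult Zp_of_nat Zp_power unfolding pcong_iff by blast
qed

lemma pcong_cancel:
  assumes "pcong k (c * a) (c * b)" "inverse c \<in> Zp" "c \<noteq> 0"
  shows "pcong k a b"
  using pcong_mult_left[OF assms(2,1)] assms(3) by (simp flip: mult.assoc)

lemma pcong_inverse:
  assumes "pcong k a b" "inverse a \<in> Zp" "inverse b \<in> Zp" "a \<noteq> 0" "b \<noteq> 0"
  shows "pcong k (inverse a) (inverse b)"
proof -
  have "pcong k (inverse a * inverse b * b) (inverse a * inverse b * a)"
    using pcong_mult_left[OF Zp_mult[OF assms(2,3)] pcong_sym[OF assms(1)]] .
  moreover have "inverse a * inverse b * b = inverse a" "inverse a * inverse b * a = inverse b"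
    using assms(4,5) by (auto simp: field_simps)
  ultimately show ?thesis by simp
qed

lemma pcong_of_int: "int p ^ k dvd a - b \<Longrightarrow> pcong k (of_int a) (of_int b)"
proof -
  assume "int p ^ k dvd a - b"
  then obtain c where "a - b = int p ^ k * c" by blast
  then have "(of_int a :: rat) - of_int b = of_nat p ^ k * of_int c"
    by (metis of_int_diff of_int_mult of_int_of_nat_eq of_int_power)
  then show ?thesis unfolding pcong_iff using Zp_of_int by blast
qed

lemma pcong_0_if_dvd: "p ^ k dvd a \<Longrightarrow> pcong k (of_nat a) 0"
  using pcong_of_int[of k "int a" 0] by (metis diff_zero of_int_0 of_int_of_nat_eq of_nat_dvd_iff of_nat_power)

lemma pcong_p_0: "pcong (Suc 0) (of_nat p) 0"
  using pcong_0_if_dvd[of 1 p] by simp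

lemma pcong_p_sq_0: "x \<in> Zp \<Longrightarrow> pcong 2 ((of_nat p)\<^sup>2 * x) 0"
  unfolding pcong_iff by (auto intro!: bexI[of _ x])

lemma pcong_first_order_mult:
  assumes "x \<in> Zp" "y \<in> Zp"
  shows "pcong 2 ((1 + of_nat p * x) * (1 + of_nat p * y)) (1 + of_nat p * (x + y))"
proof -
  have "pcong 2 ((1 + of_nat p * (x + y)) + (of_nat p)\<^sup>2 * (x * y)) ((1 + of_nat p * (x + y)) + 0)"
    using assms by (intro pcong_add pcong_refl pcong_p_sq_0) auto
  then show ?thesis by (simp add: algebra_simps power2_eq_square)
qed

text \<open>Cross terms carry \<open>p\<^sup>2\<close>, so products of factors
  \<open>1 + p x\<close> turn into sums; this is where the harmonic numbers come from.\<close>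

lemma pcong_first_order_prod:
  assumes "\<And>i. i \<in> A \<Longrightarrow> x i \<in> Zp"
  shows "pcong 2 (\<Prod>i\<in>A. 1 + of_nat p * x i) (1 + of_nat p * (\<Sum>i\<in>A. x i))"
  using assms
proof (induction A rule: infinite_finite_induct)
  case (insert i A)
  have "pcong 2 ((1 + of_nat p * x i) * (\<Prod>i\<in>A. 1 + of_nat p * x i))
      ((1 + of_nat p * x i) * (1 + of_nat p * (\<Sum>i\<in>A. x i)))"
    using insert by (intro pcong_mult_left) auto
  also have "pcong 2 \<dots> (1 + of_nat p * (x i + (\<Sum>i\<in>A. x i)))"
    using insert by (intro pcong_first_order_mult) auto
  finally show ?case using insert by simp
qed auto

text \<open>\<open>1 - p x\<close> inverts \<open>1 + p x\<close> up to
  \<open>p\<^sup>2 x\<^sup>2\<close>, so the factor moves across without a division.\<close>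

lemma pcong_first_order_inverse:
  assumes "pcong 2 (a * (1 + of_nat p * x)) b" "x \<in> Zp" "a \<in> Zp"
  shows "pcong 2 a (b * (1 - of_nat p * x))"
proof -
  have "pcong 2 (b * (1 - of_nat p * x)) (a * (1 + of_nat p * x) * (1 - of_nat p * x))"
    using pcong_sym[OF assms(1)] assms(2) by (intro pcong_mult_right) auto
  also have "a * (1 + of_nat p * x) * (1 - of_nat p * x) = a + (of_nat p)\<^sup>2 * (- a * x\<^sup>2)"
    by (simp add: algebra_simps power2_eq_square)
  also have "pcong 2 \<dots> (a + 0)"
    using assms by (intro pcong_add pcong_refl pcong_p_sq_0) auto
  finally show ?thesis using pcong_sym by simp
qed

end

section \<open>The hypergeometric sum\<close>

text \<open>The coefficients of the shifted Legendre polynomial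
  \<open>P_n (1 - 2 t)\<close>.\<close>

definition legendre_coeff :: "nat \<Rightarrow> nat \<Rightarrow> 'a::field_char_0"
  where "legendre_coeff n k = (- 1) ^ k * of_nat (n choose k) * of_nat ((n + k) choose k)"

text \<open>This is the value \<open>P_n (- 1)\<close>. With \<open>(n + k choose k)\<close>
  rewritten as a generalized binomial coefficient of upper index \<open>- (n + 1)\<close>, the sum
  is a Vandermonde convolution of total upper index \<open>- 1\<close>.\<close>

lemma sum_legendre_coeff: "(\<Sum>k\<le>n. legendre_coeff n k) = ((- 1) ^ n :: 'a::field_char_0)"
proof -
  have "(\<Sum>k\<le>n. legendre_coeff n k) =
      (\<Sum>k=0..n. ((- (of_nat n + 1)) gchoose k) * ((of_nat n gchoose (n - k)) :: 'a))"
  proof (rule sum.cong)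
    fix k assume "k \<in> {0..n}"
    then have "(of_nat n gchoose (n - k) :: 'a) = of_nat (n choose k)"
      by (metis atLeastAtMost_iff binomial_gbinomial binomial_symmetric)
    moreover have "((- (of_nat n + 1)) gchoose k :: 'a) = (- 1) ^ k * of_nat ((n + k) choose k)"
      by (subst gbinomial_minus) (simp add: binomial_gbinomial add_ac)
    ultimately show "legendre_coeff n k =
        ((- (of_nat n + 1)) gchoose k) * ((of_nat n gchoose (n - k)) :: 'a)"
      by (simp add: legendre_coeff_def)
  qed auto
  also have "\<dots> = (- 1 :: 'a) gchoose n"
    by (subst gbinomial_Vandermonde) simp
  also have "\<dots> = (- 1) ^ n"
    by (subst gbinomial_minus) (simp flip: binomial_gbinomial)
  finally show ?thesis .
qed

text \<open>The recurrence is kept free of denominators so that it also covers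
  \<open>k = n + 1\<close>, where the left factor and the right coefficient both vanish.\<close>

lemma legendre_coeff_Suc_left:
  "(of_nat (Suc n) - of_nat k) * legendre_coeff (Suc n) k =
    ((of_nat (Suc n) + of_nat k) * legendre_coeff n k :: 'a::field_char_0)"
proof (cases "k \<le> Suc n")
  case True
  have "(Suc n - k) * (Suc n choose k) = Suc n * (n choose k)"
    using binomial_absorb_comp[of "Suc n" k] by simp
  moreover have "Suc n * ((Suc n + k) choose k) = (Suc n + k) * ((n + k) choose k)"
    using binomial_absorb_comp[of "Suc n + k" k] by simp
  ultimately have "of_nat (Suc n) * ((Suc n - k) * (Suc n choose k) * ((Suc n + k) choose k)) =
      of_nat (Suc n) * ((Suc n + k) * (n choose k) * ((n + k) choose k))"
    by (metis (no_types, lifting) mult.assoc mult.left_commute)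
  then have "(Suc n - k) * (Suc n choose k) * ((Suc n + k) choose k) =
      (Suc n + k) * (n choose k) * ((n + k) choose k)"
    by (metis mult_cancel1 of_nat_eq_0_iff nat.distinct(1))
  then have "(of_nat (Suc n) - of_nat k) * of_nat (Suc n choose k) * of_nat ((Suc n + k) choose k) =
      ((of_nat (Suc n) + of_nat k) * of_nat (n choose k) * of_nat ((n + k) choose k) :: 'a)"
    using True by (metis of_nat_add of_nat_diff of_nat_mult)
  then show ?thesis unfolding legendre_coeff_def by (metis (no_types) mult.assoc mult.left_commute)
next
  case False
  then show ?thesis by (simp add: legendre_coeff_def binomial_eq_0)
qed

text \<open>Both sides satisfy \<open>(n + 1 + x) F (n + 1) = (n + 1 - x) F n\<close>.\<close>
lemma legendre_coeff_partial_fractions: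
  fixes x :: "'a::field_char_0"
  assumes "\<And>j. j \<le> n \<Longrightarrow> of_nat j + x \<noteq> 0"
  shows "(\<Sum>k\<le>n. legendre_coeff n k / (of_nat k + x)) * (\<Prod>j\<le>n. of_nat j + x) =
    (\<Prod>j=1..n. of_nat j - x)"
  using assms
proof (induction n)
  case 0
  then show ?case by (simp add: legendre_coeff_def)
next
  case (Suc n)
  let ?N = "of_nat (Suc n) :: 'a"
  let ?c = "\<lambda>n k. legendre_coeff n k :: 'a"
  have top: "?c n (Suc n) = 0" by (simp add: legendre_coeff_def)
  \<comment> \<open>Weighting by \<open>?N + x\<close> and \<open>?N - x\<close> makes the numerator
    divisible by \<open>k + x\<close>: the poles disappear, and what is left sums to
    \<open>(- 1) ^ (n + 1) + (- 1) ^ n = 0\<close>.\<close>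
  have step: "(?N + x) * (?c (Suc n) k / (of_nat k + x)) - (?N - x) * (?c n k / (of_nat k + x)) =
      ?c (Suc n) k + ?c n k" if "k \<le> Suc n" for k
  proof (cases "k = Suc n")
    case True
    then show ?thesis using Suc.prems[of "Suc n"] top by simp
  next
    case False
    then have nz: "?N - of_nat k \<noteq> 0" "of_nat k + x \<noteq> 0"
      using that Suc.prems by (auto simp del: of_nat_Suc)
    have c: "?c (Suc n) k = (?N + of_nat k) * ?c n k / (?N - of_nat k)"
      using legendre_coeff_Suc_left[of n k, where ?'a='a] nz by (simp add: field_simps del: of_nat_Suc)
    have "(?N + x) * ?c (Suc n) k - (?N - x) * ?c n k = (?c (Suc n) k + ?c n k) * (of_nat k + x)"
      unfolding c using nz(1) by (simp add: divide_simps del: of_nat_Suc) (simp add: algebra_simps del: of_nat_Suc)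
    moreover have "(?N + x) * (?c (Suc n) k / (of_nat k + x)) - (?N - x) * (?c n k / (of_nat k + x)) =
        ((?N + x) * ?c (Suc n) k - (?N - x) * ?c n k) / (of_nat k + x)"
      by (simp add: diff_divide_distrib del: of_nat_Suc)
    ultimately show ?thesis using nz(2) by (simp del: of_nat_Suc)
  qed
  let ?F = "\<lambda>n. \<Sum>k\<le>n. ?c n k / (of_nat k + x)"
  have "(\<Sum>k\<le>Suc n. ?c (Suc n) k + ?c n k) = (\<Sum>k\<le>Suc n. ?c (Suc n) k) + (\<Sum>k\<le>n. ?c n k)"
    unfolding sum.distrib using top by simp
  also have "\<dots> = 0" unfolding sum_legendre_coeff by simp
  finally have "(\<Sum>k\<le>Suc n. (?N + x) * (?c (Suc n) k / (of_nat k + x)) - (?N - x) * (?c n k / (of_nat k + x))) = 0"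
    using step by (simp cong: sum.cong_simp)
  then have "(?N + x) * ?F (Suc n) = (?N - x) * (\<Sum>k\<le>Suc n. ?c n k / (of_nat k + x))"
    by (simp add: sum_subtractf sum_distrib_left del: sum.atMost_Suc of_nat_Suc)
  also have "(\<Sum>k\<le>Suc n. ?c n k / (of_nat k + x)) = ?F n" using top by simp
  finally have rec: "(?N + x) * ?F (Suc n) = (?N - x) * ?F n" .
  have "?F (Suc n) * (\<Prod>j\<le>Suc n. of_nat j + x) = (?N + x) * ?F (Suc n) * (\<Prod>j\<le>n. of_nat j + x)"
    by (simp del: sum.atMost_Suc of_nat_Suc)
  also have "\<dots> = (?N - x) * (?F n * (\<Prod>j\<le>n. of_nat j + x))"
    unfolding rec by (simp only: mult.assoc)
  also have "?F n * (\<Prod>j\<le>n. of_nat j + x) = (\<Prod>j=1..n. of_nat j - x)"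
    using Suc by simp
  finally show ?case by (simp del: sum.atMost_Suc of_nat_Suc)
qed

section \<open>Reduction of the hypergeometric sum modulo \<open>p\<^sup>2\<close>\<close>

definition harmonic :: "nat \<Rightarrow> rat"
  where "harmonic n = (\<Sum>i=1..n. inverse (of_nat i))"

lemma harmonic_0 [simp]: "harmonic 0 = 0"
  by (simp add: harmonic_def)

lemma harmonic_Suc: "harmonic (Suc n) = harmonic n + inverse (of_nat (Suc n))"
  by (simp add: harmonic_def)

context prime_rat
begin

lemma Zp_harmonic: "n < p \<Longrightarrow> harmonic n \<in> Zp"
  unfolding harmonic_def by (intro Zp_sum Zp_inverse_small) auto

lemma Zp_inverse_fact: "n < p \<Longrightarrow> inverse (fact n) \<in> Zp"
  using Zp_inverse_of_nat[of "fact n"] prime_dvd_fact_iff[OF prime_p, of n] by simp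

text \<open>Compare the ratios of consecutive terms: both have denominator
  \<open>4 (k + 1)\<^sup>2\<close>, and the numerators are
  \<open>(2 k + 1)\<^sup>2 - p\<^sup>2\<close> and \<open>(2 k + 1)\<^sup>2\<close>. The denominator
  is a unit because \<open>p\<close> is odd and \<open>k + 1 \<le> n < p\<close>.\<close>

lemma pcong_legendre_coeff:
  assumes "p = 2 * n + 1" "k \<le> n"
  shows "pcong 2 (legendre_coeff n k) ((of_nat ((2 * k) choose k))\<^sup>2 * (1 / 16 ^ k))"
  using assms(2)
proof (induction k)
  case 0
  then show ?case by (simp add: legendre_coeff_def)
next
  case (Suc k)
  let ?d = "\<lambda>k. (of_nat ((2 * k) choose k))\<^sup>2 * (1 / 16 ^ k) :: rat"
  let ?u = "inverse (of_nat (4 * (k + 1)\<^sup>2)) :: rat"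
  let ?o = "(of_nat (2 * k + 1))\<^sup>2 :: rat"
  have "\<not> p dvd 4 * (k + 1)\<^sup>2"
  proof
    assume "p dvd 4 * (k + 1)\<^sup>2"
    then have "p dvd 4 \<or> p dvd k + 1"
      using prime_p by (auto simp: prime_dvd_mult_iff prime_dvd_power_iff)
    then have "p dvd 2 ^ 2 \<or> p \<le> k + 1" by (auto dest: dvd_imp_le)
    then have "p dvd 2 \<or> p \<le> k + 1" using prime_p prime_dvd_power by blast
    then have "p \<le> 2 \<or> p \<le> k + 1" by (auto dest: dvd_imp_le)
    then show False using assms Suc.prems by auto
  qed
  then have u: "?u \<in> Zp" by (rule Zp_inverse_of_nat)
  have k1: "(of_nat k + 1 :: rat) \<noteq> 0" by (metis of_nat_Suc of_nat_eq_0_iff add.commute nat.distinct(1))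
  have u_eq: "?u = 1 / (4 * (of_nat k + 1)\<^sup>2)" by (simp only: of_nat_mult of_nat_power of_nat_add of_nat_1 of_nat_numeral divide_inverse mult_1_left)
  have c: "legendre_coeff n (Suc k) = legendre_coeff n k * (?o - (of_nat p)\<^sup>2) * ?u"
  proof -
    have "of_nat (Suc k) * of_nat (n choose Suc k) = ((of_nat n - of_nat k) * of_nat (n choose k) :: rat)"
      using Suc.prems binomial_absorb_comp[of n k] binomial_absorption[of k "n - 1"]
      by (metis Suc_leD Suc_diff_1 binomial_absorption diff_is_0_eq' not_less_eq_eq of_nat_diff of_nat_mult zero_less_diff gr0I mult.commute binomial_absorb_comp)
    then have 1: "(of_nat (n choose Suc k) :: rat) = (of_nat n - of_nat k) * of_nat (n choose k) / (of_nat k + 1)"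
      using k1 by (simp add: field_simps)
    have "Suc k * ((n + Suc k) choose Suc k) = (n + Suc k) * ((n + k) choose k)"
      using Suc_times_binomial[of k "n + k"] by simp
    then have "(of_nat k + 1) * of_nat ((n + Suc k) choose Suc k) = ((of_nat n + of_nat k + 1) * of_nat ((n + k) choose k) :: rat)"
      by (metis (mono_tags, lifting) add.assoc of_nat_Suc of_nat_add of_nat_mult add.commute)
    then have 2: "(of_nat ((n + Suc k) choose Suc k) :: rat) = (of_nat n + of_nat k + 1) * of_nat ((n + k) choose k) / (of_nat k + 1)"
      using k1 by (simp add: field_simps)
    have 3: "?o - (of_nat p)\<^sup>2 = - (4 * ((of_nat n - of_nat k) * (of_nat n + of_nat k + 1)))"
      unfolding assms(1) by (simp add: power2_eq_square algebra_simps)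
    have gen: "- 1 * s * (x * A / K) * (y * B / K) = s * A * B * - (4 * (x * y)) * (1 / (4 * K\<^sup>2))"
      if "K \<noteq> 0" for s x y A B K :: rat
      using that by (simp add: field_simps power2_eq_square)
    show ?thesis unfolding legendre_coeff_def 1 2 3 u_eq power_Suc by (rule gen[OF k1])
  qed
  have d: "?d (Suc k) = ?d k * ?o * ?u"
  proof -
    have "Suc k * (Suc (Suc (2 * k)) choose Suc k) = Suc (Suc (2 * k)) * (Suc (2 * k) choose k)"
      by (rule Suc_times_binomial)
    moreover have "Suc k * (Suc (2 * k) choose k) = Suc (2 * k) * ((2 * k) choose k)"
      using binomial_absorb_comp[of "Suc (2 * k)" k] by simp
    ultimately have "Suc k * (Suc k * (Suc (Suc (2 * k)) choose Suc k)) = Suc (Suc (2 * k)) * (Suc (2 * k) * ((2 * k) choose k))"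
      by (metis mult.left_commute)
    moreover have "Suc (Suc (2 * k)) = 2 * Suc k" by simp
    ultimately have "Suc k * (Suc k * (2 * Suc k choose Suc k)) = Suc k * (2 * (Suc (2 * k) * ((2 * k) choose k)))"
      by (metis mult.assoc mult.commute)
    then have "Suc k * (2 * Suc k choose Suc k) = 2 * (Suc (2 * k) * ((2 * k) choose k))"
      by (metis mult_cancel1 nat.distinct(1))
    then have "of_nat (Suc k) * of_nat (2 * Suc k choose Suc k) = (2 * (of_nat (Suc (2 * k)) * of_nat ((2 * k) choose k)) :: rat)"
      by (metis of_nat_mult of_nat_numeral)
    then have 1: "(of_nat (2 * Suc k choose Suc k) :: rat) = 2 * (of_nat (2 * k + 1) * of_nat ((2 * k) choose k)) / (of_nat k + 1)"
      using k1 by (simp add: field_simps del: binomial_Suc_Suc mult_Suc_right)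
    have gen: "(2 * (w * B) / K)\<^sup>2 * (1 / (16 * e)) = B\<^sup>2 * (1 / e) * w\<^sup>2 * (1 / (4 * K\<^sup>2))"
      if "K \<noteq> 0" "e \<noteq> 0" for w B K e :: rat
      using that by (simp add: field_simps power2_eq_square)
    show ?thesis unfolding 1 u_eq power_Suc[of 16] by (rule gen[OF k1]) simp
  qed
  have "pcong 2 (legendre_coeff n k * (?o - (of_nat p)\<^sup>2) * ?u) (?d k * (?o - 0) * ?u)"
    using Suc u pcong_p_sq_0[of 1] by (intro pcong_mult_right pcong_mult pcong_diff pcong_refl) auto
  then show ?case unfolding c d by simp
qed

text \<open>In this range \<open>p\<close> divides \<open>(2 k)!\<close> but not \<open>k!\<close>,
  hence the central binomial coefficient, and squaring gives \<open>p\<^sup>2\<close>.\<close>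

lemma pcong_central_binomial_0:
  assumes "p = 2 * n + 1" "n < k" "k < p"
  shows "pcong 2 ((of_nat ((2 * k) choose k))\<^sup>2 * (1 / 16 ^ k)) 0"
proof -
  have "p dvd fact (2 * k)" using assms prime_dvd_fact_iff[OF prime_p] by simp
  then have "p dvd fact k * fact k * ((2 * k) choose k)"
    using binomial_fact_lemma[of k "2 * k"] by simp
  then have "p dvd ((2 * k) choose k)"
    using assms prime_p by (simp add: prime_dvd_mult_iff prime_dvd_fact_iff)
  then have "pcong 2 (of_nat (((2 * k) choose k)\<^sup>2)) 0"
    by (intro pcong_0_if_dvd) (simp add: dvd_power_same)
  moreover have "\<not> p dvd 16 ^ k"
  proof
    assume "p dvd 16 ^ k"
    then have "p dvd 2 ^ (4 * k)" by (simp add: power_mult)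
    then have "p dvd 2" using prime_p prime_dvd_power by blast
    then show False using assms dvd_imp_le[of p 2] by auto
  qed
  then have "1 / 16 ^ k \<in> Zp" using Zp_inverse_of_nat[of "16 ^ k"] by (simp add: divide_inverse)
  ultimately show ?thesis using pcong_mult_right by fastforce
qed

text \<open>Pull \<open>i\<close> out of each factor; what remains is \<open>1 - p z / i\<close>,
  where \<open>1 / i\<close> is integral because \<open>i < p\<close>.\<close>

lemma pcong_prod_shift:
  assumes "k \<le> l" "l < p" "z \<in> Zp"
  shows "pcong 2 (\<Prod>i\<in>{k<..l}. of_nat i - of_nat p * z)
    (fact l / fact k * (1 - of_nat p * (z * (harmonic l - harmonic k))))"
proof -
  have fl: "(\<Prod>i\<in>{k<..l}. of_nat i) = (fact l / fact k :: rat)" using assms(1)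
    by (induction l rule: dec_induct) (auto simp: atLeastSucAtMost_greaterThanAtMost[symmetric] atLeastAtMostSuc_conv field_simps)
  have hl: "(\<Sum>i\<in>{k<..l}. inverse (of_nat i)) = harmonic l - harmonic k" using assms(1)
    by (induction l rule: dec_induct) (auto simp: harmonic_Suc atLeastSucAtMost_greaterThanAtMost[symmetric] atLeastAtMostSuc_conv algebra_simps simp del: of_nat_Suc)
  have inv: "inverse (of_nat i) \<in> Zp" if "i \<in> {k<..l}" for i
    using that assms by (intro Zp_inverse_small) auto
  have "(\<Prod>i\<in>{k<..l}. of_nat i - of_nat p * z) =
      (\<Prod>i\<in>{k<..l}. of_nat i * (1 + of_nat p * (- z * inverse (of_nat i))))"
    by (intro prod.cong) (auto simp: field_simps)
  also have "\<dots> = fact l / fact k * (\<Prod>i\<in>{k<..l}. 1 + of_nat p * (- z * inverse (of_nat i)))"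
    by (simp add: prod.distrib fl)
  also have "pcong 2 \<dots> (fact l / fact k * (1 + of_nat p * (\<Sum>i\<in>{k<..l}. - z * inverse (of_nat i))))"
  proof (intro pcong_mult_left pcong_first_order_prod)
    show "fact l / fact k \<in> Zp" unfolding fl[symmetric] by simp
    show "- z * inverse (of_nat i) \<in> Zp" if "i \<in> {k<..l}" for i
      using inv[OF that] assms(3) by (metis Zp_minus Zp_mult)
  qed
  also have "(\<Sum>i\<in>{k<..l}. - z * inverse (of_nat i)) = - (z * (harmonic l - harmonic k))"
    unfolding hl[symmetric] sum_distrib_left sum_negf[symmetric] by simp
  finally show ?thesis by simp
qed

end

context prime_rat
begin

lemma Zp_fact [simp]: "fact k \<in> Zp"
  by (metis Zp_of_nat of_nat_fact)

lemma not_dvd_8: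
  assumes "p > 3" shows "\<not> p dvd 8"
proof
  assume "p dvd 8"
  then have "p dvd 2 ^ 3" by simp
  then have "p dvd 2" using prime_p prime_dvd_power by blast
  then show False using assms dvd_imp_le[of p 2] by simp
qed

text \<open>Among the \<open>k < p\<close> only \<open>k0\<close> makes \<open>8 k + a\<close>
  divisible by \<open>p\<close>, and multiplying by \<open>h\<close> clears the denominator left
  there. The terms with \<open>k > n\<close> vanish modulo \<open>p\<^sup>2\<close>, the others
  become Legendre coefficients, and the partial fraction identity leaves a quotient of shifted
  factorials, to be expanded to first order in \<open>p\<close>.\<close>

lemma pcong_hypergeometric_sum:
  assumes p: "p = 2 * n + 1" "p > 3" and k0: "k0 \<le> n" and h: "h \<in> {1, 3}" and a: "8 * k0 + a = h * p"
  shows "pcong 2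
    (of_nat h * (\<Sum>k=0..p-1. (of_nat ((2 * k) choose k))\<^sup>2 * (1 / 16 ^ k) * (of_nat p / of_nat (8 * k + a))))
    ((of_nat (n choose k0))\<^sup>2 * (1 - of_nat p *
      (harmonic n - (1 - of_nat h / 4) * harmonic (n - k0) - of_nat h / 4 * harmonic k0)))"
proof -
  define d :: "nat \<Rightarrow> rat" where "d k = (of_nat ((2 * k) choose k))\<^sup>2 * (1 / 16 ^ k)" for k
  define c :: "nat \<Rightarrow> rat" where "c = legendre_coeff n"
  define q where "q k = (of_nat p / of_nat (8 * k + a) :: rat)" for k
  \<comment> \<open>With these values \<open>k + x = (8 k + a) / 8\<close> and
    \<open>h p / (8 k + a) = t / (k + x)\<close>; in particular \<open>k0 + x = t\<close>.\<close>
  define z :: rat where "z = of_nat h / 8"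
  define t where "t = of_nat p * z"
  define x where "x = t - of_nat k0"
  have inv2: "inverse (of_nat 8) \<in> Zp"
    by (rule Zp_inverse_of_nat[OF not_dvd_8[OF p(2)]])
  have z: "z \<in> Zp" unfolding z_def using Zp_divide[OF Zp_of_nat[of h] inv2] by simp
  have h0: "(of_nat h :: rat) \<noteq> 0" "h < p" "h > 0" using h p by auto
  then have t0: "t \<noteq> 0" by (simp add: t_def z_def)
  have x: "of_nat k + x = of_nat (8 * k + a) / 8" for k
  proof -
    have "(8 * of_nat k0 + of_nat a :: rat) = of_nat h * of_nat p"
      using a by (metis of_nat_add of_nat_mult of_nat_numeral)
    then show ?thesis by (simp add: x_def t_def z_def field_simps)
  qed
  have ndvd: "\<not> p dvd 8 * k + a" if "k < p" "k \<noteq> k0" for k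
  proof
    assume "p dvd 8 * k + a"
    then have "int p dvd (8 * int k + int a) - (8 * int k0 + int a)"
      using a by (metis dvd_diff dvd_triv_right of_nat_add of_nat_dvd_iff of_nat_mult of_nat_numeral)
    then have "int p dvd 8 * (int k - int k0)" by (simp add: algebra_simps)
    moreover have "\<not> int p dvd 8" using not_dvd_8[OF p(2)] by (metis int_dvd_int_iff of_nat_numeral)
    ultimately have "int p dvd int k - int k0"
      using prime_p prime_dvd_multD[of "int p" 8 "int k - int k0"] by auto
    moreover have "\<bar>int k - int k0\<bar> < int p" using that k0 p by auto
    ultimately show False using that dvd_imp_le_int[of "int k - int k0" "int p"] by auto
  qed
  have q: "q k \<in> Zp" if "k < p" for k
  proof (cases "k = k0")
    case True
    then have "q k = inverse (of_nat h)" unfolding q_def using a h0 by (simp add: field_simps)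
    then show ?thesis using Zp_inverse_small[of h] h0 by simp
  next
    case False
    then show ?thesis unfolding q_def by (intro Zp_divide Zp_of_nat Zp_inverse_of_nat ndvd that)
  qed
  have "(\<Sum>k=0..p-1. d k * q k) = (\<Sum>k\<le>n. d k * q k) + (\<Sum>k\<in>{n<..p-1}. d k * q k)"
  proof -
    have split: "{0..p-1} = {..n} \<union> {n<..p-1}" using p by auto
    show ?thesis unfolding split by (rule sum.union_disjoint) auto
  qed
  also have "pcong 2 \<dots> ((\<Sum>k\<le>n. c k * q k) + (\<Sum>k\<in>{n<..p-1}. 0))"
  proof (intro pcong_add pcong_sum)
    fix k assume "k \<in> {..n}"
    then show "pcong 2 (d k * q k) (c k * q k)"
      unfolding c_def d_def using p q pcong_legendre_coeff[of n k]
      by (intro pcong_mult_right pcong_sym[OF pcong_legendre_coeff]) auto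
  next
    fix k assume k: "k \<in> {n<..p-1}"
    then have "pcong 2 (d k * q k) (0 * q k)"
      unfolding d_def using p q by (intro pcong_mult_right pcong_central_binomial_0[of n]) auto
    then show "pcong 2 (d k * q k) 0" by simp
  qed
  also have "\<dots> = (\<Sum>k\<le>n. c k * q k)" by simp
  finally have S: "pcong 2 (of_nat h * (\<Sum>k=0..p-1. d k * q k)) (of_nat h * (\<Sum>k\<le>n. c k * q k))"
    by (rule pcong_mult_left[rotated]) simp
  define A where "A = of_nat h * (\<Sum>k\<le>n. c k * q k)"
  have A: "A \<in> Zp" using pcong_Zp[OF S] by (simp add: A_def)
  have "of_nat h * (c k * q k) = t * (c k / (of_nat k + x))" for k
    unfolding x by (simp add: q_def t_def z_def)
  then have A_eq: "A = t * (\<Sum>k\<le>n. c k / (of_nat k + x))"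
    by (simp add: A_def sum_distrib_left)
  define D where "D = (\<Prod>j\<in>{..n}-{k0}. of_nat j + x)"
  have nz: "of_nat j + x \<noteq> 0" if "j \<le> n" for j
  proof (cases "j = k0")
    case True
    then show ?thesis using t0 by (simp add: x_def)
  next
    case False
    then have "\<not> p dvd 8 * j + a" using ndvd that p by simp
    then have "8 * j + a \<noteq> 0" by (metis dvd_0_right)
    then show ?thesis unfolding x by (simp del: of_nat_add of_nat_mult add_is_0)
  qed
  \<comment> \<open>The factor at \<open>k0\<close> is \<open>t\<close>, the only one divisible by
    \<open>p\<close>; it cancels against the \<open>t\<close> in front of the partial fraction
    sum.\<close>
  have "(\<Prod>j\<le>n. of_nat j + x) = t * D"
    unfolding D_def using k0 by (subst prod.remove[of _ k0]) (auto simp: x_def)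
  then have AD: "A * D = (\<Prod>j=1..n. of_nat j - x)"
    using legendre_coeff_partial_fractions[of n x, OF nz] by (simp add: A_eq c_def mult_ac)
  define D0 :: rat where "D0 = (- 1) ^ k0 * fact k0 * fact (n - k0)"
  have lt: "k0 < p" "n < p" "n - k0 < p" "n - k0 \<le> n" "k0 \<le> n" using k0 p by auto
  have "D = (\<Prod>j<k0. of_nat j + x) * (\<Prod>j\<in>{k0<..n}. of_nat j + x)"
  proof -
    have split: "{..n} - {k0} = {..<k0} \<union> {k0<..n}" using k0 by auto
    show ?thesis unfolding D_def split by (rule prod.union_disjoint) auto
  qed
  \<comment> \<open>Up to multiples of \<open>p\<close> the factors below the pole are
    \<open>- k0, ..., - 1\<close>; reversing their order gives a sign and a shifted
    factorial.\<close>
  also have "(\<Prod>j<k0. of_nat j + x) = (\<Prod>i\<in>{0<..k0}. (- 1) * (of_nat i - of_nat p * z))"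
    by (rule prod.reindex_bij_witness[of _ "\<lambda>i. k0 - i" "\<lambda>j. k0 - j"]) (auto simp: x_def t_def)
  also have "\<dots> = (- 1) ^ k0 * (\<Prod>i\<in>{0<..k0}. of_nat i - of_nat p * z)"
    by (simp only: prod.distrib prod_constant card_greaterThanAtMost) simp
  also have "(\<Prod>j\<in>{k0<..n}. of_nat j + x) = (\<Prod>i\<in>{0<..n-k0}. of_nat i - of_nat p * (- z))"
    using k0 by (intro prod.reindex_bij_witness[of _ "\<lambda>i. i + k0" "\<lambda>j. j - k0"]) (auto simp: x_def t_def)
  finally have "D = (- 1) ^ k0 * (\<Prod>i\<in>{0<..k0}. of_nat i - of_nat p * z) *
    (\<Prod>i\<in>{0<..n-k0}. of_nat i - of_nat p * (- z))" .
  also have "pcong 2 \<dots> ((- 1) ^ k0 * (fact k0 / fact 0 * (1 - of_nat p * (z * (harmonic k0 - harmonic 0)))) *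
    (fact (n - k0) / fact 0 * (1 - of_nat p * (- z * (harmonic (n - k0) - harmonic 0)))))"
    using lt z by (intro pcong_mult pcong_refl pcong_prod_shift) auto
  also have "\<dots> = D0 * ((1 + of_nat p * (- z * harmonic k0)) * (1 + of_nat p * (z * harmonic (n - k0))))"
    by (simp add: D0_def)
  also have "pcong 2 \<dots> (D0 * (1 + of_nat p * (- z * harmonic k0 + z * harmonic (n - k0))))"
    using lt z by (intro pcong_mult_left pcong_first_order_mult) (auto simp: D0_def Zp_harmonic)
  finally have D: "pcong 2 D (D0 * (1 + of_nat p * (- z * harmonic k0 + z * harmonic (n - k0))))" .
  define N0 :: rat where "N0 = fact n / fact k0 * ((- 1) ^ k0 * (fact n / fact (n - k0)))"
  have "(\<Prod>j=1..n. of_nat j - x) = (\<Prod>j\<in>{0<..n-k0}. of_nat j - x) * (\<Prod>j\<in>{n-k0<..n}. of_nat j - x)"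
  proof -
    have split: "{1..n} = {0<..n-k0} \<union> {n-k0<..n}" using k0 by auto
    show ?thesis unfolding split by (rule prod.union_disjoint) auto
  qed
  also have "(\<Prod>j\<in>{0<..n-k0}. of_nat j - x) = (\<Prod>i\<in>{k0<..n}. of_nat i - of_nat p * z)"
    using k0 by (intro prod.reindex_bij_witness[of _ "\<lambda>i. i - k0" "\<lambda>j. j + k0"]) (auto simp: x_def t_def)
  \<comment> \<open>Here \<open>j - x = j + k0 - p z\<close> with \<open>j + k0\<close> beyond
    \<open>n\<close>. The reflection \<open>i = p - j - k0\<close> maps the range to itself and
    replaces the shift \<open>z\<close> by \<open>1 - z\<close>.\<close>
  also have "(\<Prod>j\<in>{n-k0<..n}. of_nat j - x) = (\<Prod>i\<in>{n-k0<..n}. (- 1) * (of_nat i - of_nat p * (1 - z)))"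
    using k0 p(1) by (intro prod.reindex_bij_witness[of _ "\<lambda>i. p - i - k0" "\<lambda>j. p - j - k0"])
      (auto simp: x_def t_def of_nat_diff algebra_simps)
  also have "\<dots> = (- 1) ^ k0 * (\<Prod>i\<in>{n-k0<..n}. of_nat i - of_nat p * (1 - z))"
    using k0 by (simp only: prod.distrib prod_constant card_greaterThanAtMost) simp
  also have "pcong 2 ((\<Prod>i\<in>{k0<..n}. of_nat i - of_nat p * z) *
      ((- 1) ^ k0 * (\<Prod>i\<in>{n-k0<..n}. of_nat i - of_nat p * (1 - z))))
    (fact n / fact k0 * (1 - of_nat p * (z * (harmonic n - harmonic k0))) *
     ((- 1) ^ k0 * (fact n / fact (n - k0) * (1 - of_nat p * ((1 - z) * (harmonic n - harmonic (n - k0)))))))"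
    using lt z by (intro pcong_mult pcong_refl pcong_prod_shift) auto
  also have "\<dots> = N0 * ((1 + of_nat p * (- z * (harmonic n - harmonic k0))) *
      (1 + of_nat p * (- ((1 - z) * (harmonic n - harmonic (n - k0))))))"
    by (simp add: N0_def mult_ac)
  also have "pcong 2 \<dots> (N0 * (1 + of_nat p * (- z * (harmonic n - harmonic k0) + - ((1 - z) * (harmonic n - harmonic (n - k0))))))"
  proof -
    have "inverse (fact k0) \<in> Zp" "inverse (fact (n - k0)) \<in> Zp" using lt by (auto intro!: Zp_inverse_fact)
    then have "N0 \<in> Zp" unfolding N0_def by (intro Zp_mult Zp_divide Zp_power Zp_minus Zp_numeral Zp_fact)
    then show ?thesis
      using lt z by (intro pcong_mult_left pcong_first_order_mult) (auto simp: Zp_harmonic)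
  qed
  finally have N: "pcong 2 (A * D) (N0 * (1 + of_nat p * (- z * (harmonic n - harmonic k0) + - ((1 - z) * (harmonic n - harmonic (n - k0))))))"
    unfolding AD .
  have fz: "(fact k0 :: rat) \<noteq> 0" "(fact (n - k0) :: rat) \<noteq> 0" "(fact n :: rat) \<noteq> 0" by auto
  have N0: "N0 = D0 * (of_nat (n choose k0))\<^sup>2"
    using fz k0 by (simp add: N0_def D0_def binomial_fact power2_eq_square)
  define u where "u = - z * harmonic k0 + z * harmonic (n - k0)"
  define v where "v = - z * (harmonic n - harmonic k0) + - ((1 - z) * (harmonic n - harmonic (n - k0)))"
  have uv: "u \<in> Zp" "v \<in> Zp" unfolding u_def v_def using z lt by (auto simp: Zp_harmonic)
  have "pcong 2 (D0 * (A * (1 + of_nat p * u))) (D0 * ((of_nat (n choose k0))\<^sup>2 * (1 + of_nat p * v)))"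
    using pcong_trans[OF pcong_mult_left[OF A pcong_sym[OF D]] N] N0 by (simp add: u_def v_def mult_ac)
  moreover have "inverse D0 \<in> Zp"
  proof -
    have "inverse (fact k0) \<in> Zp" "inverse (fact (n - k0)) \<in> Zp" using lt by (auto intro!: Zp_inverse_fact)
    then show ?thesis unfolding D0_def by (simp add: power_one_over flip: power_inverse)
  qed
  moreover have "D0 \<noteq> 0" by (simp add: D0_def)
  ultimately have "pcong 2 (A * (1 + of_nat p * u)) ((of_nat (n choose k0))\<^sup>2 * (1 + of_nat p * v))"
    using pcong_cancel by blast
  then have "pcong 2 A ((of_nat (n choose k0))\<^sup>2 * (1 + of_nat p * v) * (1 - of_nat p * u))"
    using uv A by (intro pcong_first_order_inverse)
  also have "\<dots> = (of_nat (n choose k0))\<^sup>2 * ((1 + of_nat p * v) * (1 + of_nat p * (- u)))"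
    by simp
  also have "pcong 2 \<dots> ((of_nat (n choose k0))\<^sup>2 * (1 + of_nat p * (v + - u)))"
    using uv by (intro pcong_mult_left pcong_first_order_mult) auto
  also have "v + - u = - (harmonic n - (1 - of_nat h / 4) * harmonic (n - k0) - of_nat h / 4 * harmonic k0)"
    by (simp add: u_def v_def z_def field_simps)
  finally have "pcong 2 A ((of_nat (n choose k0))\<^sup>2 * (1 + of_nat p *
      - (harmonic n - (1 - of_nat h / 4) * harmonic (n - k0) - of_nat h / 4 * harmonic k0)))" .
  from pcong_trans[OF S[folded A_def] this] show ?thesis
    unfolding d_def q_def by (simp only: mult_minus_right add_uminus_conv_diff)
qed

end

section \<open>Sections of binomial coefficients modulo \<open>p\<^sup>2\<close>\<close>

lemma prime_dvd_choose_multiple: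
  fixes p :: nat
  assumes "prime p" "\<not> p dvd k"
  shows "p dvd ((p * n) choose k)"
proof (cases "k = 0 \<or> n = 0")
  case True
  then show ?thesis using assms by (cases k) auto
next
  case False
  then obtain j N where "k = Suc j" "p * n = Suc N"
    using assms by (metis mult_is_0 not0_implies_Suc not_prime_0)
  then have "k * ((p * n) choose k) = p * n * (N choose j)"
    using Suc_times_binomial_eq[of N j] by (simp add: mult.commute)
  then have "p dvd k * ((p * n) choose k)" by simp
  then show ?thesis using assms prime_dvd_mult_iff by blast
qed

text \<open>Split \<open>(1 + t) ^ (p (n + 1))\<close> as \<open>(1 + t) ^ p\<close> times
  \<open>(1 + t) ^ (p n)\<close>. A term of the convolution with \<open>0 < k < p\<close> is a
  product of two binomial coefficients that are both divisible by \<open>p\<close>, so only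
  \<open>k = 0\<close> and \<open>k = p\<close> survive, and these are Pascal's rule for
  \<open>n\<close>.\<close>

lemma choose_prime_multiples_cong:
  fixes p :: nat
  assumes "prime p"
  shows "[(p * n) choose (p * u) = n choose u] (mod p\<^sup>2)"
proof (induction n arbitrary: u)
  case 0
  have "p * u = 0 \<longleftrightarrow> u = 0" using assms by auto
  then show ?case by (cases "u = 0") (auto simp: binomial_eq_0)
next
  case (Suc n)
  show ?case
  proof (cases u)
    case (Suc v)
    have p: "p > 0" using assms prime_gt_0_nat by blast
    define f where "f k = (p choose k) * ((p * n) choose (p * u - k))" for k
    have "(p * Suc n) choose (p * u) = (\<Sum>k\<le>p * u. f k)"
      unfolding f_def using vandermonde[of p "p * n" "p * u"] by (simp add: add.commute)
    also have "\<dots> = (\<Sum>k\<in>{0,p}. f k) + (\<Sum>k\<in>{..p * u} - {0,p}. f k)"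
      using Suc by (subst sum.subset_diff[of "{0,p}"]) auto
    also have "[\<dots> = (\<Sum>k\<in>{0,p}. f k) + (\<Sum>k\<in>{..p * u} - {0,p}. 0)] (mod p\<^sup>2)"
    proof (intro cong_add cong_sum cong_refl)
      fix k assume k: "k \<in> {..p * u} - {0,p}"
      show "[f k = 0] (mod p\<^sup>2)"
      proof (cases "k < p")
        case True
        then have nd: "\<not> p dvd k" using k by (auto dest: dvd_imp_le)
        then have "\<not> p dvd p * u - k" using k
          by (metis DiffD1 atMost_iff diff_diff_cancel dvd_diff_nat dvd_triv_left)
        then have "p dvd (p * n) choose (p * u - k)" using prime_dvd_choose_multiple assms by blast
        moreover have "p dvd p choose k" using prime_dvd_choose_multiple[OF assms nd, of 1] by simp
        ultimately show ?thesis unfolding f_def power2_eq_square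
          by (simp add: cong_0_iff mult_dvd_mono)
      next
        case False
        then show ?thesis using k by (simp add: f_def binomial_eq_0)
      qed
    qed
    also have "(\<Sum>k\<in>{0,p}. f k) + (\<Sum>k\<in>{..p * u} - {0,p}. 0) = ((p * n) choose (p * u)) + ((p * n) choose (p * v))"
      using p Suc by (simp add: f_def)
    also have "[\<dots> = (n choose u) + (n choose v)] (mod p\<^sup>2)"
      by (intro cong_add Suc.IH)
    finally show ?thesis using Suc by (simp add: add.commute)
  qed simp
qed

text \<open>As polynomials modulo \<open>p\<close>, \<open>(1 + t) ^ (p (n + 1) - 1)\<close> is
  \<open>(1 + t ^ p) ^ n\<close> times
  \<open>(1 + t ^ p) / (1 + t) = 1 - t + ... + t ^ (p - 1)\<close>. The proof descends by Pascal's
  rule, since \<open>(p (n + 1) choose k)\<close> vanishes modulo \<open>p\<close> unless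
  \<open>p\<close> divides \<open>k\<close>. The induction runs over the whole index
  \<open>p u + v\<close> because the case \<open>v = 0\<close> steps back into the preceding
  block.\<close>

lemma choose_pred_prime_multiple_cong:
  fixes p :: nat
  assumes "prime p" "odd p" "v < p"
  shows "[int ((p * Suc n - 1) choose (p * u + v)) = (- 1) ^ v * int (n choose u)] (mod int p)"
  using assms(3)
proof (induction "p * u + v" arbitrary: u v)
  case 0
  then show ?case using assms by (auto simp: prime_gt_0_nat)
next
  case (Suc j)
  have p: "p > 1" using assms prime_gt_1_nat by blast
  then obtain N where N: "p * Suc n = Suc N" by (metis Suc_pred nat_0_less_mult_iff zero_less_Suc zero_less_one order_less_trans)
  have pascal: "int ((p * Suc n - 1) choose (p * u + v)) = int ((p * Suc n) choose (p * u + v)) - int ((p * Suc n - 1) choose j)"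
    unfolding Suc(2)[symmetric] N by simp
  show ?case
  proof (cases v)
    case (Suc w)
    have "\<not> p dvd v" using Suc \<open>v < p\<close> by (auto dest: dvd_imp_le)
    then have "\<not> p dvd p * u + v" by (simp add: dvd_add_right_iff)
    then have 1: "[int ((p * Suc n) choose (p * u + v)) = 0] (mod int p)"
      using prime_dvd_choose_multiple[OF assms(1)] by (simp add: cong_0_iff del: mult_Suc_right)
    have "[int ((p * Suc n - 1) choose j) = (- 1) ^ w * int (n choose u)] (mod int p)"
      using Suc.hyps(1)[of u w] Suc.hyps(2) Suc \<open>v < p\<close> by simp
    from cong_diff[OF 1 this] show ?thesis unfolding pascal using Suc by simp
  next
    case 0
    then obtain u' where u': "u = Suc u'" using Suc.hyps(2) by (cases u) auto
    have j: "j = p * u' + (p - 1)" using Suc.hyps(2) 0 u' p by simp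
    have "[int ((p * Suc n - 1) choose j) = (- 1) ^ (p - 1) * int (n choose u')] (mod int p)"
      unfolding j using Suc.hyps(1)[of u' "p - 1"] j p by simp
    moreover have "[int ((p * Suc n) choose (p * u + v)) = int (Suc n choose u)] (mod int p)"
      using choose_prime_multiples_cong[OF assms(1), of "Suc n" u] 0
      by (metis add.right_neutral cong_dvd_modulus_nat cong_int_iff dvd_triv_left power2_eq_square)
    ultimately have "[int ((p * Suc n) choose (p * u + v)) - int ((p * Suc n - 1) choose j) =
        int (Suc n choose u) - (- 1) ^ (p - 1) * int (n choose u')] (mod int p)"
      by (rule cong_diff[rotated])
    then show ?thesis unfolding pascal using 0 u' assms(2) by simp
  qed
qed

text \<open>Both sides are the coefficient of \<open>t ^ r\<close> in
  \<open>(1 + t) ^ n log (1 + t)\<close>, the right one read as the derivative of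
  \<open>(n choose r)\<close> with respect to \<open>n\<close>. Multiplication by
  \<open>1 + t\<close> is Pascal's rule, hence the induction on \<open>n\<close>.\<close>

lemma sum_choose_div_eq_harmonic:
  assumes "r \<le> n"
  shows "(\<Sum>i=1..r. (- 1) ^ (i + 1) * of_nat (n choose (r - i)) / of_nat i) =
    of_nat (n choose r) * (harmonic n - harmonic (n - r))"
  using assms
proof (induction n arbitrary: r)
  case 0
  then show ?case by simp
next
  case (Suc n)
  let ?D = "\<lambda>n r. \<Sum>i=1..r. (- 1) ^ (i + 1) * of_nat (n choose (r - i)) / of_nat i :: rat"
  show ?case
  proof (cases r)
    case (Suc s)
    have "?D (Suc n) (Suc s) = (\<Sum>i=1..Suc s. (- 1) ^ (i + 1) * of_nat (n choose (Suc s - i)) / of_nat i +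
        (if i \<le> s then (- 1) ^ (i + 1) * of_nat (n choose (s - i)) / of_nat i else 0))"
    proof (rule sum.cong)
      fix i assume "i \<in> {1..Suc s}"
      then consider "i = Suc s" | "Suc s - i = Suc (s - i)" "i \<le> s" by force
      then show "(- 1) ^ (i + 1) * of_nat (Suc n choose (Suc s - i)) / of_nat i =
        (- 1) ^ (i + 1) * of_nat (n choose (Suc s - i)) / of_nat i +
        (if i \<le> s then (- 1) ^ (i + 1) * of_nat (n choose (s - i)) / of_nat i else 0 :: rat)"
        by cases (auto simp: add_divide_distrib diff_divide_distrib distrib_left)
    qed simp
    also have "\<dots> = ?D n (Suc s) + ?D n s"
      unfolding sum.distrib by (intro arg_cong2[of _ _ _ _ "(+)"] refl sum.mono_neutral_cong_right) auto
    finally have pascal: "?D (Suc n) (Suc s) = ?D n (Suc s) + ?D n s" .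
    have IH: "?D n s = of_nat (n choose s) * (harmonic n - harmonic (n - s))"
      using Suc.IH[of s] Suc.prems Suc by simp
    show ?thesis
    proof (cases "s = n")
      case True
      \<comment> \<open>Here \<open>r = n + 1\<close> exceeds the range of the induction hypothesis
        for \<open>n\<close>. Absorption turns the sum into an alternating row sum without its first
        term, with value \<open>1 / (n + 1)\<close>.\<close>
      have "?D n (Suc n) = (\<Sum>i=1..Suc n. (- 1) ^ (i + 1) * of_nat (Suc n choose i) / of_nat (Suc n))"
      proof (rule sum.cong)
        fix i assume "i \<in> {1..Suc n}"
        then obtain l where l: "i = Suc l" "l \<le> n" by (cases i) auto
        have "Suc l * (Suc n choose Suc l) = Suc n * (n choose (n - l))"
          using Suc_times_binomial[of l n] binomial_symmetric[OF l(2)] by simp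
        then have "of_nat (Suc l) * of_nat (Suc n choose Suc l) = (of_nat (Suc n) * of_nat (n choose (n - l)) :: rat)"
          by (metis of_nat_mult)
        then show "(- 1) ^ (i + 1) * of_nat (n choose (Suc n - i)) / of_nat i =
            ((- 1) ^ (i + 1) * of_nat (Suc n choose i) / of_nat (Suc n) :: rat)"
          unfolding l(1) by (simp add: divide_simps mult_ac del: of_nat_Suc binomial_Suc_Suc)
      qed simp
      also have "\<dots> = - (\<Sum>i=1..Suc n. (- 1) ^ i * of_nat (Suc n choose i)) / of_nat (Suc n)"
        by (simp only: sum_divide_distrib sum_negf[symmetric]) (rule sum.cong, auto)
      also have "(\<Sum>i=1..Suc n. (- 1) ^ i * of_nat (Suc n choose i)) = (- 1 :: rat)"
      proof -
        have "0 = (\<Sum>i=0..Suc n. (- 1) ^ i * of_nat (Suc n choose i) :: rat)"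
          using choose_alternating_sum[of "Suc n", where ?'a = rat] by (simp only: atMost_atLeast0)
        also have "\<dots> = 1 + (\<Sum>i=1..Suc n. (- 1) ^ i * of_nat (Suc n choose i))"
          by (subst sum.atLeast_Suc_atMost) (simp_all del: sum.cl_ivl_Suc binomial_Suc_Suc)
        finally show ?thesis by linarith
      qed
      finally show ?thesis using IH pascal True Suc by (simp add: harmonic_Suc divide_inverse)
    next
      case False
      then have sn: "Suc s \<le> n" using Suc.prems Suc by simp
      then have IH2: "?D n (Suc s) = of_nat (n choose Suc s) * (harmonic n - harmonic (n - Suc s))"
        using Suc.IH[of "Suc s"] by simp
      have ns: "n - s = Suc (n - Suc s)" using sn by simp
      have f1: "of_nat (Suc s) * of_nat (Suc n choose Suc s) = (of_nat (Suc n) * of_nat (n choose s) :: rat)"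
        by (metis Suc_times_binomial of_nat_mult)
      have B: "of_nat (Suc n choose Suc s) = (of_nat (n choose s) + of_nat (n choose Suc s) :: rat)"
        by (metis binomial_Suc_Suc of_nat_add)
      have f2: "of_nat (Suc s) * of_nat (n choose Suc s) = (of_nat (n - s) * of_nat (n choose s) :: rat)"
        using f1 sn unfolding B by (simp add: algebra_simps of_nat_diff)
      have "of_nat (n choose Suc s) * inverse (of_nat (n - s)) = (of_nat (n choose s) / of_nat (Suc s) :: rat)"
        using f2 sn by (simp add: field_simps del: of_nat_Suc of_nat_diff)
      moreover have "of_nat (Suc n choose Suc s) * inverse (of_nat (Suc n)) = (of_nat (n choose s) / of_nat (Suc s) :: rat)"
        using f1 by (simp add: field_simps del: of_nat_Suc binomial_Suc_Suc)
      ultimately have e: "of_nat (n choose Suc s) * inverse (of_nat (n - s)) =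
          (of_nat (Suc n choose Suc s) * inverse (of_nat (Suc n)) :: rat)" by simp
      have h: "harmonic (n - s) = harmonic (n - Suc s) + inverse (of_nat (n - s))"
        unfolding ns harmonic_Suc ..
      have gen: "B * (hn + i2 - (hm + i1)) = c2 * (hn - hm) + c1 * (hn - (hm + i1))"
        if "B = c1 + c2" "c2 * i1 = B * i2" for B c1 c2 hn hm i1 i2 :: rat
        using that by (simp add: algebra_simps)
      show ?thesis unfolding Suc pascal IH IH2 diff_Suc_Suc h harmonic_Suc[of n] by (rule gen[OF B e, symmetric])
    qed
  qed simp
qed

context prime_rat
begin

text \<open>Absorption gives \<open>k (p n choose k) = p n (p n - 1 choose k - 1)\<close>. One
  factor \<open>p\<close> is explicit, so \<open>k\<close> may be replaced by \<open>i\<close> and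
  the other binomial coefficient by its residue modulo \<open>p\<close>.\<close>

lemma pcong_choose_above:
  assumes "odd p" "0 < i" "i < p" "j \<le> n" "n > 0"
  shows "pcong 2 (of_nat ((p * n) choose (p * j + i)))
    (of_nat p * ((- 1) ^ (i + 1) * ((of_nat n - of_nat j) * of_nat (n choose j) / of_nat i)))"
proof -
  obtain n' where n': "n = Suc n'" using assms by (cases n) auto
  obtain v where v: "i = Suc v" using assms by (cases i) auto
  have p: "p > 1" using prime_p prime_gt_1_nat by blast
  let ?k = "p * j + i"
  let ?B = "of_nat ((p * n - 1) choose (p * j + v)) :: rat"
  have nd: "\<not> p dvd ?k" using assms by (auto simp: dvd_add_right_iff dest: dvd_imp_le)
  have ik: "inverse (of_nat ?k) \<in> Zp" "inverse (of_nat i) \<in> Zp"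
    using nd Zp_inverse_of_nat Zp_inverse_small assms by blast+
  have "Suc (p * n - 1) = p * n" using p assms by (simp add: Suc_pred)
  then have "?k * ((p * n) choose ?k) = p * n * ((p * n - 1) choose (p * j + v))"
    using Suc_times_binomial[of "p * j + v" "p * n - 1"] v by simp
  then have "of_nat ?k * of_nat ((p * n) choose ?k) = (of_nat p * of_nat n * ?B :: rat)"
    by (metis of_nat_mult)
  moreover have "(of_nat ?k :: rat) \<noteq> 0" using assms by (simp del: of_nat_add of_nat_mult)
  ultimately have "of_nat ((p * n) choose ?k) = of_nat p * (inverse (of_nat ?k) * (of_nat n * ?B))"
    by (simp add: field_simps)
  also have "pcong 2 \<dots> (of_nat p * (inverse (of_nat i) * (of_nat n * ((- 1) ^ v * of_nat (n' choose j)))))"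
  proof -
    have "int (p * j) = int ?k - int i" by simp
    then have "pcong 1 (of_int (int ?k)) (of_int (int i))"
      by (intro pcong_of_int) (simp)
    then have "pcong 1 (of_nat ?k) (of_nat i)" by (simp del: of_nat_add of_nat_mult)
    then have "pcong 1 (inverse (of_nat ?k)) (inverse (of_nat i))"
      using ik assms by (intro pcong_inverse) (auto simp del: of_nat_add of_nat_mult)
    moreover have "int p dvd int ((p * n - 1) choose (p * j + v)) - (- 1) ^ v * int (n' choose j)"
      using choose_pred_prime_multiple_cong[OF prime_p assms(1), of v n' j] v assms n'
      by (simp add: cong_iff_dvd_diff)
    then have "pcong 1 (of_int (int ((p * n - 1) choose (p * j + v)))) (of_int ((- 1) ^ v * int (n' choose j)))"
      by (intro pcong_of_int) simp
    then have "pcong 1 ?B ((- 1) ^ v * of_nat (n' choose j))" by simp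
    ultimately have "pcong 1 (inverse (of_nat ?k) * (of_nat n * ?B))
        (inverse (of_nat i) * (of_nat n * ((- 1) ^ v * of_nat (n' choose j))))"
      by (intro pcong_mult pcong_refl) auto
    from pcong_p_mult[OF this] show ?thesis by (simp add: numeral_2_eq_2)
  qed
  also have "of_nat n * ((- 1) ^ v * of_nat (n' choose j)) = ((- 1) ^ (i + 1) * ((of_nat n - of_nat j) * of_nat (n choose j)) :: rat)"
  proof -
    have "(n - j) * (n choose j) = n * (n' choose j)"
      using binomial_absorb_comp[of n j] n' by simp
    then have "(of_nat n - of_nat j) * of_nat (n choose j) = (of_nat n * of_nat (n' choose j) :: rat)"
      using assms by (metis of_nat_diff of_nat_mult)
    then show ?thesis using v by simp
  qed
  finally show ?thesis by (simp add: divide_inverse mult_ac)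
qed

text \<open>The reflection of \<open>pcong_choose_above\<close> under \<open>k\<close> to
  \<open>p n - k\<close>, with \<open>n - j\<close> in place of \<open>j\<close>.\<close>

lemma pcong_choose_below:
  assumes "odd p" "0 < i" "i < p" "0 < j" "j \<le> n"
  shows "pcong 2 (of_nat ((p * n) choose (p * j - i)))
    (of_nat p * ((- 1) ^ (i + 1) * (of_nat j * of_nat (n choose j) / of_nat i)))"
proof -
  have le: "p * j - i \<le> p * n" "i \<le> p * j"
    using assms by (auto simp: le_diff_conv intro: order_trans[OF _ mult_le_mono2[of 1 j p]])
      (metis mult_le_mono2 trans_le_add1)
  have "p * n - (p * j - i) = p * (n - j) + i"
    using le assms by (simp add: diff_mult_distrib2)
  then have "(p * n) choose (p * j - i) = (p * n) choose (p * (n - j) + i)"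
    using binomial_symmetric[OF le(1)] by simp
  moreover have "pcong 2 (of_nat ((p * n) choose (p * (n - j) + i)))
    (of_nat p * ((- 1) ^ (i + 1) * ((of_nat n - of_nat (n - j)) * of_nat (n choose (n - j)) / of_nat i)))"
    using assms by (intro pcong_choose_above) auto
  ultimately show ?thesis using assms by (simp add: of_nat_diff flip: binomial_symmetric)
qed

end

lemma sum_split_at:
  fixes f :: "nat \<Rightarrow> 'a::comm_monoid_add"
  assumes "r \<le> n"
  shows "(\<Sum>j\<le>n. f j) = f r + (\<Sum>i=1..r. f (r - i)) + (\<Sum>i=1..n-r. f (r + i))"
proof -
  have split: "{..n} = insert r ({..<r} \<union> {r<..n})" using assms by auto
  have "(\<Sum>j\<le>n. f j) = f r + ((\<Sum>j<r. f j) + (\<Sum>j\<in>{r<..n}. f j))"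
    unfolding split by (simp add: sum.union_disjoint Int_def)
  also have "(\<Sum>j<r. f j) = (\<Sum>i=1..r. f (r - i))"
    by (rule sum.reindex_bij_witness[of _ "\<lambda>i. r - i" "\<lambda>j. r - j"]) auto
  also have "(\<Sum>j\<in>{r<..n}. f j) = (\<Sum>i=1..n-r. f (r + i))"
    by (rule sum.reindex_bij_witness[of _ "\<lambda>i. r + i" "\<lambda>j. j - r"]) auto
  finally show ?thesis by (simp add: add.assoc)
qed

context prime_rat
begin

text \<open>Shared by both signs of \<open>d\<close>. The term \<open>T r\<close> is the main one; a
  term at distance \<open>i\<close> from it is of order \<open>p\<close> and has weight
  \<open>(a + d i) / i = a / i + d\<close>, or the same with \<open>b\<close>. The parts
  \<open>a / i\<close> and \<open>b / i\<close> add up to harmonic numbers, the constants to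
  \<open>d (n choose r)\<close>, because the alternating row sum vanishes.\<close>

lemma pcong_choose_section_aux:
  assumes r: "r \<le> n" "0 < n" "n < p"
    and T0: "pcong 2 (T r) (of_nat (n choose r))"
    and low: "\<And>i. i \<in> {1..r} \<Longrightarrow> pcong 2 (T (r - i))
      (of_nat p * ((- 1) ^ (i + 1) * ((a + d * of_nat i) * of_nat (n choose (r - i)) / of_nat i)))"
    and high: "\<And>i. i \<in> {1..n-r} \<Longrightarrow> pcong 2 (T (r + i))
      (of_nat p * ((- 1) ^ (i + 1) * ((b + d * of_nat i) * of_nat (n choose (r + i)) / of_nat i)))"
  shows "pcong 2 (\<Sum>j\<le>n. T j) (of_nat (n choose r) *
    (1 + of_nat p * (d + a * (harmonic n - harmonic (n - r)) + b * (harmonic n - harmonic r))))"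
proof -
  let ?C = "of_nat (n choose r) :: rat"
  let ?L = "\<Sum>i=1..r. (- 1) ^ (i + 1) * of_nat (n choose (r - i)) :: rat"
  let ?H = "\<Sum>i=1..n-r. (- 1) ^ (i + 1) * of_nat (n choose (r + i)) :: rat"
  have dist: "(\<Sum>i\<in>I. of_nat p * ((- 1) ^ (i + 1) * ((e + d * of_nat i) * g i / of_nat i))) =
      of_nat p * (e * (\<Sum>i\<in>I. (- 1) ^ (i + 1) * g i / of_nat i) + d * (\<Sum>i\<in>I. (- 1) ^ (i + 1) * g i))"
    if "0 \<notin> I" for I :: "nat set" and e and g :: "nat \<Rightarrow> rat"
  proof -
    have "of_nat p * ((- 1) ^ (i + 1) * ((e + d * of_nat i) * g i / of_nat i)) =
       of_nat p * (e * ((- 1) ^ (i + 1) * g i / of_nat i)) + of_nat p * (d * ((- 1) ^ (i + 1) * g i))" if "i \<in> I" for i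
    proof -
      have "i \<noteq> 0" using that \<open>0 \<notin> I\<close> by metis
      then show ?thesis by (simp add: field_simps)
    qed
    then have "(\<Sum>i\<in>I. of_nat p * ((- 1) ^ (i + 1) * ((e + d * of_nat i) * g i / of_nat i))) =
        (\<Sum>i\<in>I. of_nat p * (e * ((- 1) ^ (i + 1) * g i / of_nat i)) + of_nat p * (d * ((- 1) ^ (i + 1) * g i)))"
      by (intro sum.cong refl)
    then show ?thesis by (simp only: sum.distrib sum_distrib_left distrib_left)
  qed
  have z1: "0 \<notin> {1..r}" and z2: "0 \<notin> {1..n-r}" by auto
  have alt: "?L + ?H = ?C"
  proof -
    have "0 = (- 1) ^ r * (\<Sum>j\<le>n. (- 1) ^ j * of_nat (n choose j) :: rat)"
      using choose_alternating_sum[of n] r by simp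
    also have "\<dots> = (\<Sum>j\<le>n. (- 1) ^ (r + j) * of_nat (n choose j))"
      by (simp add: sum_distrib_left power_add mult.assoc)
    also have "\<dots> = (- 1) ^ (r + r) * ?C + (\<Sum>i=1..r. (- 1) ^ (r + (r - i)) * of_nat (n choose (r - i))) +
        (\<Sum>i=1..n-r. (- 1) ^ (r + (r + i)) * of_nat (n choose (r + i)))"
      by (rule sum_split_at[OF r(1)])
    also have "(\<Sum>i=1..r. (- 1) ^ (r + (r - i)) * of_nat (n choose (r - i))) = - ?L"
    proof -
      have eq: "(- 1 :: rat) ^ (r + (r - i)) = - ((- 1) ^ (i + 1))" if "i \<in> {1..r}" for i
      proof -
        have "even (r + (r - i)) = even i" using that by (auto simp: even_diff_nat)
        then show ?thesis by (simp add: minus_one_power_iff)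
      qed
      show ?thesis unfolding sum_negf[symmetric]
      proof (rule sum.cong)
        fix i assume "i \<in> {1..r}"
        then show "(- 1) ^ (r + (r - i)) * of_nat (n choose (r - i)) =
            - ((- 1) ^ (i + 1) * of_nat (n choose (r - i)) :: rat)"
          by (simp only: eq mult_minus_left)
      qed simp
    qed
    also have "(\<Sum>i=1..n-r. (- 1) ^ (r + (r + i)) * of_nat (n choose (r + i))) = - ?H"
    proof -
      have "(- 1 :: rat) ^ (r + (r + i)) = - ((- 1) ^ (i + 1))" for i
        by (simp add: minus_one_power_iff)
      then show ?thesis by (simp add: sum_negf cong: sum.cong)
    qed
    finally show ?thesis by simp
  qed
  have Hr: "(\<Sum>i=1..n-r. (- 1) ^ (i + 1) * of_nat (n choose (r + i)) / of_nat i) = ?C * (harmonic n - harmonic r)"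
  proof -
    have "(\<Sum>i=1..n-r. (- 1) ^ (i + 1) * of_nat (n choose (r + i)) / of_nat i) =
      (\<Sum>i=1..n-r. (- 1) ^ (i + 1) * of_nat (n choose (n - r - i)) / of_nat i :: rat)"
    proof (rule sum.cong)
      fix i assume i: "i \<in> {1..n-r}"
      have "n choose (r + i) = n choose (n - (r + i))"
        using i by (intro binomial_symmetric) auto
      then show "(- 1) ^ (i + 1) * of_nat (n choose (r + i)) / of_nat i =
          ((- 1) ^ (i + 1) * of_nat (n choose (n - r - i)) / of_nat i :: rat)" by simp
    qed simp
    then show ?thesis using sum_choose_div_eq_harmonic[of "n - r" n] r
      by (simp flip: binomial_symmetric)
  qed
  have "(\<Sum>j\<le>n. T j) = T r + (\<Sum>i=1..r. T (r - i)) + (\<Sum>i=1..n-r. T (r + i))"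
    by (rule sum_split_at[OF r(1)])
  also have "pcong 2 \<dots> (?C +
      (\<Sum>i=1..r. of_nat p * ((- 1) ^ (i + 1) * ((a + d * of_nat i) * of_nat (n choose (r - i)) / of_nat i))) +
      (\<Sum>i=1..n-r. of_nat p * ((- 1) ^ (i + 1) * ((b + d * of_nat i) * of_nat (n choose (r + i)) / of_nat i))))"
    by (intro pcong_add pcong_sum T0 low high)
  also have "\<dots> = ?C + of_nat p * (a * (?C * (harmonic n - harmonic (n - r))) + d * ?L) +
      of_nat p * (b * (?C * (harmonic n - harmonic r)) + d * ?H)"
    unfolding dist[where I = "{1..r}" and e = a and g = "\<lambda>i. of_nat (n choose (r - i))", OF z1]
      dist[where I = "{1..n-r}" and e = b and g = "\<lambda>i. of_nat (n choose (r + i))", OF z2]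
      sum_choose_div_eq_harmonic[OF r(1)] Hr by (rule refl)
  also have "\<dots> = ?C + of_nat p * (a * (?C * (harmonic n - harmonic (n - r))) +
      b * (?C * (harmonic n - harmonic r)) + d * (?L + ?H))"
    by (simp only: distrib_left add_ac)
  also have "\<dots> = ?C * (1 + of_nat p * (d + a * (harmonic n - harmonic (n - r)) + b * (harmonic n - harmonic r)))"
    unfolding alt by (simp add: algebra_simps)
  finally show ?thesis .
qed

text \<open>Here \<open>k = r + (p - 1) j = p j + (r - j)\<close>: terms with \<open>j < r\<close>
  lie above the multiple \<open>p j\<close>, those with \<open>j > r\<close> below it, and
  \<open>j = r\<close> hits \<open>p r\<close> exactly.\<close>

lemma pcong_choose_section_pos:
  assumes p: "p = 2 * n + 1" and r: "0 < r" "r < n"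
  shows "pcong 2 (of_nat (\<Sum>k | k \<le> p * n \<and> (int p - 1) dvd int k - int r. (p * n) choose k))
    (of_nat (n choose r) * (1 + of_nat p *
      (1 + of_nat (n - r) * (harmonic n - harmonic (n - r)) + of_nat r * (harmonic n - harmonic r))))"
proof -
  have "(\<Sum>k | k \<le> p * n \<and> (int p - 1) dvd int k - int r. (p * n) choose k) =
      (\<Sum>j\<le>n. (p * n) choose (r + (p - 1) * j))"
  proof (rule sum.reindex_bij_witness[of _ "\<lambda>j. r + (p - 1) * j" "\<lambda>k. (k - r) div (p - 1)"])
    fix k assume k: "k \<in> {k. k \<le> p * n \<and> (int p - 1) dvd int k - int r}"
    then obtain q where q: "int k - int r = (int p - 1) * q" by (auto elim: dvdE)
    have "q \<ge> 0"
    proof (rule ccontr)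
      assume "\<not> q \<ge> 0"
      then have "(int p - 1) * q \<le> (int p - 1) * (- 1)" using p by (intro mult_left_mono) auto
      then show False using q p r by (simp add: mult.commute)
    qed
    then obtain j where j: "q = int j" using nonneg_int_cases by blast
    have kj: "k = r + (p - 1) * j" using q j p
      by (metis add.commute add_diff_cancel_right' diff_add_cancel diff_add_inverse int_ops(2) nat_int of_nat_add of_nat_mult add_implies_diff)
    have "j \<le> n"
    proof (rule ccontr)
      assume "\<not> j \<le> n"
      then have "(p - 1) * Suc n \<le> (p - 1) * j" by (intro mult_le_mono2) auto
      then show False using k kj p r by (auto simp: algebra_simps)
    qed
    then show "(k - r) div (p - 1) \<in> {..n}" "r + (p - 1) * ((k - r) div (p - 1)) = k"
      "(p * n) choose (r + (p - 1) * ((k - r) div (p - 1))) = (p * n) choose k"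
      using kj p r by auto
  next
    fix j assume j: "j \<in> {..n}"
    then have "(p - 1) * j \<le> (p - 1) * n" by simp
    moreover have "p * n = (p - 1) * n + n" using p by simp
    ultimately have "r + (p - 1) * j \<le> p * n" using r by linarith
    then show "r + (p - 1) * j \<in> {k. k \<le> p * n \<and> (int p - 1) dvd int k - int r}"
      using p by auto
    show "(r + (p - 1) * j - r) div (p - 1) = j" using p r by simp
  qed
  moreover have "pcong 2 (\<Sum>j\<le>n. of_nat ((p * n) choose (r + (p - 1) * j))) (of_nat (n choose r) * (1 + of_nat p *
      (1 + of_nat (n - r) * (harmonic n - harmonic (n - r)) + of_nat r * (harmonic n - harmonic r))))"
  proof (rule pcong_choose_section_aux)
    have "r + (p - 1) * r = p * r" using p by simp
    then show "pcong 2 (of_nat ((p * n) choose (r + (p - 1) * r))) (of_nat (n choose r))"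
      using choose_prime_multiples_cong[OF prime_p, of n r] pcong_of_int[of 2 "int ((p * n) choose (p * r))" "int (n choose r)"]
      by (simp add: cong_iff_dvd_diff flip: cong_int_iff)
  next
    fix i assume i: "i \<in> {1..r}"
    then have "p * (r - i) = (p - 1) * (r - i) + (r - i)" using p by simp
    then have e: "r + (p - 1) * (r - i) = p * (r - i) + i" using i by simp
    show "pcong 2 (of_nat ((p * n) choose (r + (p - 1) * (r - i)))) (of_nat p * ((- 1) ^ (i + 1) *
        ((of_nat (n - r) + 1 * of_nat i) * of_nat (n choose (r - i)) / of_nat i)))"
    proof -
      have c: "odd p" "0 < i" "i < p" "r - i \<le> n" "n > 0" using i r p by auto
      have d: "of_nat n - of_nat (r - i) = (of_nat (n - r) + 1 * of_nat i :: rat)"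
        using i r by (simp add: of_nat_diff)
      show ?thesis unfolding e d[symmetric] by (rule pcong_choose_above[OF c])
    qed
  next
    fix i assume i: "i \<in> {1..n-r}"
    have "p * (r + i) = (p - 1) * (r + i) + (r + i)" using p by simp
    then have e: "r + (p - 1) * (r + i) = p * (r + i) - i" by simp
    show "pcong 2 (of_nat ((p * n) choose (r + (p - 1) * (r + i)))) (of_nat p * ((- 1) ^ (i + 1) *
        ((of_nat r + 1 * of_nat i) * of_nat (n choose (r + i)) / of_nat i)))"
    proof -
      have c: "odd p" "0 < i" "i < p" "0 < r + i" "r + i \<le> n" using i r p by auto
      have d: "(of_nat r + 1 * of_nat i :: rat) = of_nat (r + i)" by simp
      show ?thesis unfolding e d by (rule pcong_choose_below[OF c])
    qed
  qed (use p r in auto)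
  ultimately show ?thesis by (simp only: of_nat_sum)
qed

text \<open>Now \<open>k = (p + 1) j - r = p j + (j - r)\<close>, so above and below change places,
  and the weights decrease with the distance from \<open>j = r\<close>.\<close>

lemma pcong_choose_section_neg:
  assumes p: "p = 2 * n + 1" and r: "0 < r" "r < n"
  shows "pcong 2 (of_nat (\<Sum>k | k \<le> p * n \<and> (int p + 1) dvd int k + int r. (p * n) choose k))
    (of_nat (n choose r) * (1 + of_nat p *
      (- 1 + of_nat r * (harmonic n - harmonic (n - r)) + of_nat (n - r) * (harmonic n - harmonic r))))"
proof -
  have "(\<Sum>k | k \<le> p * n \<and> (int p + 1) dvd int k + int r. (p * n) choose k) =
      (\<Sum>j\<in>{1..<n}. (p * n) choose (p * j + j - r))"
  proof (rule sum.reindex_bij_witness[of _ "\<lambda>j. p * j + j - r" "\<lambda>k. (k + r) div (p + 1)"])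
    fix k assume k: "k \<in> {k. k \<le> p * n \<and> (int p + 1) dvd int k + int r}"
    then have "int (p + 1) dvd int (k + r)" by (simp add: add.commute)
    then have "(p + 1) dvd (k + r)" using int_dvd_int_iff by blast
    then obtain j where kj: "k + r = (p + 1) * j" by (elim dvdE)
    then have "j \<ge> 1" using r by (cases j) auto
    moreover have "j < n"
    proof (rule ccontr)
      assume "\<not> j < n"
      then have "(p + 1) * n \<le> (p + 1) * j" by (intro mult_le_mono2) auto
      then show False using k kj p r by (auto simp: algebra_simps)
    qed
    ultimately have j: "j \<in> {1..<n}" by simp
    have d: "(k + r) div (p + 1) = j" unfolding kj by (rule nonzero_mult_div_cancel_left) simp
    have "p * j + j - r = k" using kj by (simp add: algebra_simps)
    then show "(k + r) div (p + 1) \<in> {1..<n}" "p * ((k + r) div (p + 1)) + (k + r) div (p + 1) - r = k"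
      "(p * n) choose (p * ((k + r) div (p + 1)) + (k + r) div (p + 1) - r) = (p * n) choose k"
      unfolding d using j by auto
  next
    fix j assume j: "j \<in> {1..<n}"
    then have ge: "r \<le> p * j + j" using p r by (cases j) auto
    have "p * Suc j \<le> p * n" using j by (intro mult_le_mono2) auto
    moreover have "j \<le> p" using j p by auto
    ultimately have "p * j + j - r \<le> p * n" unfolding mult_Suc_right by linarith
    moreover have "int (p * j + j - r) + int r = (int p + 1) * int j"
      using ge by (simp add: of_nat_diff algebra_simps)
    ultimately show "p * j + j - r \<in> {k. k \<le> p * n \<and> (int p + 1) dvd int k + int r}" by simp
    have "p * j + j - r + r = (p + 1) * j" using ge by simp
    then show "(p * j + j - r + r) div (p + 1) = j"
      by (simp only:) (rule nonzero_mult_div_cancel_left, simp)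
  qed
  \<comment> \<open>The values \<open>j = 0\<close> and \<open>j = n\<close> put \<open>k\<close>
    out of range. Filling them with zeros fits the general pattern, since the weights
    \<open>r - i\<close> and \<open>n - r - i\<close> vanish there.\<close>
  also have "\<dots> = (\<Sum>j\<le>n. if j = 0 \<or> j = n then 0 else (p * n) choose (p * j + j - r))"
  proof (rule sum.mono_neutral_cong_left)
    show "\<forall>i\<in>{..n} - {1..<n}. (if i = 0 \<or> i = n then 0 else p * n choose (p * i + i - r)) = 0" by auto
  qed auto
  finally have eq: "(\<Sum>k | k \<le> p * n \<and> (int p + 1) dvd int k + int r. (p * n) choose k) =
      (\<Sum>j\<le>n. if j = 0 \<or> j = n then 0 else (p * n) choose (p * j + j - r))" .
  have "pcong 2 (\<Sum>j\<le>n. of_nat (if j = 0 \<or> j = n then 0 else (p * n) choose (p * j + j - r)))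
    (of_nat (n choose r) * (1 + of_nat p *
      (- 1 + of_nat r * (harmonic n - harmonic (n - r)) + of_nat (n - r) * (harmonic n - harmonic r))))"
  proof (rule pcong_choose_section_aux)
    show "pcong 2 (of_nat (if r = 0 \<or> r = n then 0 else (p * n) choose (p * r + r - r))) (of_nat (n choose r))"
      using choose_prime_multiples_cong[OF prime_p, of n r] pcong_of_int[of 2 "int ((p * n) choose (p * r))" "int (n choose r)"] r
      by (simp add: cong_iff_dvd_diff flip: cong_int_iff)
  next
    fix i assume i: "i \<in> {1..r}"
    show "pcong 2 (of_nat (if r - i = 0 \<or> r - i = n then 0 else (p * n) choose (p * (r - i) + (r - i) - r))) (of_nat p * ((- 1) ^ (i + 1) *
        ((of_nat r + - 1 * of_nat i) * of_nat (n choose (r - i)) / of_nat i)))"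
    proof (cases "i = r")
      case False
      then have e: "p * (r - i) + (r - i) - r = p * (r - i) - i" using i by simp
      have c: "odd p" "0 < i" "i < p" "0 < r - i" "r - i \<le> n" using i r p False by auto
      have d: "(of_nat r + - 1 * of_nat i :: rat) = of_nat (r - i)" using i by (simp add: of_nat_diff)
      have "\<not> (r - i = 0 \<or> r - i = n)" using i r False by auto
      then show ?thesis unfolding e d by (simp only: if_False pcong_choose_below[OF c])
    qed simp
  next
    fix i assume i: "i \<in> {1..n-r}"
    show "pcong 2 (of_nat (if r + i = 0 \<or> r + i = n then 0 else (p * n) choose (p * (r + i) + (r + i) - r))) (of_nat p * ((- 1) ^ (i + 1) *
        ((of_nat (n - r) + - 1 * of_nat i) * of_nat (n choose (r + i)) / of_nat i)))"
    proof (cases "r + i = n")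
      case True
      then have z: "(of_nat (n - r) + - 1 * of_nat i :: rat) = 0" by auto
      show ?thesis unfolding z using True by simp
    next
      case False
      have e: "p * (r + i) + (r + i) - r = p * (r + i) + i" by simp
      have *: "(of_nat (n - r) + - 1 * of_nat i :: rat) = of_nat n - of_nat (r + i)" using r by (simp add: of_nat_diff)
      have c: "odd p" "0 < i" "i < p" "r + i \<le> n" "n > 0" using i r p False by auto
      have "\<not> (r + i = 0 \<or> r + i = n)" using i r False by auto
      then show ?thesis unfolding e * by (simp only: if_False pcong_choose_above[OF c])
    qed
  qed (use p r in auto)
  then show ?thesis unfolding eq of_nat_sum .
qed

end

section \<open>Squares of the sections and the common value of both sums\<close>

context prime_rat
begin

text \<open>As \<open>s\<^sup>2 = 1\<close>, the factor \<open>p - s = - s (1 - s p)\<close> cancels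
  the constant \<open>s\<close> in the expansion of \<open>Q\<close>. Squaring removes the sign and
  doubles \<open>X\<close>, which is needed only modulo \<open>p\<close>.\<close>

lemma pcong_section_square:
  assumes Q: "pcong 2 Q (c * (1 + of_nat p * (s + X)))" and s: "s = 1 \<or> s = - 1"
    and c: "c \<in> Zp" and X: "X \<in> Zp" and Y: "pcong 1 (2 * X) Y"
  shows "pcong 2 (((of_nat p - s) * Q)\<^sup>2) (c\<^sup>2 * (1 + of_nat p * Y))"
proof -
  have sZ: "s \<in> Zp" "- s \<in> Zp" using s by auto
  have "pcong 2 ((of_nat p - s) * Q) ((of_nat p - s) * (c * (1 + of_nat p * (s + X))))"
    using sZ by (intro pcong_mult_left Q) auto
  also have "\<dots> = - s * c * ((1 + of_nat p * (- s)) * (1 + of_nat p * (s + X)))"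
    using s by (auto simp: algebra_simps)
  also have "pcong 2 \<dots> (- s * c * (1 + of_nat p * (- s + (s + X))))"
    by (intro pcong_mult_left pcong_first_order_mult Zp_mult sZ c Zp_add X)
  finally have "pcong 2 ((of_nat p - s) * Q) (- s * c * (1 + of_nat p * X))" by simp
  then have "pcong 2 (((of_nat p - s) * Q)\<^sup>2) ((- s * c * (1 + of_nat p * X))\<^sup>2)"
    by (rule pcong_power)
  also have "\<dots> = c\<^sup>2 * ((1 + of_nat p * X) * (1 + of_nat p * X))"
    using s by (auto simp: power2_eq_square)
  also have "pcong 2 \<dots> (c\<^sup>2 * (1 + of_nat p * (X + X)))"
    by (intro pcong_mult_left pcong_first_order_mult Zp_power c X)
  also have "pcong 2 \<dots> (c\<^sup>2 * (1 + of_nat p * Y))"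
  proof -
    have "pcong 2 (of_nat p * (X + X)) (of_nat p * Y)"
      using pcong_p_mult[OF Y] by (metis Suc_1 mult_2)
    then show ?thesis
      by (rule pcong_mult_left[OF Zp_power[OF c] pcong_add[OF pcong_refl[OF Zp_numeral(3)]]])
  qed
  finally show ?thesis .
qed

text \<open>Modulo \<open>p\<close> the section is \<open>(n choose r)\<close>, a divisor of
  \<open>n!\<close> and hence prime to \<open>p\<close>. If it were \<open>0\<close>, then
  \<open>1 / p\<close> would be \<open>p\<close>-integral.\<close>

lemma not_dvd_section:
  assumes Q: "pcong 2 (of_nat Q) (of_nat (n choose r) * (1 + of_nat p * X))" and X: "X \<in> Zp" and n: "n < p" "r \<le> n"
  shows "\<not> p dvd Q"
proof
  assume "p dvd Q"
  then have "pcong 1 0 (of_nat Q)" using pcong_0_if_dvd[of 1 Q] pcong_sym by simp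
  also have "pcong 1 \<dots> (of_nat (n choose r) * (1 + of_nat p * X))" using pcong_mono[OF Q] by simp
  also have "pcong 1 \<dots> (of_nat (n choose r) * (1 + 0 * X))"
    using pcong_p_0 X by (intro pcong_mult_left pcong_add pcong_refl pcong_mult_right) auto
  finally have "pcong 1 0 (of_nat (n choose r))" by simp
  then obtain z where z: "z \<in> Zp" "of_nat (n choose r) = of_nat p * z"
    unfolding pcong_iff by (auto simp: minus_equation_iff) (metis Zp_minus mult_minus_right)
  have "\<not> p dvd n choose r"
  proof
    assume "p dvd n choose r"
    then have "p dvd fact r * fact (n - r) * (n choose r)" by simp
    then have "p dvd fact n" using binomial_fact_lemma[OF n(2)] by simp
    then show False using n prime_dvd_fact_iff[OF prime_p] by simp
  qed
  then have "inverse (of_nat (n choose r)) \<in> Zp" by (rule Zp_inverse_of_nat)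
  then have "inverse (of_nat (n choose r)) * z \<in> Zp" using z by simp
  moreover have "(of_nat (n choose r) :: rat) \<noteq> 0" using n by simp
  then have "inverse (of_nat (n choose r)) * z = inverse (of_nat p)"
    unfolding z(2) by (auto simp: field_simps)
  ultimately obtain a b where ab: "inverse (of_nat p :: rat) = of_int a / of_int b" "\<not> int p dvd b"
    unfolding p_integral_iff[OF prime_p] by auto
  then have "b \<noteq> 0" by auto
  then have "(of_int b :: rat) = of_int (int p * a)" using ab(1) by (simp add: field_simps)
  then have "b = int p * a" using of_int_eq_iff by blast
  then show False using ab(2) by simp
qed

abbreviation (input) "hyp_sum a \<equiv>
  (\<Sum>k=0..p-1. (of_nat ((2 * k) choose k))\<^sup>2 * (1 / 16 ^ k) * (of_nat p / of_nat (8 * k + a)) :: rat)"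

text \<open>The meeting point of the two computations: both weighted hypergeometric sums and the
  squared section reduce to it.\<close>

abbreviation (input) "section_value n m \<equiv> (of_nat (n choose m))\<^sup>2 * (1 + of_nat p *
  (- (3 / 4 * (harmonic n - harmonic (n - m)) + 1 / 4 * (harmonic n - harmonic m))))"

lemma hyp_sum_1:
  assumes "p = 2 * n + 1" "p > 3" "m \<le> n" "8 * m + a = p"
  shows "pcong 2 (hyp_sum a) (section_value n m)"
proof -
  have "pcong 2 (of_nat 1 * hyp_sum a) ((of_nat (n choose m))\<^sup>2 * (1 - of_nat p *
      (harmonic n - (1 - of_nat 1 / 4) * harmonic (n - m) - of_nat 1 / 4 * harmonic m)))"
    by (rule pcong_hypergeometric_sum) (use assms in auto)
  also have "\<dots> = section_value n m" by (simp add: field_simps)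
  finally show ?thesis by (simp only: of_nat_1 mult_1_left)
qed

text \<open>The pole has moved to \<open>n - m\<close> with \<open>h = 3\<close>. Exchanging
  \<open>m\<close> and \<open>n - m\<close> and at the same time the weights \<open>1/4\<close> and
  \<open>3/4\<close> restores the value found in \<open>hyp_sum_1\<close>.\<close>

lemma hyp_sum_3:
  assumes "p = 2 * n + 1" "p > 3" "m \<le> n" "8 * (n - m) + a = 3 * p"
  shows "pcong 2 (3 * hyp_sum a) (section_value n m)"
proof -
  have "pcong 2 (of_nat 3 * hyp_sum a) ((of_nat (n choose (n - m)))\<^sup>2 * (1 - of_nat p *
      (harmonic n - (1 - of_nat 3 / 4) * harmonic (n - (n - m)) - of_nat 3 / 4 * harmonic (n - m))))"
    by (rule pcong_hypergeometric_sum) (use assms in auto)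
  also have "n choose (n - m) = n choose m" using assms(3) by (rule binomial_symmetric[symmetric])
  also have "n - (n - m) = m" using assms(3) by simp
  also have "(of_nat (n choose m))\<^sup>2 * (1 - of_nat p *
      (harmonic n - (1 - of_nat 3 / 4) * harmonic m - of_nat 3 / 4 * harmonic (n - m))) = section_value n m"
    by (simp add: field_simps)
  finally show ?thesis by (simp only: of_nat_numeral)
qed

lemma inverse_4: "p > 3 \<Longrightarrow> 1 / 4 \<in> Zp" "p > 3 \<Longrightarrow> 3 / 4 \<in> Zp"
proof -
  assume "p > 3"
  then have "\<not> p dvd 4" using not_dvd_8 dvd_trans[of p 4 8] by auto
  then have *: "inverse (of_nat 4) \<in> Zp" by (rule Zp_inverse_of_nat)
  show "1 / 4 \<in> Zp" "3 / 4 \<in> Zp" using Zp_divide[OF Zp_of_nat[of 1] *] Zp_divide[OF Zp_of_nat[of 3] *] by simp_all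
qed

lemma section_square_aux:
  assumes p: "p > 3" and lt: "n < p" "m \<le> n"
    and Q: "pcong 2 (of_nat Q) (of_nat (n choose m) * (1 + of_nat p * (s + X)))" and s: "s = 1 \<or> s = - 1"
    and X: "X \<in> Zp" "2 * X = - (3 / 4 * (harmonic n - harmonic (n - m)) + 1 / 4 * (harmonic n - harmonic m)) + of_nat p * R"
      "R \<in> Zp"
  shows "pcong 2 (((of_nat p - s) * of_nat Q)\<^sup>2) (section_value n m)" "\<not> p dvd Q"
proof -
  let ?h = "3 / 4 * (harmonic n - harmonic (n - m)) + 1 / 4 * (harmonic n - harmonic m)"
  have sX: "s + X \<in> Zp" using s X(1) by auto
  show "\<not> p dvd Q" by (rule not_dvd_section[OF Q sX lt])
  have h: "- ?h \<in> Zp"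
    using lt inverse_4[OF p] by (intro Zp_minus Zp_add Zp_mult Zp_diff Zp_harmonic) auto
  have "pcong 1 (- ?h + of_nat p * R) (- ?h + 0 * R)"
    using h X(3) pcong_p_0 by (intro pcong_add pcong_mult_right pcong_refl) auto
  then have "pcong 1 (2 * X) (- ?h)" unfolding X(2) by simp
  from pcong_section_square[OF Q s _ X(1) this]
  show "pcong 2 (((of_nat p - s) * of_nat Q)\<^sup>2) (section_value n m)" by simp
qed

text \<open>From \<open>8 m = p - 1\<close> the doubled weights are
  \<open>2 (n - m) = 3/4 (p - 1)\<close> and \<open>2 m = 1/4 (p - 1)\<close>, that is
  \<open>- 3/4\<close> and \<open>- 1/4\<close> modulo \<open>p\<close>; \<open>R\<close> collects
  the multiples of \<open>p\<close>.\<close>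

lemma section_pos:
  assumes p: "p = 8 * m + 1" "p > 3" and n: "n = 4 * m"
    and Q: "Q = (\<Sum>k | k \<le> p * n \<and> (int p - 1) dvd int k - int m. (p * n) choose k)"
  shows "pcong 2 (((of_nat p - 1) * of_nat Q)\<^sup>2) (section_value n m)" "\<not> p dvd Q"
proof -
  define X where "X = of_nat (n - m) * (harmonic n - harmonic (n - m)) + of_nat m * (harmonic n - harmonic m)"
  define R where "R = 3 / 4 * (harmonic n - harmonic (n - m)) + 1 / 4 * (harmonic n - harmonic m)"
  have lt: "n < p" "n - m < p" "m < p" "m \<le> n" "m > 0" using p n by auto
  have H: "harmonic n \<in> Zp" "harmonic (n - m) \<in> Zp" "harmonic m \<in> Zp" using lt by (auto intro: Zp_harmonic)
  have X: "X \<in> Zp" unfolding X_def by (intro Zp_add Zp_mult Zp_diff Zp_of_nat H)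
  have R: "R \<in> Zp" unfolding R_def by (intro Zp_add Zp_mult Zp_diff H inverse_4 p)
  have eq: "pcong 2 (of_nat Q) (of_nat (n choose m) * (1 + of_nat p * (1 + X)))"
    using pcong_choose_section_pos[of n m] lt p n unfolding X_def add.assoc[symmetric] Q by simp
  have X2: "2 * X = - (3 / 4 * (harmonic n - harmonic (n - m)) + 1 / 4 * (harmonic n - harmonic m)) + of_nat p * R"
    unfolding X_def R_def p n by (simp add: field_simps)
  show "pcong 2 (((of_nat p - 1) * of_nat Q)\<^sup>2) (section_value n m)" "\<not> p dvd Q"
    by (rule section_square_aux[OF p(2) lt(1,4) eq _ X X2 R]; simp)+
qed

text \<open>Here \<open>8 m = p - 3\<close>, so \<open>2 m = (p - 3) / 4\<close> and
  \<open>2 (n - m) = (3 p - 1) / 4\<close>. Modulo \<open>p\<close> these are again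
  \<open>- 3/4\<close> and \<open>- 1/4\<close>, and the section for \<open>d = - 1\<close> attaches
  them to the same harmonic differences as before.\<close>

lemma section_neg:
  assumes p: "p = 8 * m + 3" "p > 3" and n: "n = 4 * m + 1"
    and Q: "Q = (\<Sum>k | k \<le> p * n \<and> (int p + 1) dvd int k + int m. (p * n) choose k)"
  shows "pcong 2 (((of_nat p - - 1) * of_nat Q)\<^sup>2) (section_value n m)" "\<not> p dvd Q"
proof -
  define X where "X = of_nat m * (harmonic n - harmonic (n - m)) + of_nat (n - m) * (harmonic n - harmonic m)"
  define R where "R = 1 / 4 * (harmonic n - harmonic (n - m)) + 3 / 4 * (harmonic n - harmonic m)"
  have lt: "n < p" "n - m < p" "m < p" "m \<le> n" "m > 0" using p n by auto
  have H: "harmonic n \<in> Zp" "harmonic (n - m) \<in> Zp" "harmonic m \<in> Zp" using lt by (auto intro: Zp_harmonic)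
  have X: "X \<in> Zp" unfolding X_def by (intro Zp_add Zp_mult Zp_diff Zp_of_nat H)
  have R: "R \<in> Zp" unfolding R_def by (intro Zp_add Zp_mult Zp_diff H inverse_4 p)
  have eq: "pcong 2 (of_nat Q) (of_nat (n choose m) * (1 + of_nat p * (- 1 + X)))"
    using pcong_choose_section_neg[of n m] lt p n unfolding X_def add.assoc[symmetric] Q by simp
  have X2: "2 * X = - (3 / 4 * (harmonic n - harmonic (n - m)) + 1 / 4 * (harmonic n - harmonic m)) + of_nat p * R"
    unfolding X_def R_def p n by (simp add: field_simps)
  show "pcong 2 (((of_nat p - - 1) * of_nat Q)\<^sup>2) (section_value n m)" "\<not> p dvd Q"
    by (rule section_square_aux[OF p(2) lt(1,4) eq _ X X2 R]; simp)+
qed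

end

section \<open>Quadratic algebras over the residue field\<close>

text \<open>One notion for all rings involved: the integers, the Gaussian integers, and with
  \<open>M = 0\<close> plain equality of complex numbers.\<close>

definition gcong :: "'a::comm_ring_1 \<Rightarrow> 'a \<Rightarrow> 'a \<Rightarrow> bool"
  where "gcong M x y \<longleftrightarrow> M dvd x - y"

lemma gcong_refl [simp, intro]: "gcong M x x"
  by (simp add: gcong_def)

lemma gcong_sym: "gcong M x y \<Longrightarrow> gcong M y x"
  unfolding gcong_def by (metis dvd_minus_iff minus_diff_eq)

lemma gcong_trans [trans]: "gcong M x y \<Longrightarrow> gcong M y z \<Longrightarrow> gcong M x z"
  unfolding gcong_def using dvd_add[of M "x - y" "y - z"] by simp

lemma gcong_eq_trans [trans]: "gcong M x y \<Longrightarrow> y = z \<Longrightarrow> gcong M x z"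
  and eq_gcong_trans [trans]: "x = y \<Longrightarrow> gcong M y z \<Longrightarrow> gcong M x z"
  by simp_all

lemma gcong_add: "gcong M x y \<Longrightarrow> gcong M u v \<Longrightarrow> gcong M (x + u) (y + v)"
  unfolding gcong_def using dvd_add[of M "x - y" "u - v"] by (simp add: algebra_simps)

lemma gcong_minus: "gcong M x y \<Longrightarrow> gcong M (- x) (- y)"
  unfolding gcong_def using dvd_minus_iff[of M "x - y"] by (simp add: algebra_simps)

lemma gcong_diff: "gcong M x y \<Longrightarrow> gcong M u v \<Longrightarrow> gcong M (x - u) (y - v)"
  using gcong_add[of M x y "- u" "- v"] gcong_minus[of M u v] by simp

lemma gcong_mult: assumes "gcong M x y" "gcong M u v" shows "gcong M (x * u) (y * v)"
proof -
  have "x * u - y * v = (x - y) * u + y * (u - v)" by (simp add: algebra_simps)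
  then show ?thesis using assms unfolding gcong_def by simp
qed

lemma gcong_power: "gcong M x y \<Longrightarrow> gcong M (x ^ k) (y ^ k)"
  by (induction k) (auto intro: gcong_mult)

lemma gcong_sum: "(\<And>i. i \<in> A \<Longrightarrow> gcong M (f i) (g i)) \<Longrightarrow> gcong M (sum f A) (sum g A)"
  by (induction A rule: infinite_finite_induct) (auto intro: gcong_add)

lemma gcong_0_iff: "gcong M x 0 \<longleftrightarrow> M dvd x"
  by (simp add: gcong_def)

lemma gcong_dvd_iff: "gcong M x y \<Longrightarrow> M dvd x \<longleftrightarrow> M dvd y"
  by (metis gcong_0_iff gcong_sym gcong_trans)

lemma gcong_of_int: "[x = y] (mod int m) \<Longrightarrow> gcong (of_nat m) (of_int x) (of_int y)"
proof -
  assume "[x = y] (mod int m)"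
  then obtain k where "x - y = int m * k" unfolding cong_iff_dvd_diff by blast
  then have "of_int x - of_int y = of_nat m * (of_int k :: 'a)"
    by (metis of_int_diff of_int_mult of_int_of_nat_eq)
  then show ?thesis by (simp add: gcong_def)
qed

text \<open>\<open>x ^ p - y ^ p\<close> is \<open>x - y\<close> times a sum of \<open>p\<close>
  terms all congruent to \<open>y ^ (p - 1)\<close>, and that sum supplies the second factor
  \<open>p\<close>. So modulo \<open>p\<^sup>2\<close> a \<open>p\<close>-th power depends only on
  the residue modulo \<open>p\<close>, which gives a multiplicative lift.\<close>

lemma gcong_power_lift:
  fixes x y :: "'a::comm_ring_1"
  assumes "gcong (of_nat p) x y"
  shows "gcong ((of_nat p)\<^sup>2) (x ^ p) (y ^ p)"
proof -
  have "gcong (of_nat p) (\<Sum>i<p. x ^ i * y ^ (p - Suc i)) (\<Sum>i<p. y ^ i * y ^ (p - Suc i))"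
    by (intro gcong_sum gcong_mult gcong_power assms gcong_refl)
  also have "(\<Sum>i<p. y ^ i * y ^ (p - Suc i)) = (\<Sum>i<p. y ^ (p - 1))"
    by (intro sum.cong) (auto simp flip: power_add)
  also have "\<dots> = of_nat p * y ^ (p - 1)" by simp
  finally have "of_nat p dvd (\<Sum>i<p. x ^ i * y ^ (p - Suc i))"
    using gcong_dvd_iff by (metis dvd_triv_left)
  moreover have "x ^ p - y ^ p = (x - y) * (\<Sum>i<p. x ^ i * y ^ (p - Suc i))"
    by (simp add: power_diff_sumr2 mult.commute)
  ultimately show ?thesis using assms unfolding gcong_def power2_eq_square by (simp add: mult_dvd_mono)
qed

lemma gcong_power_add:
  fixes x y :: "'a::comm_ring_1"
  assumes "prime p"
  shows "gcong (of_nat p) ((x + y) ^ p) (x ^ p + y ^ p)"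
proof -
  let ?f = "\<lambda>k. of_nat (p choose k) * x ^ k * y ^ (p - k)"
  have p: "p > 0" using assms prime_gt_0_nat by blast
  have "(x + y) ^ p = (\<Sum>k\<in>{0,p}. ?f k) + (\<Sum>k\<in>{..p} - {0,p}. ?f k)"
    unfolding binomial_ring by (subst sum.subset_diff[of "{0,p}"]) auto
  also have "gcong (of_nat p) \<dots> ((\<Sum>k\<in>{0,p}. ?f k) + (\<Sum>k\<in>{..p} - {0,p}. 0))"
  proof (intro gcong_add gcong_sum gcong_refl)
    fix k assume "k \<in> {..p} - {0,p}"
    then have "\<not> p dvd k" by (auto dest: dvd_imp_le)
    then have "p dvd p choose k" using prime_dvd_choose_multiple[OF assms, of k 1] by simp
    then have "(of_nat p :: 'a) dvd of_nat (p choose k)" by (metis dvd_def of_nat_mult)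
    then show "gcong (of_nat p) (?f k) 0" by (simp add: gcong_0_iff)
  qed
  also have "(\<Sum>k\<in>{0,p}. ?f k) + (\<Sum>k\<in>{..p} - {0,p}. 0) = x ^ p + y ^ p"
    using p by simp
  finally show ?thesis .
qed

lemma cong_eq_trans [trans]: "[a = b] (mod q) \<Longrightarrow> b = c \<Longrightarrow> [a = c] (mod q)"
  and eq_cong_trans [trans]: "a = b \<Longrightarrow> [b = c] (mod q) \<Longrightarrow> [a = c] (mod q)"
  for a b c q :: int
  by simp_all

lemma gcong_root8_mod:
  assumes "gcong M (w ^ 4) (- 1)" "[i = j] (mod 8)"
  shows "gcong M (w ^ i) (w ^ j)"
proof -
  have 8: "gcong M (w ^ 8) 1" using gcong_power[OF assms(1), of 2] by (simp flip: power_mult)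
  have "gcong M (w ^ k) (w ^ (k mod 8))" for k
  proof -
    have "w ^ k = (w ^ 8) ^ (k div 8) * w ^ (k mod 8)" by (simp flip: power_mult power_add)
    also have "gcong M \<dots> (1 ^ (k div 8) * w ^ (k mod 8))"
      by (intro gcong_mult gcong_power 8 gcong_refl)
    finally show ?thesis by simp
  qed
  then show ?thesis using assms(2) unfolding cong_def by (metis gcong_sym gcong_trans)
qed

text \<open>If \<open>4 j\<close> is a multiple of \<open>k\<close>, then \<open>j\<close> is even,
  since otherwise \<open>w ^ (4 j)\<close> would be both \<open>- 1\<close> and \<open>1\<close>.
  Three applications extract three factors \<open>2\<close> from \<open>k\<close>.\<close>

lemma gcong_root8_order:
  assumes w: "gcong M (w ^ 4) (- 1)" "\<not> gcong M 1 (- 1)" and k: "gcong M (w ^ k) 1"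
  shows "8 dvd k"
proof -
  have ev: "even j" if "4 * j = i * k" for i j
  proof (rule ccontr)
    assume "odd j"
    then have "gcong M (w ^ (4 * j)) (- 1)" using gcong_power[OF w(1), of j] by (simp add: power_mult)
    moreover have "gcong M (w ^ (4 * j)) 1"
      using gcong_power[OF k, of i] unfolding that by (simp add: mult.commute flip: power_mult)
    ultimately show False using w(2) gcong_sym gcong_trans by blast
  qed
  have "even k" using ev[of k 4] by simp
  then obtain k1 where k1: "k = 2 * k1" by blast
  have "even k1" using ev[of k1 2] k1 by simp
  then obtain k2 where k2: "k1 = 2 * k2" by blast
  have "even k2" using ev[of k2 1] k1 k2 by simp
  then show ?thesis using k1 k2 by auto
qed

lemma int_fermat:
  assumes "prime p" "p > 2" "\<not> int p dvd a"
  shows "[a ^ (p - 1) = 1] (mod int p)"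
proof -
  have p: "p - 1 = (p - 1) div 2 + (p - 1) div 2"
    using assms prime_odd_nat[of p] by (auto elim!: oddE)
  have "[a ^ ((p - 1) div 2) * a ^ ((p - 1) div 2) = Legendre a p * Legendre a p] (mod int p)"
    using euler_criterion[OF assms(1,2), of a] by (intro cong_mult) (auto simp: cong_sym_eq)
  moreover have "Legendre a p * Legendre a p = 1"
    using assms(3) by (auto simp: Legendre_def cong_0_iff)
  ultimately show ?thesis by (subst p) (simp add: power_add)
qed

lemma int_fermat_power:
  assumes "prime p" "p > 2"
  shows "[a ^ p = a] (mod int p)"
proof (cases "int p dvd a")
  case True
  then show ?thesis using assms by (simp add: cong_iff_dvd_diff dvd_power prime_gt_0_nat dvd_trans)
next
  case False
  have "p = Suc (p - 1)" using assms by simp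
  then have "a ^ p = a * a ^ (p - 1)" by (metis power_Suc)
  then show ?thesis using cong_mult[OF cong_refl[of a] int_fermat[OF assms False]] by simp
qed

lemma coprime_int_prime: "prime p \<Longrightarrow> \<not> int p dvd a \<Longrightarrow> coprime a (int p)"
  by (metis coprime_commute prime_imp_coprime prime_nat_int_transfer)

text \<open>\<open>- 1\<close> is no square modulo \<open>p\<close>: raising
  \<open>u\<^sup>2 = - v\<^sup>2\<close> to the odd power \<open>(p - 1) / 2 = 4 m + 1\<close> would
  give \<open>1 = - 1\<close>. For the algebra this says that \<open>d = - 1\<close> yields a
  field.\<close>

lemma prime_dvd_sum_two_squares:
  assumes "prime p" "p = 8 * m + 3" "int p dvd a\<^sup>2 + b\<^sup>2"
  shows "int p dvd a \<and> int p dvd b"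
proof -
  have key: "int p dvd v" if h: "int p dvd u\<^sup>2 + v\<^sup>2" for u v
  proof (rule ccontr)
    assume v: "\<not> int p dvd v"
    have "[u\<^sup>2 = - (v\<^sup>2)] (mod int p)" using h by (simp add: cong_iff_dvd_diff)
    then have "[(u\<^sup>2) ^ (4 * m + 1) = (- (v\<^sup>2)) ^ (4 * m + 1)] (mod int p)" by (rule cong_pow)
    moreover have e: "(w\<^sup>2) ^ (4 * m + 1) = w ^ (p - 1)" for w :: int
    proof -
      have "2 * (4 * m + 1) = p - 1" using assms(2) by simp
      then show ?thesis by (metis power_mult)
    qed
    moreover have "(- (v\<^sup>2)) ^ (4 * m + 1) = - ((v\<^sup>2) ^ (4 * m + 1))" by (simp add: power_minus_odd)
    ultimately have c: "[u ^ (p - 1) = - (v ^ (p - 1))] (mod int p)" by simp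
    have p2: "p > 2" using assms(2) by simp
    have u: "\<not> int p dvd u"
    proof
      assume "int p dvd u"
      then have "int p dvd u\<^sup>2" by (simp add: power2_eq_square)
      then have "int p dvd v\<^sup>2" using h dvd_add_right_iff by blast
      then show False using v assms(1) by (simp add: prime_dvd_power_iff)
    qed
    have "[1 = u ^ (p - 1)] (mod int p)" using int_fermat[OF assms(1) p2 u] by (rule cong_sym)
    also note c
    also have "[- (v ^ (p - 1)) = - 1] (mod int p)"
      using int_fermat[OF assms(1) p2 v] by (simp add: cong_minus_minus_iff)
    finally have "int p dvd 2" by (simp add: cong_iff_dvd_diff)
    then show False using p2 by (auto dest: zdvd_imp_le)
  qed
  show ?thesis using key[of b a] key[of a b] assms(3) by (simp add: add.commute)
qed

text \<open>A pair \<open>(c, e)\<close> stands for the element \<open>c + e \<epsilon>\<close> of \<open>A\<close>; its image \<open>emb\<close> in the ring \<open>'a\<close> does not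
  determine it when \<open>\<epsilon> = 1\<close>.\<close>
type_synonym ipair = "int \<times> int"

text \<open>Instantiated with \<open>\<epsilon> = 1\<close> in the integers and \<open>\<epsilon> = i\<close> in the Gaussian integers.\<close>
locale frob =
  fixes p m :: nat and d :: int and \<epsilon> :: "'a::idom"
  assumes prime_p: "prime p" and m_pos: "m > 0"
    and prime_elem_p: "prime_elem (of_nat p :: 'a)"
    and case_distinction: "p = 8 * m + 1 \<and> d = 1 \<and> \<epsilon> = 1 \<or> p = 8 * m + 3 \<and> d = - 1 \<and> \<epsilon> * \<epsilon> = - 1"
    and of_int_dvd: "\<And>k x. of_nat p ^ k dvd (of_int x :: 'a) \<Longrightarrow> int p ^ k dvd x"
begin

abbreviation P :: 'a where "P \<equiv> of_nat p"

abbreviation n :: nat where "n \<equiv> (p - 1) div 2"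

text \<open>In the split case the two components get the exponents \<open>m\<close> and
  \<open>3 m\<close>, where \<open>m = (p - 1) / 8\<close>. In the field case conjugation is the
  \<open>p\<close>-th power and \<open>exA + p exB = (p\<^sup>2 - 1) / 8\<close>. Both choices
  satisfy \<open>exA + exB = n\<close>.\<close>

definition exA :: nat where "exA = (if d = 1 then m else 3 * m + 1)"
definition exB :: nat where "exB = (if d = 1 then 3 * m else m)"

lemma cases_d:
  obtains (pos) "p = 8 * m + 1" "d = 1" "n = 4 * m" "exA = m" "exB = 3 * m" "\<epsilon> = 1"
  | (neg) "p = 8 * m + 3" "d = - 1" "n = 4 * m + 1" "exA = 3 * m + 1" "exB = m" "\<epsilon> * \<epsilon> = - 1"
proof -
  from case_distinction consider "p = 8 * m + 1" "d = 1" "\<epsilon> = 1" | "p = 8 * m + 3" "d = - 1" "\<epsilon> * \<epsilon> = - 1"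
    by blast
  then show thesis
  proof cases
    case 1
    show ?thesis by (rule pos[OF 1(1,2)]) (unfold exA_def exB_def, simp_all add: 1)
  next
    case 2
    show ?thesis by (rule neg[OF 2(1,2)]) (unfold exA_def exB_def, simp_all add: 2)
  qed
qed

lemma p_eq: "p = 2 * n + 1"
  using case_distinction by auto

lemma p_gt: "p > 8" using case_distinction m_pos by auto

lemma odd_p: "odd p" by (subst p_eq) simp

lemma eps_sq: "\<epsilon> * \<epsilon> = of_int d"
  using case_distinction by auto

lemma eps_pow_p: "\<epsilon> ^ p = of_int d * \<epsilon>"
proof (cases rule: cases_d)
  case neg
  have "\<epsilon> ^ p = \<epsilon> * (\<epsilon> * \<epsilon>) ^ n"
    by (subst p_eq) (simp add: power_mult power2_eq_square mult.assoc)
  then show ?thesis using neg by simp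
qed simp

definition emb :: "ipair \<Rightarrow> 'a" where "emb x = of_int (fst x) + of_int (snd x) * \<epsilon>"
text \<open>Taken on pairs: for \<open>\<epsilon> = 1\<close> the maps \<open>emb\<close> and
  \<open>embc\<close> are, modulo \<open>p\<close>, the two projections of the split algebra onto
  the residue field.\<close>

definition embc :: "ipair \<Rightarrow> 'a" where "embc x = of_int (fst x) - of_int (snd x) * \<epsilon>"
definition pnorm :: "ipair \<Rightarrow> int" where "pnorm x = (fst x)\<^sup>2 - d * (snd x)\<^sup>2"
definition pmul :: "ipair \<Rightarrow> ipair \<Rightarrow> ipair"
  where "pmul x y = (fst x * fst y + d * (snd x * snd y), fst x * snd y + snd x * fst y)"
definition pconj :: "ipair \<Rightarrow> ipair" where "pconj x = (fst x, - snd x)"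
definition pcg :: "ipair \<Rightarrow> ipair \<Rightarrow> bool"
  where "pcg x y \<longleftrightarrow> [fst x = fst y] (mod int p) \<and> [snd x = snd y] (mod int p)"

lemma emb_mul: "emb (pmul x y) = emb x * emb y"
proof -
  have "emb x * emb y = of_int (fst x * fst y) + of_int (fst x * snd y + snd x * fst y) * \<epsilon> +
      of_int (snd x * snd y) * (\<epsilon> * \<epsilon>)" by (simp add: emb_def algebra_simps)
  moreover have "emb (pmul x y) = of_int (fst x * fst y) + of_int (fst x * snd y + snd x * fst y) * \<epsilon> +
      of_int (snd x * snd y) * (\<epsilon> * \<epsilon>)"
    unfolding eps_sq by (simp add: emb_def pmul_def algebra_simps)
  ultimately show ?thesis by simp
qed

lemma embc_eq: "embc x = emb (pconj x)"
  by (simp add: embc_def emb_def pconj_def)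

lemma pconj_mul: "pconj (pmul x y) = pmul (pconj x) (pconj y)"
  by (simp add: pconj_def pmul_def)

lemma pconj_pconj [simp]: "pconj (pconj x) = x" by (simp add: pconj_def)

lemma pnorm_pconj [simp]: "pnorm (pconj x) = pnorm x" by (simp add: pnorm_def pconj_def)

lemma embc_mul: "embc (pmul x y) = embc x * embc y"
  by (simp add: embc_eq pconj_mul emb_mul)

lemma emb_embc: "emb x * embc x = of_int (pnorm x)"
proof -
  have "emb x * embc x = of_int (fst x * fst x) - of_int (snd x * snd x) * (\<epsilon> * \<epsilon>)"
    by (simp add: emb_def embc_def algebra_simps)
  then show ?thesis unfolding eps_sq by (simp add: pnorm_def power2_eq_square)
qed

lemma d_sq: "d * d = 1" using case_distinction by auto

lemma pnorm_mul: "pnorm (pmul x y) = pnorm x * pnorm y"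
proof -
  have "pnorm (pmul x y) = (fst x * fst y)\<^sup>2 + (d * d) * (snd x * snd y)\<^sup>2 - d * (fst x * snd y)\<^sup>2 - d * (snd x * fst y)\<^sup>2"
    by (simp add: pnorm_def pmul_def power2_eq_square algebra_simps)
  moreover have "pnorm x * pnorm y = (fst x * fst y)\<^sup>2 + (d * d) * (snd x * snd y)\<^sup>2 - d * (fst x * snd y)\<^sup>2 - d * (snd x * fst y)\<^sup>2"
    by (simp add: pnorm_def power2_eq_square algebra_simps)
  ultimately show ?thesis by simp
qed

lemma emb_cong: "pcg x y \<Longrightarrow> gcong P (emb x) (emb y)"
  unfolding emb_def pcg_def by (intro gcong_add gcong_mult gcong_of_int gcong_refl) auto

lemma embc_cong: "pcg x y \<Longrightarrow> gcong P (embc x) (embc y)"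
  unfolding embc_def pcg_def by (intro gcong_diff gcong_mult gcong_of_int gcong_refl) auto

lemma pnorm_cong: "pcg x y \<Longrightarrow> [pnorm x = pnorm y] (mod int p)"
  unfolding pnorm_def pcg_def by (intro cong_diff cong_mult cong_pow cong_refl) auto

lemma pmul_cong: "pcg x y \<Longrightarrow> pcg u v \<Longrightarrow> pcg (pmul x u) (pmul y v)"
  unfolding pcg_def pmul_def by (auto intro!: cong_add cong_mult)

lemma pcg_trans: "pcg x y \<Longrightarrow> pcg y z \<Longrightarrow> pcg x z"
  unfolding pcg_def using cong_trans by blast

lemma pcg_sym: "pcg x y \<Longrightarrow> pcg y x"
  unfolding pcg_def by (auto simp: cong_sym_eq)

lemma pcg_refl [simp]: "pcg x x" by (simp add: pcg_def)

definition punit :: "ipair \<Rightarrow> bool" where "punit x \<longleftrightarrow> \<not> int p dvd pnorm x"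

lemma punit_cong: "pcg x y \<Longrightarrow> punit x \<longleftrightarrow> punit y"
  unfolding punit_def using pnorm_cong cong_dvd_iff by blast

lemma punit_mul: "punit (pmul x y) \<longleftrightarrow> punit x \<and> punit y"
  unfolding punit_def pnorm_mul using prime_p by (simp add: prime_dvd_mult_iff)

lemma punit_pconj [simp]: "punit (pconj x) \<longleftrightarrow> punit x" by (simp add: punit_def)

lemma P_dvd_of_int_iff: "P dvd of_int x \<longleftrightarrow> int p dvd x"
  using of_int_dvd[of 1 x] gcong_of_int[of x 0 p] by (auto simp: gcong_0_iff cong_0_iff)

lemma P_dvd_mult: "P dvd x * y \<longleftrightarrow> P dvd x \<or> P dvd y"
  using prime_elem_p by (rule prime_elem_dvd_mult_iff)

lemma P_dvd_power: "P dvd x ^ k \<Longrightarrow> P dvd x"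
  using prime_elem_p by (rule prime_elem_dvd_power)

lemma P_cancel: "\<not> P dvd c \<Longrightarrow> gcong P (c * x) (c * y) \<Longrightarrow> gcong P x y"
  unfolding gcong_def by (metis P_dvd_mult right_diff_distrib)

lemma P_sq_dvd_cancel: assumes "\<not> P dvd c" "P\<^sup>2 dvd c * x" shows "P\<^sup>2 dvd x"
proof -
  have P0: "P \<noteq> 0" using prime_elem_p by auto
  have "P dvd c * x" using assms(2) by (metis dvd_mult_left power2_eq_square)
  then obtain y where y: "x = P * y" using assms(1) P_dvd_mult by blast
  then have "P * P dvd P * (c * y)" using assms(2) by (simp add: power2_eq_square mult_ac)
  then have "P dvd c * y" using P0 by simp
  then have "P dvd y" using assms(1) P_dvd_mult by blast
  then show ?thesis unfolding y power2_eq_square by (simp add: mult_dvd_mono)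
qed

lemma P_sq_cancel: "\<not> P dvd c \<Longrightarrow> gcong (P\<^sup>2) (c * x) (c * y) \<Longrightarrow> gcong (P\<^sup>2) x y"
  unfolding gcong_def using P_sq_dvd_cancel by (metis right_diff_distrib)

lemma gcong_P_sq: "gcong (P\<^sup>2) x y \<Longrightarrow> gcong P x y"
  unfolding gcong_def power2_eq_square using dvd_mult_left by blast

lemma punit_emb: "punit x \<Longrightarrow> \<not> P dvd emb x" "punit x \<Longrightarrow> \<not> P dvd embc x"
  unfolding punit_def P_dvd_of_int_iff[symmetric] emb_embc[symmetric] by auto

text \<open>The \<open>p\<close>-th power is additive modulo \<open>p\<close> and fixes integers,
  and \<open>\<epsilon> ^ p = d \<epsilon>\<close>. So it is the identity for \<open>d = 1\<close>
  and conjugation for \<open>d = - 1\<close>.\<close>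

lemma emb_frob: "gcong P (emb x ^ p) (of_int (fst x) + of_int (d * snd x) * \<epsilon>)"
proof -
  have f: "gcong P (of_int c ^ p) (of_int c)" for c
    using gcong_of_int[OF int_fermat_power[OF prime_p, of c]] p_gt by simp
  have "gcong P (emb x ^ p) (of_int (fst x) ^ p + (of_int (snd x) * \<epsilon>) ^ p)"
    unfolding emb_def by (rule gcong_power_add[OF prime_p])
  also have "\<dots> = of_int (fst x) ^ p + of_int (snd x) ^ p * (of_int d * \<epsilon>)"
    by (simp add: power_mult_distrib eps_pow_p)
  also have "gcong P \<dots> (of_int (fst x) + of_int (snd x) * (of_int d * \<epsilon>))"
    by (intro gcong_add gcong_mult f gcong_refl)
  finally show ?thesis by (simp add: mult_ac)
qed

lemma emb_frob_pos: assumes "d = 1" shows "gcong P (emb x ^ p) (emb x)"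
  using emb_frob[of x] assms by (simp add: emb_def)

lemma emb_frob_neg: assumes "d = - 1" shows "gcong P (emb x ^ p) (embc x)"
  using emb_frob[of x] assms by (simp add: embc_def)

lemma embc_frob_neg: assumes "d = - 1" shows "gcong P (embc x ^ p) (emb x)"
  using emb_frob_neg[OF assms, of "pconj x"] by (simp add: embc_eq)

lemma emb_fermat: assumes "d = 1" "punit x" shows "gcong P (emb x ^ (8 * m)) 1"
proof -
  have "p = Suc (8 * m)" using assms case_distinction by auto
  then have "gcong P (emb x * emb x ^ (8 * m)) (emb x * 1)"
    using emb_frob_pos[OF assms(1), of x] by simp
  then show ?thesis using P_cancel punit_emb assms by blast
qed

lemma embc_fermat: assumes "d = 1" "punit x" shows "gcong P (embc x ^ (8 * m)) 1"
  using emb_fermat[OF assms(1), of "pconj x"] assms(2) by (simp only: embc_eq punit_pconj)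

definition theta :: "ipair \<Rightarrow> 'a" where "theta x = emb x ^ exA * embc x ^ exB"

lemma theta_mul: "theta (pmul x y) = theta x * theta y"
  by (simp add: theta_def emb_mul embc_mul power_mult_distrib mult_ac)

lemma theta_cong: "pcg x y \<Longrightarrow> gcong P (theta x) (theta y)"
  unfolding theta_def by (intro gcong_mult gcong_power emb_cong embc_cong)

text \<open>The fourth power is the quadratic character of the norm, so a unit of non-residue norm
  shows that the order is exactly eight. In the split case the surplus
  \<open>embc x ^ (8 * m)\<close> is trivial; in the field case
  \<open>4 (3 m + 1) = (4 m + 1) + p\<close>, and the \<open>p\<close>-th power supplies the missing
  conjugate.\<close>

lemma theta_pow4: assumes "punit x" shows "gcong P (theta x ^ 4) (of_int (pnorm x) ^ n)"
proof (cases rule: cases_d)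
  case pos
  have "theta x ^ 4 = (emb x * embc x) ^ (4 * m) * embc x ^ (8 * m)"
    by (simp add: theta_def pos(4,5) mult.commute[of m 4] mult.commute[of m 3] power_mult_distrib power_add[symmetric] power_mult[symmetric] mult.assoc)
  also have "gcong P \<dots> ((emb x * embc x) ^ (4 * m) * 1)"
    using pos(2) assms by (intro gcong_mult gcong_refl embc_fermat)
  finally show ?thesis by (simp only: emb_embc pos(3) mult_1_right)
next
  case neg
  have e0: "(3 * m + 1) * 4 = (4 * m + 1) + p" "m * 4 = 4 * m" using neg(1) by simp_all
  have e: "emb x ^ ((3 * m + 1) * 4) = emb x ^ (4 * m + 1) * emb x ^ p"
    unfolding e0 by (rule power_add)
  have "theta x ^ 4 = emb x ^ (4 * m + 1) * emb x ^ p * embc x ^ (4 * m)"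
    by (simp only: theta_def neg(4,5) power_mult_distrib power_mult[symmetric] e e0(2))
  also have "gcong P \<dots> (emb x ^ (4 * m + 1) * embc x * embc x ^ (4 * m))"
    using neg(2) by (intro gcong_mult gcong_refl emb_frob_neg)
  also have "\<dots> = (emb x * embc x) ^ (4 * m + 1)"
    by (simp add: power_mult_distrib mult_ac)
  finally show ?thesis by (simp only: emb_embc neg(3))
qed

lemma theta_pow8: assumes "punit x" shows "gcong P (theta x ^ 8) 1"
proof -
  have "theta x ^ 8 = (theta x ^ 4) ^ 2" by (simp flip: power_mult)
  also have "gcong P \<dots> ((of_int (pnorm x) ^ n) ^ 2)"
    by (intro gcong_power theta_pow4 assms)
  also have "\<dots> = of_int (pnorm x ^ (p - 1))"
    by (subst (2) p_eq) (simp flip: power_mult add: mult.commute)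
  also have "gcong P \<dots> (of_int 1)"
    using assms p_gt by (intro gcong_of_int int_fermat prime_p) (auto simp: punit_def)
  finally show ?thesis by simp
qed

text \<open>In the split case conjugation swaps the exponents \<open>m\<close> and
  \<open>3 m\<close>, which amounts to cubing because \<open>9 m = m + 8 m\<close>. In the field
  case \<open>3 (3 m + 1) = m + p\<close>, and the \<open>p\<close>-th power is conjugation.\<close>

lemma theta_conj: assumes "punit x" shows "gcong P (theta (pconj x)) (theta x ^ 3)"
proof (cases rule: cases_d)
  case pos
  have "theta x ^ 3 = emb x ^ (3 * m) * embc x ^ m * embc x ^ (8 * m)"
    by (simp add: theta_def pos(4,5) mult.commute[of m 4] mult.commute[of m 3] power_mult_distrib mult.assoc flip: power_add power_mult)
  also have "gcong P \<dots> (emb x ^ (3 * m) * embc x ^ m * 1)"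
    using pos(2) assms by (intro gcong_mult gcong_refl embc_fermat)
  also have "\<dots> = theta (pconj x)" by (simp add: theta_def embc_eq pos(4,5) mult.commute)
  finally show ?thesis by (rule gcong_sym)
next
  case neg
  have e0: "(3 * m + 1) * 3 = (m) + p" "m * 3 = 3 * m" using neg(1) by simp_all
  have e: "emb x ^ ((3 * m + 1) * 3) = emb x ^ (m) * emb x ^ p"
    unfolding e0 by (rule power_add)
  have "theta x ^ 3 = emb x ^ m * emb x ^ p * embc x ^ (3 * m)"
    by (simp only: theta_def neg(4,5) power_mult_distrib power_mult[symmetric] e e0(2))
  also have "gcong P \<dots> (emb x ^ m * embc x * embc x ^ (3 * m))"
    using neg(2) by (intro gcong_mult gcong_refl emb_frob_neg)
  also have "\<dots> = theta (pconj x)" by (simp add: theta_def embc_eq neg(4,5) mult_ac)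
  finally show ?thesis using gcong_sym by blast
qed

lemma sq_cong_cases: "gcong P (x ^ 2) (y ^ 2) \<Longrightarrow> gcong P x y \<or> gcong P x (- y)"
proof -
  assume "gcong P (x ^ 2) (y ^ 2)"
  moreover have "x ^ 2 - y ^ 2 = (x - y) * (x - - y)" by (simp add: power2_eq_square algebra_simps)
  ultimately show ?thesis unfolding gcong_def P_dvd_mult[symmetric] by simp
qed

end

section \<open>A character of order eight\<close>

context frob
begin

lemma int_pow_n:
  assumes "\<not> int p dvd a"
  shows "[a ^ n = 1] (mod int p) \<or> [a ^ n = - 1] (mod int p)"
proof -
  have "a ^ (p - 1) - 1 = (a ^ n - 1) * (a ^ n - (- 1))"
    by (subst p_eq) (simp add: algebra_simps flip: power_add mult_2)
  moreover have "int p dvd a ^ (p - 1) - 1"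
    using int_fermat[OF prime_p _ assms] p_gt by (simp add: cong_iff_dvd_diff)
  ultimately show ?thesis
    using prime_p prime_dvd_mult_iff[of "int p"] by (auto simp: cong_iff_dvd_diff)
qed

lemma p_not_dvd_2: "\<not> int p dvd 2"
  using p_gt by (auto dest!: zdvd_imp_le)

lemma primitive_root: obtains g :: int where "\<not> int p dvd g" "\<And>k. [g ^ k = 1] (mod int p) \<longleftrightarrow> (p - 1) dvd k"
proof -
  obtain g where g: "residue_primroot p g"
    using prime_primitive_root_exists[of p] prime_p p_gt by auto
  then have o: "ord p g = p - 1" "coprime p g"
    using prime_p by (auto simp: residue_primroot_def totient_prime)
  show thesis
  proof (rule that[of "int g"])
    show "\<not> int p dvd int g"
      using o(2) prime_p by (metis coprime_absorb_left int_dvd_int_iff not_prime_unit)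
    fix k show "[int g ^ k = 1] (mod int p) \<longleftrightarrow> (p - 1) dvd k"
      using ord_divides[of g k p] o(1) by (metis cong_int_iff of_nat_1 of_nat_power)
  qed
qed

lemma half: "2 * (int n + 1) = int p + 1"
  using odd_p by (auto elim!: oddE)

lemma ex_nonresidue_norm: "\<exists>x. punit x \<and> [pnorm x ^ n = - 1] (mod int p)"
proof (cases rule: cases_d)
  case pos
  obtain g :: int where g: "\<not> int p dvd g" "\<And>k. [g ^ k = 1] (mod int p) \<longleftrightarrow> (p - 1) dvd k"
    using primitive_root by blast
  have "\<not> (p - 1) dvd n" using p_gt by (auto dest!: dvd_imp_le)
  then have g1: "[g ^ n = - 1] (mod int p)" using g int_pow_n by blast
  \<comment> \<open>\<open>n + 1\<close> is the inverse of \<open>2\<close> modulo \<open>p\<close>,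
    so this element has the projections \<open>g\<close> and \<open>1\<close>, and norm
    \<open>g\<close>.\<close>
  let ?x = "((g + 1) * (int n + 1), (g - 1) * (int n + 1))"
  have "pnorm ?x = g * (2 * (int n + 1))\<^sup>2"
    unfolding pnorm_def unfolding pos(2) by (simp add: power2_eq_square algebra_simps)
  also have "\<dots> = g * (int p + 1)\<^sup>2" unfolding half ..
  also have "[\<dots> = g * (0 + 1)\<^sup>2] (mod int p)"
    by (intro cong_mult cong_pow cong_add cong_refl) (simp add: cong_0_iff)
  finally have N: "[pnorm ?x = g] (mod int p)" by simp
  then have "punit ?x" using g(1) cong_dvd_iff unfolding punit_def by blast
  moreover have "[pnorm ?x ^ n = - 1] (mod int p)" using cong_trans[OF cong_pow[OF N] g1] .
  ultimately show ?thesis by blast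
next
  case neg
  obtain g0 :: int where g0: "\<not> int p dvd g0" "\<And>k. [g0 ^ k = 1] (mod int p) \<longleftrightarrow> (p - 1) dvd k"
    using primitive_root by blast
  \<comment> \<open>For the least non-residue \<open>k\<close> the predecessor is a square
    \<open>y\<^sup>2\<close> modulo \<open>p\<close>, so \<open>1 + y \<epsilon>\<close> has norm
    \<open>1 + y\<^sup>2 = k\<close>.\<close>
  define Q where "Q k \<longleftrightarrow> \<not> int p dvd int k \<and> \<not> [int k ^ n = 1] (mod int p)" for k
  have "[int (nat (g0 mod int p)) = g0] (mod int p)" using p_gt by (simp add: cong_def)
  moreover have "\<not> (p - 1) dvd n" using p_gt by (auto dest!: dvd_imp_le)
  ultimately have "Q (nat (g0 mod int p))"
    unfolding Q_def using g0 by (metis cong_dvd_iff cong_pow cong_sym cong_trans)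
  then have L: "Q (LEAST k. Q k)" by (rule LeastI)
  define k where "k = (LEAST k. Q k)"
  have Qk: "Q k" using L by (simp only: k_def)
  have "k \<noteq> 0" using Qk by (metis Q_def dvd_0_right of_nat_0)
  moreover have "k \<noteq> 1" using Qk by (metis Q_def cong_refl of_nat_1 power_one)
  ultimately have kpos: "k > 1" by linarith
  have "\<not> Q (k - 1)" using kpos not_less_Least[of "k - 1" Q] unfolding k_def by auto
  moreover have "\<not> int p dvd int (k - 1)"
  proof
    assume "int p dvd int (k - 1)"
    then have "[int k = 1] (mod int p)" using kpos by (simp add: cong_iff_dvd_diff of_nat_diff)
    then have "[int k ^ n = 1] (mod int p)" using cong_pow[of "int k" 1 "int p" n] by simp
    then show False using Qk unfolding Q_def by simp
  qed
  ultimately have k1: "[int (k - 1) ^ n = 1] (mod int p)" "\<not> int p dvd int (k - 1)" unfolding Q_def by auto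
  have "QuadRes (int p) (int (k - 1))"
  proof (rule ccontr)
    assume "\<not> QuadRes (int p) (int (k - 1))"
    then have "Legendre (int (k - 1)) (int p) = - 1" using k1 by (simp add: Legendre_def cong_0_iff)
    then have "[- 1 = 1] (mod int p)"
      using euler_criterion[OF prime_p, of "int (k - 1)"] k1(1) p_gt cong_trans by fastforce
    then have "int p dvd - 2" by (simp add: cong_iff_dvd_diff)
    then show False using p_not_dvd_2 by simp
  qed
  then obtain y where y: "[y\<^sup>2 = int (k - 1)] (mod int p)" unfolding QuadRes_def by blast
  have "pnorm (1, y) = 1 + y\<^sup>2" unfolding pnorm_def unfolding neg(2) by simp
  also have "[\<dots> = 1 + int (k - 1)] (mod int p)" by (intro cong_add y cong_refl)
  finally have N: "[pnorm (1, y) = int k] (mod int p)" using kpos by (simp add: of_nat_diff)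
  then have "punit (1, y)" using Qk cong_dvd_iff unfolding punit_def Q_def by blast
  moreover have "[int k ^ n = - 1] (mod int p)"
    using Qk int_pow_n unfolding Q_def by blast
  then have "[pnorm (1, y) ^ n = - 1] (mod int p)" using cong_trans[OF cong_pow[OF N]] by blast
  ultimately show ?thesis by blast
qed

text \<open>Not a generator of the unit group: only its value \<open>zeta\<close> under
  \<open>theta\<close> has to be a primitive eighth root of unity.\<close>

definition gen :: ipair where "gen = (SOME x. punit x \<and> gcong P (theta x ^ 4) (- 1))"
definition zeta :: 'a where "zeta = theta gen"

lemma gen: "punit gen" "gcong P (zeta ^ 4) (- 1)"
proof -
  obtain x where x: "punit x" "[pnorm x ^ n = - 1] (mod int p)" using ex_nonresidue_norm by blast
  have "gcong P (theta x ^ 4) (of_int (pnorm x) ^ n)" by (rule theta_pow4[OF x(1)])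
  also have "gcong P \<dots> (- 1)" using gcong_of_int[OF x(2)] by simp
  finally have "\<exists>x. punit x \<and> gcong P (theta x ^ 4) (- 1)" using x by blast
  from someI_ex[OF this] show "punit gen" "gcong P (zeta ^ 4) (- 1)"
    unfolding gen_def zeta_def by auto
qed

lemma not_1_cong_minus_1: "\<not> gcong P 1 (- 1)"
  using P_dvd_of_int_iff[of 2] p_not_dvd_2 by (simp add: gcong_def)

lemma not_P_dvd_1: "\<not> P dvd 1"
  using prime_elem_p by (simp add: prime_elem_def)

lemma zeta_add4: "gcong P (- (zeta ^ k)) (zeta ^ (k + 4))"
proof -
  have "gcong P (zeta ^ k * zeta ^ 4) (zeta ^ k * (- 1))" by (intro gcong_mult gcong_refl gen)
  then show ?thesis using gcong_sym by (simp add: power_add)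
qed

lemma zeta_root_cases:
  assumes "gcong P (z ^ 2) (zeta ^ (2 * k))"
  shows "gcong P z (zeta ^ k) \<or> gcong P z (zeta ^ (k + 4))"
proof -
  have "gcong P z (zeta ^ k) \<or> gcong P z (- (zeta ^ k))"
    using assms by (intro sq_cong_cases) (simp add: mult.commute power_mult)
  then show ?thesis using zeta_add4 gcong_trans by blast
qed

text \<open>Take square roots three times. The two roots of \<open>zeta ^ (2 * k)\<close> are
  \<open>zeta ^ k\<close> and \<open>- zeta ^ k\<close>, and the latter is
  \<open>zeta ^ (k + 4)\<close>, so the powers of \<open>zeta\<close> are never left.\<close>

lemma root8:
  assumes "gcong P (z ^ 8) 1"
  shows "\<exists>k<8. gcong P z (zeta ^ k)"
proof -
  have "gcong P ((z ^ 4) ^ 2) (zeta ^ (2 * 0))" using assms by (simp flip: power_mult)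
  from zeta_root_cases[OF this] have "gcong P ((z ^ 2) ^ 2) (zeta ^ (2 * 0)) \<or> gcong P ((z ^ 2) ^ 2) (zeta ^ (2 * 2))"
    by (simp flip: power_mult)
  then have "gcong P (z ^ 2) (zeta ^ (2 * 0)) \<or> gcong P (z ^ 2) (zeta ^ (2 * 2)) \<or>
      gcong P (z ^ 2) (zeta ^ (2 * 1)) \<or> gcong P (z ^ 2) (zeta ^ (2 * 3))"
    using zeta_root_cases[of "z ^ 2" 0] zeta_root_cases[of "z ^ 2" 2] by auto
  then have "\<exists>k<4. gcong P (z ^ 2) (zeta ^ (2 * k))"
    by (elim disjE) (rule exI[of _ 0], simp, rule exI[of _ 2], simp, rule exI[of _ 1], simp, rule exI[of _ 3], simp)
  then obtain k where k: "k < 4" "gcong P (z ^ 2) (zeta ^ (2 * k))" by blast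
  show ?thesis using zeta_root_cases[OF k(2)] k(1)
    by (elim disjE) (rule exI[of _ k], simp, rule exI[of _ "k + 4"], simp)
qed

lemma zeta_pow_8: "gcong P (zeta ^ 8) 1"
  unfolding zeta_def by (rule theta_pow8[OF gen(1)])

lemma zeta_not_dvd: "\<not> P dvd zeta ^ k"
proof
  assume "P dvd zeta ^ k"
  then have "P dvd zeta" by (rule P_dvd_power)
  then have "P dvd zeta ^ 8" using dvd_trans[OF _ dvd_power[of 8 zeta]] by simp
  then show False using zeta_pow_8 gcong_dvd_iff not_P_dvd_1 by blast
qed

lemma zeta_pow_eq_1: "gcong P (zeta ^ k) 1 \<Longrightarrow> 8 dvd k"
  by (rule gcong_root8_order[OF gen(2) not_1_cong_minus_1])

lemma zeta_inj_le: assumes "gcong P (zeta ^ i) (zeta ^ j)" "i \<le> j" shows "[i = j] (mod 8)"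
proof -
  have "zeta ^ j = zeta ^ i * zeta ^ (j - i)" using assms(2) by (simp flip: power_add)
  then have "gcong P (zeta ^ i * zeta ^ (j - i)) (zeta ^ i * 1)" using assms(1) gcong_sym by simp
  then have "gcong P (zeta ^ (j - i)) 1" using P_cancel zeta_not_dvd by blast
  then show ?thesis using zeta_pow_eq_1 assms(2) by (metis cong_altdef_nat cong_sym)
qed

lemma zeta_inj: "gcong P (zeta ^ i) (zeta ^ j) \<Longrightarrow> [i = j] (mod 8)"
  using zeta_inj_le[of i j] zeta_inj_le[of j i] gcong_sym cong_sym by (metis nle_le)

text \<open>Reading the values of \<open>theta\<close> as exponents of \<open>zeta\<close> frees
  them from the ring \<open>'a\<close>: the same exponent is used below with a complex root of unity
  and with a lift modulo \<open>p\<^sup>2\<close>.\<close>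

definition char_index :: "ipair \<Rightarrow> nat" where "char_index x = (SOME k. k < 8 \<and> gcong P (theta x) (zeta ^ k))"

lemma char_index: assumes "punit x" shows "char_index x < 8" "gcong P (theta x) (zeta ^ char_index x)"
  using someI_ex[OF root8[OF theta_pow8[OF assms], unfolded Bex_def]] unfolding char_index_def by auto

lemma char_index_eqI: assumes "punit x" "gcong P (theta x) (zeta ^ k)" shows "[char_index x = k] (mod 8)"
  using zeta_inj[of "char_index x" k] char_index[OF assms(1)] assms(2) gcong_sym gcong_trans by blast

definition omega :: complex where "omega = cis (pi / 4)"
definition chi :: "ipair \<Rightarrow> complex" where "chi x = omega ^ char_index x"

lemma omega_pow4: "omega ^ 4 = - 1"
  unfolding omega_def by (simp add: DeMoivre)

lemma omega_cong: "[i = j] (mod 8) \<Longrightarrow> omega ^ i = omega ^ j"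
  using gcong_root8_mod[of 0 omega i j] omega_pow4 by (simp add: gcong_def)

lemma omega_sum: "omega + omega ^ 3 = complex_of_real (sqrt 2) * \<i>"
proof -
  have "omega = complex_of_real (sqrt 2 / 2) * (1 + \<i>)"
    by (simp add: omega_def complex_eq_iff cos_45 sin_45)
  moreover have "omega ^ 3 = complex_of_real (sqrt 2 / 2) * (- 1 + \<i>)"
  proof -
    have "omega ^ 3 = cis (3 * pi / 4)" by (simp add: omega_def DeMoivre)
    also have "\<dots> = cis (pi / 4) * cis (pi / 2)" by (subst cis_mult) (simp add: field_simps)
    also have "\<dots> = omega * \<i>" by (simp add: omega_def)
    finally show ?thesis by (simp add: \<open>omega = _\<close> algebra_simps)
  qed
  ultimately have "omega + omega ^ 3 = complex_of_real (sqrt 2 / 2) * (1 + \<i>) + complex_of_real (sqrt 2 / 2) * (- 1 + \<i>)"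
    by (simp only:)
  also have "\<dots> = complex_of_real (sqrt 2) * \<i>" by (simp add: complex_eq_iff)
  finally show ?thesis .
qed

lemma chi_eqI: "punit x \<Longrightarrow> gcong P (theta x) (zeta ^ k) \<Longrightarrow> chi x = omega ^ k"
  unfolding chi_def using char_index_eqI omega_cong by blast

lemma chi_mul: assumes "punit x" "punit y" shows "chi (pmul x y) = chi x * chi y"
proof -
  have "gcong P (theta x * theta y) (zeta ^ char_index x * zeta ^ char_index y)" by (intro gcong_mult char_index assms)
  then show ?thesis using assms chi_eqI[of "pmul x y" "char_index x + char_index y"]
    by (simp add: theta_mul punit_mul power_add chi_def)
qed

lemma chi_cong: assumes "pcg x y" "punit x" shows "chi x = chi y"
proof -
  have "punit y" using assms punit_cong by blast
  then have "gcong P (theta x) (zeta ^ char_index y)" using theta_cong[OF assms(1)] char_index gcong_trans by blast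
  then show ?thesis using chi_eqI[OF assms(2)] unfolding chi_def by blast
qed

lemma chi_conj: assumes "punit x" shows "chi (pconj x) = chi x ^ 3"
proof -
  have "gcong P (theta (pconj x)) ((zeta ^ char_index x) ^ 3)"
    using gcong_trans[OF theta_conj[OF assms] gcong_power[OF char_index(2)[OF assms]]] .
  then show ?thesis using chi_eqI[of "pconj x" "char_index x * 3"] assms by (simp add: chi_def power_mult)
qed

lemma chi_eq_1: assumes "punit x" "chi x = 1" shows "gcong P (theta x) 1"
proof -
  have "8 dvd char_index x"
    using assms(2) omega_pow4 by (intro gcong_root8_order[of 0 omega]) (auto simp: gcong_def chi_def)
  then have "char_index x = 0" using char_index(1)[OF assms(1)] by auto
  then show ?thesis using char_index(2)[OF assms(1)] by simp
qed

lemma chi_cnj: "chi x * cnj (chi x) = 1"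
  by (simp add: chi_def omega_def cis_cnj DeMoivre cis_mult)

definition red :: "ipair \<Rightarrow> ipair" where "red x = (fst x mod int p, snd x mod int p)"
definition U :: "ipair set" where "U = {x \<in> {0..<int p} \<times> {0..<int p}. punit x}"

lemma pcg_red: "pcg (red x) x"
  by (simp add: pcg_def red_def cong_def)

lemma red_mem: "punit x \<Longrightarrow> red x \<in> U"
  using punit_cong[OF pcg_red] p_gt by (auto simp: U_def red_def)

lemma finite_U: "finite U" by (simp add: U_def)

lemma pcg_imp_eq: assumes "x \<in> {0..<int p} \<times> {0..<int p}" "y \<in> {0..<int p} \<times> {0..<int p}" "pcg x y" shows "x = y"
  using assms by (auto simp: pcg_def cong_def prod_eq_iff)

lemma U_D: "x \<in> U \<Longrightarrow> punit x" "x \<in> U \<Longrightarrow> x \<in> {0..<int p} \<times> {0..<int p}"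
  by (auto simp: U_def)

lemma pmul_cancel:
  assumes "punit g" "pcg (pmul g x) (pmul g y)" shows "pcg x y"
proof -
  have e: "pmul (pconj g) (pmul g z) = (pnorm g * fst z, pnorm g * snd z)" for z
    by (simp add: pmul_def pconj_def pnorm_def power2_eq_square algebra_simps)
  have "pcg (pnorm g * fst x, pnorm g * snd x) (pnorm g * fst y, pnorm g * snd y)"
    unfolding e[symmetric] by (intro pmul_cong assms pcg_refl)
  moreover have "coprime (pnorm g) (int p)"
    using assms(1) prime_p unfolding punit_def by (simp add: prime_imp_coprime coprime_commute)
  ultimately show ?thesis by (simp add: pcg_def cong_mult_lcancel)
qed

lemma sum_pmul_invariant:
  assumes A: "A \<subseteq> U" and g: "punit g" and inv: "\<And>x. x \<in> A \<Longrightarrow> red (pmul g x) \<in> A"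
  shows "(\<Sum>x\<in>A. f (red (pmul g x))) = (\<Sum>x\<in>A. f x)"
    and "(\<lambda>x. red (pmul g x)) ` A = A"
proof -
  have fin: "finite A" using A finite_U finite_subset by blast
  have inj: "inj_on (\<lambda>x. red (pmul g x)) A"
  proof (rule inj_onI)
    fix x y assume xy: "x \<in> A" "y \<in> A" "red (pmul g x) = red (pmul g y)"
    then have "pcg (pmul g x) (pmul g y)" using pcg_red pcg_sym pcg_trans by metis
    then have "pcg x y" using pmul_cancel g by blast
    then show "x = y" using pcg_imp_eq xy A U_D by blast
  qed
  show im: "(\<lambda>x. red (pmul g x)) ` A = A"
    using endo_inj_surj[OF fin _ inj] inv by blast
  show "(\<Sum>x\<in>A. f (red (pmul g x))) = (\<Sum>x\<in>A. f x)"
    using sum.reindex[OF inj, of f] im by simp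
qed

text \<open>Stated for any set stable under a single \<open>g\<close> of nontrivial value, because
  it serves the whole unit group, the scalars and the degenerate lines alike.\<close>

lemma sum_chi_eq_0:
  assumes A: "A \<subseteq> U" and g: "punit g" and inv: "\<And>x. x \<in> A \<Longrightarrow> red (pmul g x) \<in> A"
    and nt: "\<not> gcong P (theta g) 1"
  shows "(\<Sum>x\<in>A. chi x) = 0"
proof -
  have "(\<Sum>x\<in>A. chi x) = (\<Sum>x\<in>A. chi (red (pmul g x)))"
    by (rule sum_pmul_invariant(1)[OF A g inv, symmetric])
  also have "\<dots> = (\<Sum>x\<in>A. chi g * chi x)"
  proof (rule sum.cong)
    fix x assume "x \<in> A"
    then have x: "punit x" using A U_D by blast
    then show "chi (red (pmul g x)) = chi g * chi x"
      using chi_mul[OF g x] chi_cong[OF pcg_sym[OF pcg_red]] g by (simp add: punit_mul)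
  qed simp
  also have "\<dots> = chi g * (\<Sum>x\<in>A. chi x)" by (simp add: sum_distrib_left)
  finally have "(1 - chi g) * (\<Sum>x\<in>A. chi x) = 0" by (simp add: algebra_simps)
  moreover have "chi g \<noteq> 1" using nt chi_eq_1[OF g] by blast
  ultimately show ?thesis by simp
qed

end

section \<open>The norm of the character sum\<close>

context frob
begin

definition S :: "int set" where "S = {s \<in> {0..<int p}. punit (1, s)}"
definition line :: "int \<Rightarrow> ipair set"
  where "line s = {x \<in> U. [fst x + d * snd x * s = 1] (mod int p)}"
definition char_sum :: complex where "char_sum = (\<Sum>s\<in>S. chi (1, s))"

lemma S_D: "s \<in> S \<Longrightarrow> punit (1, s)" "s \<in> S \<Longrightarrow> 0 \<le> s \<and> s < int p" "s \<in> S \<Longrightarrow> (1, s) \<in> U"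
  using p_gt by (auto simp: S_def U_def)

lemma not_S_D: "s \<in> {0..<int p} \<Longrightarrow> s \<notin> S \<Longrightarrow> int p dvd 1 - d * s\<^sup>2"
  by (simp add: S_def punit_def pnorm_def)

lemma
  assumes "d = 1"
  shows pnorm_pos: "pnorm x = fst x * fst x - snd x * snd x"
    and line_pos: "x \<in> line s \<longleftrightarrow> x \<in> U \<and> [fst x + s * snd x = 1] (mod int p)"
    and pmul_pos: "fst (pmul x y) = fst x * fst y + snd x * snd y" "snd (pmul x y) = fst x * snd y + snd x * fst y"
  unfolding pnorm_def line_def pmul_def unfolding assms by (simp_all add: power2_eq_square mult.commute)


lemma chi_red_mul: "punit x \<Longrightarrow> punit y \<Longrightarrow> chi (red (pmul x y)) = chi x * chi y"
  using chi_cong[OF pcg_sym[OF pcg_red[of "pmul x y"]]] chi_mul by (simp add: punit_mul)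

lemma cong_imp_eq: "[x = y] (mod int p) \<Longrightarrow> x \<in> {0..<int p} \<Longrightarrow> y \<in> {0..<int p} \<Longrightarrow> x = y"
  by (auto simp: cong_def)

text \<open>Multiplication by \<open>1 + s \<epsilon>\<close> maps \<open>line s\<close> bijectively onto the set of all \<open>1 + t \<epsilon>\<close>.\<close>
lemma char_sum_eq_line:
  assumes s: "s \<in> S"
  shows "char_sum = chi (1, s) * (\<Sum>x\<in>line s. chi x)"
proof -
  let ?f = "\<lambda>x. red (pmul (1, s) x)"
  have perm: "?f ` U = U"
    using sum_pmul_invariant(2)[of U "(1, s)"] S_D[OF s] red_mem U_D by (auto simp: punit_mul)
  have fst_f: "[fst (?f x) = fst x + d * snd x * s] (mod int p)" for x
    by (simp add: red_def pmul_def cong_def mult_ac)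
  have inj: "inj_on ?f U"
    using perm finite_U by (simp add: eq_card_imp_inj_on)
  have im: "?f ` line s = (\<lambda>t. (1 :: int, t)) ` S"
  proof (intro equalityI subsetI)
    fix y assume "y \<in> ?f ` line s"
    then obtain x where x: "x \<in> line s" "y = ?f x" by blast
    then have yU: "y \<in> U" using perm by (auto simp: line_def)
    have "[fst y = 1] (mod int p)" using x fst_f[of x] cong_trans unfolding line_def by blast
    then have "fst y = 1" using yU p_gt cong_imp_eq[of "fst y" 1] by (auto simp: U_def)
    then have "y = (1, snd y)" by (simp add: prod_eq_iff)
    then show "y \<in> (\<lambda>t. (1 :: int, t)) ` S" using yU
      by (metis (mono_tags, lifting) S_def U_def image_eqI mem_Collect_eq mem_Sigma_iff)
  next
    fix y assume "y \<in> (\<lambda>t. (1 :: int, t)) ` S"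
    then obtain t where t: "t \<in> S" "y = (1, t)" by blast
    then have "y \<in> U" using S_D by blast
    then obtain x where x: "x \<in> U" "y = ?f x" using perm by blast
    have "fst (?f x) = 1" using x(2) t(2) by (metis fst_conv)
    then have "[fst x + d * snd x * s = 1] (mod int p)"
      using cong_sym[OF fst_f[of x]] by simp
    then show "y \<in> ?f ` line s" using x by (auto simp: line_def)
  qed
  have "char_sum = (\<Sum>y\<in>(\<lambda>t. (1 :: int, t)) ` S. chi y)"
    unfolding char_sum_def by (subst sum.reindex) (auto simp: inj_on_def)
  also have "\<dots> = (\<Sum>x\<in>line s. chi (?f x))"
    unfolding im[symmetric]
    by (subst sum.reindex) (auto intro: inj_on_subset[OF inj] simp: line_def)
  also have "\<dots> = (\<Sum>x\<in>line s. chi (1, s) * chi x)"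
    using S_D[OF s] U_D by (intro sum.cong chi_red_mul refl) (auto simp: line_def)
  finally show ?thesis by (simp add: sum_distrib_left)
qed

text \<open>Each summand \<open>cnj (chi (1, s))\<close> of the conjugate cancels the unimodular
  factor that \<open>char_sum_eq_line\<close> produces for the same \<open>s\<close>.\<close>

lemma char_sum_norm_lines: "char_sum * cnj char_sum = (\<Sum>s\<in>S. \<Sum>x\<in>line s. chi x)"
proof -
  have "char_sum * cnj char_sum = (\<Sum>s\<in>S. char_sum * cnj (chi (1, s)))"
    by (subst (2) char_sum_def) (simp add: sum_distrib_left)
  also have "\<dots> = (\<Sum>s\<in>S. \<Sum>x\<in>line s. chi x)"
  proof (rule sum.cong)
    fix s assume s: "s \<in> S"
    have "char_sum * cnj (chi (1, s)) = (chi (1, s) * cnj (chi (1, s))) * (\<Sum>x\<in>line s. chi x)"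
      unfolding char_sum_eq_line[OF s] by (simp only: mult_ac)
    then show "char_sum * cnj (chi (1, s)) = (\<Sum>x\<in>line s. chi x)"
      by (simp add: chi_cnj)
  qed simp
  finally show ?thesis .
qed

lemma half_cong: "[2 * (int n + 1) = 1] (mod int p)"
  unfolding half by (simp add: cong_iff_dvd_diff)

lemma S_neg:
  assumes "d = - 1" "s \<in> {0..<int p}"
  shows "s \<in> S"
proof (rule ccontr)
  assume "s \<notin> S"
  then have dv: "int p dvd 1 + s\<^sup>2" using not_S_D[OF assms(2)] unfolding assms(1) by simp
  have "p = 8 * m + 3" using assms(1) by (cases rule: cases_d) auto
  then have "int p dvd 1" using prime_dvd_sum_two_squares[OF prime_p, of m 1 s] dv by simp
  then show False using p_gt by simp
qed

lemma S_pos: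
  assumes "d = 1" "s \<in> {0..<int p}" "s \<notin> S"
  shows "[s * s = 1] (mod int p)" "[s = 1] (mod int p) \<or> [s = - 1] (mod int p)"
proof -
  have dv: "int p dvd 1 - s\<^sup>2" using not_S_D[OF assms(2,3)] unfolding assms(1) by simp
  then show s2: "[s * s = 1] (mod int p)"
    by (simp add: cong_iff_dvd_diff power2_eq_square dvd_diff_commute)
  have "int p dvd (s - 1) * (s + 1)" using s2 by (simp add: cong_iff_dvd_diff algebra_simps)
  then show "[s = 1] (mod int p) \<or> [s = - 1] (mod int p)"
    using prime_p prime_dvd_mult_iff[of "int p"] by (auto simp: cong_iff_dvd_diff)
qed

text \<open>This concerns only \<open>s = 1\<close> and \<open>s = - 1\<close> in the split case,
  where \<open>1 + s \<epsilon>\<close> is a zero divisor. The line then fixes one projection of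
  \<open>x\<close> and leaves the other free, and the character is nontrivial on the free
  one.\<close>

lemma sum_line_bad:
  assumes "s \<notin> S" "s \<in> {0..<int p}"
  shows "(\<Sum>x\<in>line s. chi x) = 0"
proof (cases rule: cases_d)
  case neg
  then show ?thesis using S_neg assms by blast
next
  case pos
  note s2 = S_pos(1)[OF pos(2) assms(2,1)]
  obtain g :: int where g: "\<not> int p dvd g" "\<And>k. [g ^ k = 1] (mod int p) \<longleftrightarrow> (p - 1) dvd k"
    using primitive_root by blast
  define h where "h = int n + 1"
  \<comment> \<open>As \<open>h\<close> inverts \<open>2\<close> and \<open>s\<^sup>2 = 1\<close>,
    modulo \<open>p\<close> the combination \<open>fst \<gamma> + s * snd \<gamma>\<close> is
    \<open>1\<close>, which keeps the line stable, and
    \<open>fst \<gamma> - s * snd \<gamma>\<close> is the primitive root \<open>g\<close>, which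
    makes the character nontrivial at \<open>\<gamma>\<close>.\<close>
  define \<gamma> where "\<gamma> = ((1 + g) * h, s * (1 - g) * h)"
  have h2: "[2 * h = 1] (mod int p)" using half_cong by (simp add: h_def)
  have plus: "[fst \<gamma> + s * snd \<gamma> = 1] (mod int p)"
  proof -
    have "fst \<gamma> + s * snd \<gamma> = (1 + g) * h + (s * s) * ((1 - g) * h)" by (simp add: \<gamma>_def algebra_simps)
    also have "[\<dots> = (1 + g) * h + 1 * ((1 - g) * h)] (mod int p)"
      by (intro cong_add cong_mult s2 cong_refl)
    also have "(1 + g) * h + 1 * ((1 - g) * h) = 2 * h" by (simp add: algebra_simps)
    finally show ?thesis using h2 cong_trans by blast
  qed
  have minus: "[fst \<gamma> - s * snd \<gamma> = g] (mod int p)"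
  proof -
    have "fst \<gamma> - s * snd \<gamma> = (1 + g) * h - (s * s) * ((1 - g) * h)" by (simp add: \<gamma>_def algebra_simps)
    also have "[\<dots> = (1 + g) * h - 1 * ((1 - g) * h)] (mod int p)"
      by (intro cong_diff cong_mult s2 cong_refl)
    also have "(1 + g) * h - 1 * ((1 - g) * h) = g * (2 * h)" by (simp add: algebra_simps)
    finally show ?thesis using cong_mult[OF cong_refl[of g] h2] cong_trans by fastforce
  qed
  have "[pnorm \<gamma> = 1 * g] (mod int p)"
  proof -
    have "fst \<gamma> * fst \<gamma> - (s * s) * (snd \<gamma> * snd \<gamma>) = (fst \<gamma> + s * snd \<gamma>) * (fst \<gamma> - s * snd \<gamma>)"
      by (simp add: algebra_simps)
    also have "[\<dots> = 1 * g] (mod int p)" by (intro cong_mult plus minus)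
    finally have "[fst \<gamma> * fst \<gamma> - (s * s) * (snd \<gamma> * snd \<gamma>) = 1 * g] (mod int p)" .
    moreover have "[fst \<gamma> * fst \<gamma> - (s * s) * (snd \<gamma> * snd \<gamma>) = fst \<gamma> * fst \<gamma> - 1 * (snd \<gamma> * snd \<gamma>)] (mod int p)"
      by (intro cong_diff cong_mult s2 cong_refl)
    ultimately have "[fst \<gamma> * fst \<gamma> - 1 * (snd \<gamma> * snd \<gamma>) = 1 * g] (mod int p)"
      using cong_trans[OF cong_sym] by blast
    then show ?thesis unfolding pnorm_pos[OF pos(2)] by simp
  qed
  then have pu: "punit \<gamma>" using g(1) cong_dvd_iff unfolding punit_def by (metis mult_1)
  have "[s = 1] (mod int p) \<or> [s = - 1] (mod int p)" by (rule S_pos(2)[OF pos(2) assms(2,1)])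
  then have "[fst \<gamma> + snd \<gamma> = 1] (mod int p) \<and> [fst \<gamma> - snd \<gamma> = g] (mod int p) \<or>
      [fst \<gamma> + snd \<gamma> = g] (mod int p) \<and> [fst \<gamma> - snd \<gamma> = 1] (mod int p)"
  proof
    assume s1: "[s = 1] (mod int p)"
    have 1: "[fst \<gamma> + s * snd \<gamma> = fst \<gamma> + 1 * snd \<gamma>] (mod int p)" and 2: "[fst \<gamma> - s * snd \<gamma> = fst \<gamma> - 1 * snd \<gamma>] (mod int p)"
      by (intro cong_add cong_diff cong_mult s1 cong_refl)+
    show ?thesis using cong_trans[OF cong_sym[OF 1] plus] cong_trans[OF cong_sym[OF 2] minus] by simp
  next
    assume s1: "[s = - 1] (mod int p)"
    have 1: "[fst \<gamma> + s * snd \<gamma> = fst \<gamma> + - 1 * snd \<gamma>] (mod int p)" and 2: "[fst \<gamma> - s * snd \<gamma> = fst \<gamma> - - 1 * snd \<gamma>] (mod int p)"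
      by (intro cong_add cong_diff cong_mult s1 cong_refl)+
    show ?thesis using cong_trans[OF cong_sym[OF 1] plus] cong_trans[OF cong_sym[OF 2] minus] by simp
  qed
  moreover have e: "emb \<gamma> = of_int (fst \<gamma> + snd \<gamma>)" "embc \<gamma> = of_int (fst \<gamma> - snd \<gamma>)"
    unfolding emb_def embc_def unfolding pos(6) by simp_all
  moreover have "gcong P (of_int a) 1" if "[a = 1] (mod int p)" for a
    using gcong_of_int[OF that] by simp
  ultimately have em: "gcong P (emb \<gamma>) 1 \<and> gcong P (embc \<gamma>) (of_int g) \<or> gcong P (emb \<gamma>) (of_int g) \<and> gcong P (embc \<gamma>) 1"
    unfolding e using gcong_of_int by blast
  have nt: "\<not> gcong P (theta \<gamma>) 1"
  proof
    assume th: "gcong P (theta \<gamma>) 1"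
    have "\<exists>k. k \<in> {m, 3 * m} \<and> gcong P (theta \<gamma>) (of_int g ^ k)"
    proof (cases "gcong P (emb \<gamma>) 1 \<and> gcong P (embc \<gamma>) (of_int g)")
      case True
      then have "gcong P (theta \<gamma>) (1 ^ exA * of_int g ^ exB)"
        unfolding theta_def by (intro gcong_mult gcong_power) auto
      then show ?thesis using pos(5) by (intro exI[of _ "3 * m"]) simp
    next
      case False
      then have "gcong P (theta \<gamma>) (of_int g ^ exA * 1 ^ exB)"
        unfolding theta_def using em by (intro gcong_mult gcong_power) auto
      then show ?thesis using pos(4) by (intro exI[of _ m]) simp
    qed
    then obtain k where k: "k \<in> {m, 3 * m}" "gcong P (theta \<gamma>) (of_int g ^ k)" by blast
    then have "gcong P (of_int (g ^ k)) (of_int 1)" using th gcong_sym gcong_trans by (metis of_int_1 of_int_power)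
    then have "[g ^ k = 1] (mod int p)"
      unfolding gcong_def of_int_diff[symmetric] P_dvd_of_int_iff by (simp add: cong_iff_dvd_diff)
    then have "(p - 1) dvd k" using g by blast
    then have "8 * m dvd k" using pos(1) by simp
    then show False using k(1) m_pos by (auto dest!: dvd_imp_le)
  qed
  show ?thesis
  proof (rule sum_chi_eq_0[OF _ pu _ nt])
    show "line s \<subseteq> U" by (auto simp: line_def)
    fix x assume x: "x \<in> line s"
    have xu: "punit x" and x1: "[fst x + s * snd x = 1] (mod int p)"
      using x U_D unfolding line_pos[OF pos(2)] by auto
    have r: "red (pmul \<gamma> x) \<in> U" using xu pu by (intro red_mem) (simp add: punit_mul)
    let ?y = "pmul \<gamma> x"
    have y: "fst ?y = fst \<gamma> * fst x + snd \<gamma> * snd x" "snd ?y = fst \<gamma> * snd x + snd \<gamma> * fst x"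
      by (rule pmul_pos[OF pos(2)])+
    have 1: "[fst (red ?y) + s * snd (red ?y) = fst ?y + s * snd ?y] (mod int p)"
      using pcg_red[of ?y] unfolding pcg_def by (intro cong_add cong_mult cong_refl) auto
    have "fst ?y + s * snd ?y = fst \<gamma> * fst x + 1 * (snd \<gamma> * snd x) + s * (fst \<gamma> * snd x + snd \<gamma> * fst x)"
      unfolding y by simp
    also have "[\<dots> = fst \<gamma> * fst x + (s * s) * (snd \<gamma> * snd x) + s * (fst \<gamma> * snd x + snd \<gamma> * fst x)] (mod int p)"
      by (intro cong_add cong_mult cong_sym[OF s2] cong_refl)
    finally have 2: "[fst ?y + s * snd ?y = fst \<gamma> * fst x + (s * s) * (snd \<gamma> * snd x) + s * (fst \<gamma> * snd x + snd \<gamma> * fst x)] (mod int p)" .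
    have "fst \<gamma> * fst x + (s * s) * (snd \<gamma> * snd x) + s * (fst \<gamma> * snd x + snd \<gamma> * fst x) =
        (fst \<gamma> + s * snd \<gamma>) * (fst x + s * snd x)" by (simp add: algebra_simps)
    also have "[\<dots> = 1 * 1] (mod int p)" by (intro cong_mult plus x1)
    finally have "[fst (red ?y) + s * snd (red ?y) = 1] (mod int p)"
      using cong_trans[OF 1 cong_trans[OF 2]] by simp
    then show "red (pmul \<gamma> x) \<in> line s" using r unfolding line_pos[OF pos(2)] by simp
  qed
qed

end

section \<open>The sum over all lines and the coordinates of the character sum\<close>

context frob
begin

lemma gen_nontrivial: "\<not> gcong P (theta gen) 1"
proof
  assume "gcong P (theta gen) 1"
  then have "gcong P (zeta ^ 4) (1 ^ 4)" unfolding zeta_def by (rule gcong_power)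
  then have "gcong P 1 (- 1)" using gen(2) gcong_sym gcong_trans by (metis power_one)
  then show False using not_1_cong_minus_1 by blast
qed

lemma sum_chi_U: "(\<Sum>x\<in>U. chi x) = 0"
proof (rule sum_chi_eq_0[OF subset_refl gen(1) _ gen_nontrivial])
  fix x assume "x \<in> U"
  then show "red (pmul gen x) \<in> U" using gen(1) U_D by (intro red_mem) (auto simp: punit_mul)
qed

lemma exAB: "exA + exB = n"
  by (cases rule: cases_d) linarith+

lemma theta_scalar: "theta (c, 0) = of_int (c ^ n)"
  by (simp add: theta_def emb_def embc_def exAB flip: power_add)

lemma punit_scalar: "punit (c, 0) \<longleftrightarrow> \<not> int p dvd c"
  using prime_p by (simp add: punit_def pnorm_def prime_dvd_power_iff)

lemma sum_chi_scalars: "(\<Sum>x\<in>{x \<in> U. snd x = 0}. chi x) = 0"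
proof -
  obtain g :: int where g: "\<not> int p dvd g" "\<And>k. [g ^ k = 1] (mod int p) \<longleftrightarrow> (p - 1) dvd k"
    using primitive_root by blast
  have pu: "punit (g, 0)" using g(1) punit_scalar by blast
  show ?thesis
  proof (rule sum_chi_eq_0[OF _ pu])
    fix x assume x: "x \<in> {x \<in> U. snd x = 0}"
    then have "red (pmul (g, 0) x) \<in> U" using pu U_D by (intro red_mem) (auto simp: punit_mul)
    then show "red (pmul (g, 0) x) \<in> {x \<in> U. snd x = 0}" using x by (simp add: red_def pmul_def)
  next
    have "\<not> (p - 1) dvd n" using p_gt by (auto dest!: dvd_imp_le)
    then have "\<not> [g ^ n = 1] (mod int p)" using g by blast
    then show "\<not> gcong P (theta (g, 0)) 1"
      unfolding theta_scalar gcong_def using P_dvd_of_int_iff[of "g ^ n - 1"] by (simp add: cong_iff_dvd_diff)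
  qed auto
qed

lemma chi_one: "chi (1, 0) = 1"
  using chi_eqI[of "(1, 0)" 0] by (simp add: theta_scalar punit_scalar) (use p_gt in auto)

text \<open>Count the lines through each unit. A non-scalar lies on exactly one, because
  \<open>d * snd x\<close> is invertible; a scalar lies on none, except \<open>1\<close>, which lies
  on all \<open>p\<close>. The non-scalars contribute zero, since the sums over all units and over
  the scalars both vanish.\<close>

lemma sum_all_lines: "(\<Sum>s\<in>{0..<int p}. \<Sum>x\<in>line s. chi x) = of_nat p"
proof -
  define N where "N x = card {s \<in> {0..<int p}. [fst x + d * snd x * s = 1] (mod int p)}" for x
  have "(\<Sum>s\<in>{0..<int p}. \<Sum>x\<in>line s. chi x) =
      (\<Sum>s\<in>{0..<int p}. \<Sum>x\<in>U. if [fst x + d * snd x * s = 1] (mod int p) then chi x else 0)"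
    unfolding line_def by (intro sum.cong refl sum.inter_filter finite_U)
  also have "\<dots> = (\<Sum>x\<in>U. \<Sum>s\<in>{0..<int p}. if [fst x + d * snd x * s = 1] (mod int p) then chi x else 0)"
    by (rule sum.swap)
  also have "\<dots> = (\<Sum>x\<in>U. of_nat (N x) * chi x)"
    unfolding N_def by (intro sum.cong refl) (simp flip: sum.inter_filter)
  also have "\<dots> = (\<Sum>x\<in>{x \<in> U. snd x \<noteq> 0}. of_nat (N x) * chi x) + (\<Sum>x\<in>{x \<in> U. snd x = 0}. of_nat (N x) * chi x)"
  proof -
    have "U = {x \<in> U. snd x \<noteq> 0} \<union> {x \<in> U. snd x = 0}" by auto
    then show ?thesis using finite_U
      by (metis (no_types, lifting) sum.union_disjoint finite_Un disjoint_iff mem_Collect_eq)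
  qed
  also have "(\<Sum>x\<in>{x \<in> U. snd x \<noteq> 0}. of_nat (N x) * chi x) = (\<Sum>x\<in>{x \<in> U. snd x \<noteq> 0}. chi x)"
  proof (rule sum.cong)
    fix x assume x: "x \<in> {x \<in> U. snd x \<noteq> 0}"
    define e where "e = d * snd x"
    have "\<not> int p dvd snd x" using x by (auto simp: U_def dest: zdvd_imp_le)
    moreover have "int p dvd d * e \<longleftrightarrow> int p dvd snd x" unfolding e_def using d_sq by (simp flip: mult.assoc)
    ultimately have "\<not> int p dvd e" by auto
    then have cop: "coprime e (int p)" using prime_p by (simp add: coprime_int_prime)
    then obtain i where i: "[e * i = 1] (mod int p)" using cong_solve_coprime_int by blast
    let ?s = "(i * (1 - fst x)) mod int p"
    have "{s \<in> {0..<int p}. [fst x + d * snd x * s = 1] (mod int p)} = {?s}"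
    proof (intro equalityI subsetI)
      fix s assume "s \<in> {s \<in> {0..<int p}. [fst x + d * snd x * s = 1] (mod int p)}"
      then have s: "s \<in> {0..<int p}" "[fst x + e * s = 1] (mod int p)" by (simp_all add: e_def)
      have "[s = (e * i) * s] (mod int p)" using cong_mult[OF cong_sym[OF i] cong_refl[of s]] by simp
      also have "(e * i) * s = i * ((fst x + e * s) - fst x)" by (simp add: algebra_simps)
      also have "[\<dots> = i * (1 - fst x)] (mod int p)" by (intro cong_mult cong_diff s cong_refl)
      finally have "[s = ?s] (mod int p)" by (simp add: cong_def)
      then show "s \<in> {?s}" using s(1) p_gt cong_imp_eq[of s ?s] by simp
    next
      fix s assume s: "s \<in> {?s}"
      have "[fst x + e * s = fst x + e * (i * (1 - fst x))] (mod int p)"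
        using s by (intro cong_add cong_mult cong_refl) (simp add: cong_def)
      also have "fst x + e * (i * (1 - fst x)) = fst x + (e * i) * (1 - fst x)" by (simp add: mult.assoc)
      also have "[\<dots> = fst x + 1 * (1 - fst x)] (mod int p)" by (intro cong_add cong_mult i cong_refl)
      finally show "s \<in> {s \<in> {0..<int p}. [fst x + d * snd x * s = 1] (mod int p)}"
        using s p_gt by (simp add: e_def)
    qed
    then have "N x = 1" unfolding N_def by simp
    then show "of_nat (N x) * chi x = chi x" by simp
  qed simp
  also have "(\<Sum>x\<in>{x \<in> U. snd x \<noteq> 0}. chi x) = 0"
  proof -
    have "U = {x \<in> U. snd x \<noteq> 0} \<union> {x \<in> U. snd x = 0}" by auto
    then have "(\<Sum>x\<in>U. chi x) = (\<Sum>x\<in>{x \<in> U. snd x \<noteq> 0}. chi x) + (\<Sum>x\<in>{x \<in> U. snd x = 0}. chi x)"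
      using finite_U by (metis (no_types, lifting) sum.union_disjoint finite_Un disjoint_iff mem_Collect_eq)
    then show ?thesis using sum_chi_U sum_chi_scalars by simp
  qed
  also have "(\<Sum>x\<in>{x \<in> U. snd x = 0}. of_nat (N x) * chi x) = (\<Sum>x\<in>{(1, 0)}. of_nat (N x) * chi x)"
  proof (rule sum.mono_neutral_right)
    show "finite {x \<in> U. snd x = 0}" using finite_U by simp
    show "{(1, 0)} \<subseteq> {x \<in> U. snd x = 0}" using p_gt by (auto simp: U_def punit_scalar)
    show "\<forall>x\<in>{x \<in> U. snd x = 0} - {(1, 0)}. of_nat (N x) * chi x = 0"
    proof
      fix x assume x: "x \<in> {x \<in> U. snd x = 0} - {(1, 0)}"
      then have "fst x \<noteq> 1" by (cases x) simp
      then have "\<not> [fst x = 1] (mod int p)"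
        using x p_gt cong_imp_eq[of "fst x" 1] by (auto simp: U_def)
      then have "N x = 0" using x unfolding N_def by simp
      then show "of_nat (N x) * chi x = 0" by simp
    qed
  qed
  also have "\<dots> = of_nat p"
  proof -
    have "N (1, 0) = card {0..<int p}" unfolding N_def by (rule arg_cong[of _ _ card]) auto
    then show ?thesis by (simp add: chi_one)
  qed
  finally show ?thesis by simp
qed

lemma char_sum_norm: "char_sum * cnj char_sum = of_nat p"
proof -
  have "S \<subseteq> {0..<int p}" by (auto simp: S_def)
  then have "(\<Sum>s\<in>{0..<int p}. \<Sum>x\<in>line s. chi x) = (\<Sum>s\<in>S. \<Sum>x\<in>line s. chi x)"
    using sum_line_bad by (intro sum.mono_neutral_right) auto
  then show ?thesis using char_sum_norm_lines sum_all_lines by simp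
qed

text \<open>Coordinates of \<open>w ^ k + w ^ (3 * k)\<close> with respect to \<open>2\<close> and
  \<open>w + w ^ 3\<close>, for a primitive eighth root of unity \<open>w\<close> and
  \<open>k < 8\<close>. For \<open>k = 2\<close> and \<open>k = 6\<close> the two powers are
  opposite, hence the zeros.\<close>

definition cA :: "nat \<Rightarrow> int" where "cA k = (if k = 0 then 1 else if k = 4 then - 1 else 0)"
definition cB :: "nat \<Rightarrow> int"
  where "cB k = (if k = 1 \<or> k = 3 then 1 else if k = 5 \<or> k = 7 then - 1 else 0)"
definition X :: int where "X = (\<Sum>s\<in>S. cA (char_index (1, s)))"
definition Y :: int where "Y = (\<Sum>s\<in>S. cB (char_index (1, s)))"

text \<open>Needed twice: with \<open>M = 0\<close> and \<open>w = omega\<close> for the norm, and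
  with \<open>M = p\<^sup>2\<close> and \<open>w = eta\<close> for the residue. The common integer
  coordinates tie the two together.\<close>

lemma gcong_root_sum:
  fixes w :: "'b::comm_ring_1"
  assumes w: "gcong M (w ^ 4) (- 1)" and k: "k < 8"
  shows "gcong M (w ^ k + w ^ (3 * k)) (2 * of_int (cA k) + of_int (cB k) * (w + w ^ 3))"
proof -
  have r: "gcong M (w ^ (j + 4)) (- (w ^ j))" for j
    using gcong_mult[OF gcong_refl[of M "w ^ j"] w] by (simp add: power_add)
  have r2: "gcong M (w ^ (j + 8)) (w ^ j)" for j
    using gcong_trans[OF r[of "j + 4"] gcong_minus[OF r[of j]]] by (simp add: add.commute add.left_commute)
  have r12: "gcong M (w ^ (j + 12)) (- (w ^ j))" for j
    using gcong_trans[OF r2[of "j + 4"] r[of j]] by (simp add: add.commute add.left_commute)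
  have r20: "gcong M (w ^ (j + 20)) (- (w ^ j))" for j
    using gcong_trans[OF r12[of "j + 8"] gcong_minus[OF r2[of j]]] by (simp add: add.commute add.left_commute)
  consider "k = 0" | "k = 1" | "k = 2" | "k = 3" | "k = 4" | "k = 5" | "k = 6" | "k = 7" using k by linarith
  then show ?thesis
  proof cases
    case 3
    then show ?thesis using gcong_add[OF gcong_refl[of M "w ^ 2"] r[of 2]] by (simp add: cA_def cB_def)
  next
    case 4
    then show ?thesis using gcong_add[OF gcong_refl[of M "w ^ 3"] r2[of 1]] by (simp add: cA_def cB_def add.commute)
  next
    case 5
    then show ?thesis using gcong_add[OF r[of 0] r12[of 0]] by (simp add: cA_def cB_def)
  next
    case 6
    then show ?thesis using gcong_add[OF r[of 1] r12[of 3]] by (simp add: cA_def cB_def)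
  next
    case 7
    have a: "gcong M (w ^ 6) (- (w ^ 2))" using r[of 2] by simp
    have b: "gcong M (w ^ 18) (- (w ^ 6))" using r12[of 6] by simp
    have "gcong M (w ^ 6 + w ^ 18) (- (w ^ 2) + - (- (w ^ 2)))"
      by (rule gcong_add[OF a gcong_trans[OF b gcong_minus[OF a]]])
    then show ?thesis using 7 by (simp add: cA_def cB_def)
  next
    case 8
    then show ?thesis using gcong_add[OF r[of 3] r20[of 1]] by (simp add: cA_def cB_def add.commute)
  qed (simp_all add: cA_def cB_def)
qed

lemma sum_S_conj:
  assumes "\<And>x y. pcg x y \<Longrightarrow> punit x \<Longrightarrow> f x = f y"
  shows "(\<Sum>s\<in>S. f (1, s)) = (\<Sum>s\<in>S. f (pconj (1, s)))"
proof -
  have p: "punit (1, (- s) mod int p)" "f (1, (- s) mod int p) = f (pconj (1, s))" if "s \<in> S" for s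
  proof -
    have c: "pcg (pconj (1, s)) (1, (- s) mod int p)" by (simp add: pcg_def pconj_def cong_def)
    moreover have "punit (pconj (1, s))" using S_D(1)[OF that] by simp
    ultimately show "punit (1, (- s) mod int p)" "f (1, (- s) mod int p) = f (pconj (1, s))"
      using punit_cong assms by metis+
  qed
  have inv: "(- ((- s) mod int p)) mod int p = s" if "s \<in> S" for s
    using S_D(2)[OF that] by (metis add.inverse_inverse mod_minus_eq mod_pos_pos_trivial)
  have "(\<Sum>s\<in>S. f (pconj (1, s))) = (\<Sum>s\<in>S. f (1, s))"
    by (rule sum.reindex_bij_witness[of _ "\<lambda>s. (- s) mod int p" "\<lambda>s. (- s) mod int p"])
      (use p inv p_gt in \<open>auto simp: S_def\<close>)
  then show ?thesis by simp
qed

text \<open>Replacing \<open>s\<close> by \<open>- s\<close> shows that the character sum equals the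
  sum of the cubes. Averaging gives \<open>2 E = 2 X + Y \<surd>-2\<close>, whose norm is
  \<open>4 p\<close>. The doubled form is kept because \<open>Y\<close> is recognized as even only
  from this very equation.\<close>

lemma X_Y: "4 * X\<^sup>2 + 2 * Y\<^sup>2 = 4 * int p"
proof -
  have "char_sum = (\<Sum>s\<in>S. chi (pconj (1, s)))"
    unfolding char_sum_def by (rule sum_S_conj) (rule chi_cong)
  also have "\<dots> = (\<Sum>s\<in>S. chi (1, s) ^ 3)" by (intro sum.cong refl chi_conj S_D)
  finally have "2 * char_sum = (\<Sum>s\<in>S. chi (1, s) + chi (1, s) ^ 3)"
    by (simp add: sum.distrib char_sum_def)
  also have "\<dots> = (\<Sum>s\<in>S. 2 * of_int (cA (char_index (1, s))) + of_int (cB (char_index (1, s))) * (omega + omega ^ 3))"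
  proof (rule sum.cong)
    fix s assume s: "s \<in> S"
    have "gcong 0 (omega ^ char_index (1, s) + omega ^ (3 * char_index (1, s))) (2 * of_int (cA (char_index (1, s))) + of_int (cB (char_index (1, s))) * (omega + omega ^ 3))"
      by (rule gcong_root_sum) (use omega_pow4 char_index(1)[OF S_D(1)[OF s]] in auto)
    then show "chi (1, s) + chi (1, s) ^ 3 = 2 * of_int (cA (char_index (1, s))) + of_int (cB (char_index (1, s))) * (omega + omega ^ 3)"
      by (simp add: gcong_def chi_def mult.commute flip: power_mult)
  qed simp
  also have "\<dots> = 2 * of_int X + of_int Y * (omega + omega ^ 3)"
    by (simp add: X_def Y_def sum.distrib sum_distrib_left sum_distrib_right)
  finally have E: "2 * char_sum = Complex (2 * of_int X) (of_int Y * sqrt 2)"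
    unfolding omega_sum by (simp add: complex_eq_iff)
  have "(2 * char_sum) * cnj (2 * char_sum) = 4 * of_nat p" using char_sum_norm by simp
  then have "complex_of_real ((2 * of_int X)\<^sup>2 + (of_int Y * sqrt 2)\<^sup>2) = complex_of_real (4 * of_nat p)"
    unfolding E complex_mult_cnj by simp
  then have "(2 * of_int X)\<^sup>2 + (of_int Y * sqrt 2)\<^sup>2 = (4 * of_nat p :: real)"
    by (simp only: of_real_eq_iff)
  then have "real_of_int (4 * X\<^sup>2 + 2 * Y\<^sup>2) = real_of_int (4 * int p)"
    by (simp add: power_mult_distrib mult.commute)
  then show ?thesis by (simp only: of_int_eq_iff)
qed

end

section \<open>Evaluation of the character sum modulo \<open>p\<^sup>2\<close>\<close>

lemma sum_int_powers:
  fixes p :: nat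
  assumes g: "\<not> int p dvd g" "\<not> [g ^ k = 1] (mod int p)" and p: "prime p"
  shows "[(\<Sum>s\<in>{0..<int p}. s ^ k) = 0] (mod int p)"
proof -
  have p0: "int p > 0" using p prime_gt_0_nat by simp
  have cop: "coprime g (int p)" using p g(1) by (rule coprime_int_prime)
  let ?f = "\<lambda>s. (g * s) mod int p"
  have inj: "inj_on ?f {0..<int p}"
  proof (rule inj_onI)
    fix x y assume xy: "x \<in> {0..<int p}" "y \<in> {0..<int p}" "?f x = ?f y"
    then have "[g * x = g * y] (mod int p)" by (simp add: cong_def)
    then have "[x = y] (mod int p)" using cop cong_mult_lcancel by blast
    then show "x = y" using xy by (simp add: cong_def)
  qed
  have im: "?f ` {0..<int p} = {0..<int p}"
    using p0 by (intro endo_inj_surj[OF _ _ inj]) auto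
  have "(\<Sum>s\<in>{0..<int p}. s ^ k) = (\<Sum>s\<in>{0..<int p}. (?f s) ^ k)"
    using sum.reindex[OF inj, of "\<lambda>s. s ^ k"] im by simp
  also have "[\<dots> = (\<Sum>s\<in>{0..<int p}. (g * s) ^ k)] (mod int p)"
    by (intro cong_sum cong_pow) simp
  also have "(\<Sum>s\<in>{0..<int p}. (g * s) ^ k) = g ^ k * (\<Sum>s\<in>{0..<int p}. s ^ k)"
    by (simp add: power_mult_distrib sum_distrib_left)
  finally have "int p dvd (g ^ k - 1) * (\<Sum>s\<in>{0..<int p}. s ^ k)"
    by (simp add: cong_iff_dvd_diff left_diff_distrib dvd_diff_commute)
  then show ?thesis using g(2) p prime_dvd_mult_iff[of "int p"] by (auto simp: cong_iff_dvd_diff)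
qed

context frob
begin

lemma sum_int_powers_0: assumes "\<not> (p - 1) dvd k" shows "gcong P (of_int (\<Sum>s\<in>{0..<int p}. s ^ k)) 0"
proof -
  obtain g :: int where g: "\<not> int p dvd g" "\<And>k. [g ^ k = 1] (mod int p) \<longleftrightarrow> (p - 1) dvd k"
    using primitive_root by blast
  then show ?thesis using gcong_of_int[OF sum_int_powers[OF g(1) _ prime_p, of k]] assms by simp
qed

lemma sum_int_powers_1: "gcong P (of_int (\<Sum>s\<in>{0..<int p}. s ^ (p - 1))) (- 1)"
proof -
  have "[(\<Sum>s\<in>{0..<int p}. s ^ (p - 1)) = (\<Sum>s\<in>{0..<int p}. if s = 0 then 0 else 1)] (mod int p)"
  proof (rule cong_sum)
    fix s assume s: "s \<in> {0..<int p}"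
    show "[s ^ (p - 1) = (if s = 0 then 0 else 1)] (mod int p)"
    proof (cases "s = 0")
      case False
      then have "\<not> int p dvd s" using s by (auto dest: zdvd_imp_le)
      then show ?thesis using int_fermat[OF prime_p] p_gt False by simp
    qed (use p_gt in \<open>simp add: power_0_left\<close>)
  qed
  also have "(\<Sum>s\<in>{0..<int p}. if s = 0 then 0 else 1) = (\<Sum>s\<in>{0..<int p} - {0}. 1 :: int)"
    by (rule sum.mono_neutral_cong_right) auto
  also have "\<dots> = int p - 1" using p_gt by (simp add: of_nat_diff)
  finally have "[(\<Sum>s\<in>{0..<int p}. s ^ (p - 1)) = - 1] (mod int p)"
    by (rule cong_trans) (simp add: cong_iff_dvd_diff)
  then show ?thesis using gcong_of_int by fastforce
qed

lemma not_P_dvd_small: "0 < r \<Longrightarrow> r < p \<Longrightarrow> \<not> P dvd of_nat r"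
  using P_dvd_of_int_iff[of "int r"] by (auto dest: zdvd_imp_le)

text \<open>The Galois conjugates \<open>1 + s \<epsilon>\<close> and \<open>1 - s \<epsilon>\<close> are separated by extracting
  the linear coefficient of \<open>(1 + s \<epsilon>) ^ r - (1 - s \<epsilon>) ^ r\<close> with the weight \<open>s ^ (p - 2)\<close>.\<close>
lemma norm_one_order_aux:
  assumes d: "d = - 1" and r: "0 < r" "r < p"
    and eq: "\<And>s. s \<in> {0..<int p} \<Longrightarrow> gcong P (emb (1, s) ^ r) (embc (1, s) ^ r)"
  shows False
proof -
  have eps: "\<epsilon> * \<epsilon> = - 1" using eps_sq d by simp
  define c where "c j = of_nat (r choose j) * (\<epsilon> ^ j - (- \<epsilon>) ^ j)" for j
  have expand: "emb (1, s) ^ r - embc (1, s) ^ r = (\<Sum>j\<le>r. c j * of_int s ^ j)" for s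
  proof -
    have "emb (1, s) ^ r = (\<Sum>j\<le>r. of_nat (r choose j) * (of_int s * \<epsilon>) ^ j)"
      using binomial_ring[of "of_int s * \<epsilon>" 1 r] by (simp add: emb_def add.commute)
    moreover have "embc (1, s) ^ r = (\<Sum>j\<le>r. of_nat (r choose j) * (of_int s * (- \<epsilon>)) ^ j)"
      using binomial_ring[of "of_int s * (- \<epsilon>)" 1 r] by (simp add: embc_def add.commute)
    moreover have "of_nat (r choose j) * (of_int s * \<epsilon>) ^ j - of_nat (r choose j) * (of_int s * (- \<epsilon>)) ^ j =
        c j * of_int s ^ j" for j
      unfolding c_def power_mult_distrib by (simp add: algebra_simps)
    ultimately show ?thesis by (simp only: sum_subtractf[symmetric])
  qed
  have "gcong P (\<Sum>s\<in>{0..<int p}. of_int s ^ (p - 2) * (emb (1, s) ^ r - embc (1, s) ^ r))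
      (\<Sum>s\<in>{0..<int p}. of_int s ^ (p - 2) * 0)"
    using eq by (intro gcong_sum gcong_mult gcong_refl) (simp add: gcong_def)
  then have zero: "gcong P (\<Sum>s\<in>{0..<int p}. of_int s ^ (p - 2) * (emb (1, s) ^ r - embc (1, s) ^ r)) 0"
    by simp
  have swap: "(\<Sum>s\<in>{0..<int p}. of_int s ^ (p - 2) * (emb (1, s) ^ r - embc (1, s) ^ r)) =
      (\<Sum>j\<le>r. c j * of_int (\<Sum>s\<in>{0..<int p}. s ^ (p - 2 + j)))"
    unfolding expand sum_distrib_left of_int_sum
    by (subst sum.swap) (simp add: power_add mult_ac)
  \<comment> \<open>Since \<open>j < p\<close>, the exponent \<open>p - 2 + j\<close> is a multiple
    of \<open>p - 1\<close> only for \<open>j = 1\<close>; the next such \<open>j\<close> would be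
    \<open>p\<close>.\<close>
  have coeff: "gcong P (\<Sum>j\<le>r. c j * of_int (\<Sum>s\<in>{0..<int p}. s ^ (p - 2 + j)))
      (\<Sum>j\<le>r. c j * (if j = 1 then - 1 else 0))"
  proof (intro gcong_sum gcong_mult gcong_refl)
    fix j assume "j \<in> {..r}"
    then have j: "j < p" using r by simp
    show "gcong P (of_int (\<Sum>s\<in>{0..<int p}. s ^ (p - 2 + j))) (if j = 1 then - 1 else 0)"
    proof (cases "j = 1")
      case True
      then have "p - 2 + j = p - 1" using p_gt by simp
      then show ?thesis using sum_int_powers_1 True by simp
    next
      case False
      have "\<not> (p - 1) dvd (p - 2 + j)"
      proof
        assume "(p - 1) dvd (p - 2 + j)"
        then obtain q where q: "p - 2 + j = (p - 1) * q" by blast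
        have "q \<noteq> 0" using q p_gt by (cases q) auto
        moreover have "q \<noteq> 1" using q False p_gt by auto
        ultimately have "(p - 1) * 2 \<le> (p - 1) * q" by (intro mult_le_mono2) linarith
        then show False using q j p_gt by linarith
      qed
      then show ?thesis using sum_int_powers_0 False by simp
    qed
  qed
  have "(\<Sum>j\<le>r. c j * (if j = 1 then - 1 else 0)) = (\<Sum>j\<le>r. if j = 1 then - c j else 0)"
    by (intro sum.cong) auto
  also have "\<dots> = - c 1" using r by (simp add: sum.delta)
  finally have "gcong P 0 (- c 1)"
    using gcong_trans[OF gcong_sym[OF zero[unfolded swap]] coeff] by simp
  then have "gcong P (- c 1) 0" by (rule gcong_sym)
  then have "P dvd of_nat r * (2 * \<epsilon>)" by (simp add: gcong_0_iff c_def)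
  then have "P dvd of_nat r \<or> P dvd of_int 2 \<or> P dvd \<epsilon>" by (simp add: P_dvd_mult)
  moreover have "\<not> P dvd \<epsilon>"
  proof
    assume "P dvd \<epsilon>"
    then have "P dvd \<epsilon> * \<epsilon>" by simp
    then show False unfolding eps using not_P_dvd_1 by simp
  qed
  ultimately show False using not_P_dvd_small[OF r] P_dvd_of_int_iff[of 2] p_not_dvd_2 by blast
qed

text \<open>\<open>\<beta> ^ (p + 1)\<close> is the norm modulo \<open>p\<close>, the same for
  \<open>\<beta>\<close> and its conjugate, so only the remainder of \<open>t\<close> modulo
  \<open>p + 1\<close> matters. The remainder \<open>p\<close> is beyond the reach of the
  coefficient extraction and is excluded by looking at \<open>s = 1\<close>.\<close>

lemma norm_one_order:
  assumes d: "d = - 1"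
    and eq: "\<And>s. s \<in> {0..<int p} \<Longrightarrow> gcong P (emb (1, s) ^ t) (embc (1, s) ^ t)"
  shows "(p + 1) dvd t"
proof (rule ccontr)
  assume nd: "\<not> (p + 1) dvd t"
  define r where "r = t mod (p + 1)"
  have r: "0 < r" "r \<le> p" using nd unfolding r_def
    by (metis dvd_eq_mod_eq_0 gr0I, metis Suc_eq_plus1 less_Suc_eq_le mod_less_divisor zero_less_Suc)
  have eqr: "gcong P (emb (1, s) ^ r) (embc (1, s) ^ r)" if s: "s \<in> {0..<int p}" for s
  proof -
    let ?e = "emb (1, s)" and ?f = "embc (1, s)"
    have pu: "punit (1, s)" using S_neg[OF d s] S_D by blast
    have 1: "gcong P (?e ^ (p + 1)) (?f * ?e)" "gcong P (?f ^ (p + 1)) (?e * ?f)"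
      using gcong_mult[OF emb_frob_neg[OF d, of "(1, s)"] gcong_refl[of P ?e]]
        gcong_mult[OF embc_frob_neg[OF d, of "(1, s)"] gcong_refl[of P ?f]] by (simp_all add: mult.commute)
    have 2: "gcong P (?f ^ (p + 1)) (?e ^ (p + 1))"
      using gcong_trans[OF 1(2)] gcong_sym[OF 1(1)] by (simp add: mult.commute)
    have t: "t = (p + 1) * (t div (p + 1)) + r" unfolding r_def by (rule mult_div_mod_eq[symmetric])
    have "?e ^ t = (?e ^ (p + 1)) ^ (t div (p + 1)) * ?e ^ r"
      by (subst t) (simp only: power_add power_mult)
    moreover have "?f ^ t = (?f ^ (p + 1)) ^ (t div (p + 1)) * ?f ^ r"
      by (subst t) (simp only: power_add power_mult)
    moreover have "gcong P ((?f ^ (p + 1)) ^ (t div (p + 1)) * ?f ^ r) ((?e ^ (p + 1)) ^ (t div (p + 1)) * ?f ^ r)"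
      by (intro gcong_mult gcong_power 2 gcong_refl)
    ultimately have "gcong P ((?e ^ (p + 1)) ^ (t div (p + 1)) * ?e ^ r) ((?e ^ (p + 1)) ^ (t div (p + 1)) * ?f ^ r)"
      using eq[OF s] gcong_trans by metis
    moreover have "\<not> P dvd (?e ^ (p + 1)) ^ (t div (p + 1))"
      using P_dvd_power punit_emb(1)[OF pu] by blast
    ultimately show ?thesis using P_cancel by blast
  qed
  show False
  proof (cases "r = p")
    case True
    have one: "1 \<in> {0..<int p}" using p_gt by simp
    have "gcong P (embc (1, 1)) (emb (1, 1))"
      using gcong_trans[OF gcong_sym[OF emb_frob_neg[OF d]] gcong_trans[OF eqr[OF one, unfolded True] embc_frob_neg[OF d]]] .
    then have "gcong P (emb (1, 1) ^ 1) (embc (1, 1) ^ 1)" using gcong_sym by simp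
    then have "P dvd 2 * \<epsilon>" by (simp add: gcong_def emb_def embc_def)
    then have "P dvd of_int 2 \<or> P dvd \<epsilon> * \<epsilon>" by (auto simp: P_dvd_mult)
    moreover have "\<epsilon> * \<epsilon> = - 1" using eps_sq d by simp
    ultimately show False using P_dvd_of_int_iff[of 2] p_not_dvd_2 not_P_dvd_1 by auto
  next
    case False
    then show False using norm_one_order_aux[OF d r(1) _ eqr] r by simp
  qed
qed

text \<open>The seventh power of \<open>theta\<close> stands for its inverse, so this is the
  character \<open>\<beta> ^ k \<beta>' ^ (p n - k) \<chi>\<^sup>-\<^sup>1\<close> modulo
  \<open>p\<close>; its \<open>p\<close>-th power is a term of the binomial expansion of
  \<open>summand\<close> below. The predicate \<open>good\<close> singles out the \<open>k\<close>
  for which it is trivial.\<close>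

definition monomial :: "nat \<Rightarrow> ipair \<Rightarrow> 'a"
  where "monomial k x = theta x ^ 7 * (emb x ^ k * embc x ^ (p * n - k))"
definition good :: "nat \<Rightarrow> bool" where "good k \<longleftrightarrow> (int p - d) dvd int k - d * int m"

lemma monomial_eq: "monomial k x = emb x ^ (7 * exA + k) * embc x ^ (7 * exB + (p * n - k))"
  by (simp add: monomial_def theta_def power_add power_mult_distrib mult_ac flip: power_mult)

lemma emb_pow_order_neg:
  assumes d: "d = - 1" and x: "punit x"
  shows "gcong P (emb x ^ (p * p - 1)) 1"
proof -
  have "gcong P ((emb x ^ p) ^ p) (emb x)"
    using gcong_trans[OF gcong_power[OF emb_frob_neg[OF d]] embc_frob_neg[OF d]] .
  moreover have "(emb x ^ p) ^ p = emb x * emb x ^ (p * p - 1)"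
    using p_gt by (simp flip: power_mult power_Suc)
  ultimately have "gcong P (emb x * emb x ^ (p * p - 1)) (emb x * 1)" by simp
  then show ?thesis using P_cancel punit_emb(1)[OF x] by blast
qed

lemma monomial_neg:
  assumes d: "d = - 1"
  shows "gcong P (monomial k x) (emb x ^ ((7 * exA + k) + p * (7 * exB + (p * n - k))))"
proof -
  have "gcong P (monomial k x) (emb x ^ (7 * exA + k) * (emb x ^ p) ^ (7 * exB + (p * n - k)))"
    unfolding monomial_eq by (intro gcong_mult gcong_power gcong_sym[OF emb_frob_neg[OF d]] gcong_refl)
  then show ?thesis by (simp only: power_add power_mult)
qed

text \<open>In the field case the monomial is a single power of \<open>emb x\<close>, and its
  exponent is \<open>- (p - 1) (k + m)\<close> modulo \<open>p\<^sup>2 - 1\<close>; hence it is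
  trivial exactly when \<open>p + 1\<close> divides \<open>k + m\<close>. The additive form avoids
  subtraction of naturals.\<close>

lemma monomial_neg_exponent:
  assumes "d = - 1" "k \<le> p * n"
  shows "(7 * exA + k) + p * (7 * exB + (p * n - k)) + (p - 1) * (k + m) = (p * p - 1) * (1 + n)"
proof (cases rule: cases_d)
  case neg
  obtain l where l: "p * n = k + l" using assms(2) le_Suc_ex by blast
  obtain P1 where P1: "p = Suc P1" using p_gt by (cases p) auto
  have "(7 * exA + k) + p * (7 * exB + (p * n - k)) + (p - 1) * (k + m) =
      7 * exA + 7 * p * exB + (p - 1) * m + p * (k + l)"
    unfolding l unfolding P1 by (simp add: algebra_simps)
  also have "\<dots> = 7 * (3 * m + 1) + 7 * p * m + (p - 1) * m + p * (p * n)"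
    unfolding l neg(4,5) ..
  also have "\<dots> = (p * p - 1) * (1 + n)"
    unfolding neg(3) unfolding neg(1) by (simp add: algebra_simps)
  finally show ?thesis .
qed (use assms in simp)

lemma monomial_good:
  assumes k: "good k" "k \<le> p * n" and x: "punit x"
  shows "gcong P (monomial k x) 1"
proof (cases rule: cases_d)
  case pos
  have g: "int (8 * m) dvd int k - int m" using k(1)[unfolded good_def, unfolded pos(1,2)] by simp
  have "int (7 * exA + k) = (int k - int m) + int (8 * m)" unfolding pos(4) by simp
  then have "int (8 * m) dvd int (7 * exA + k)" using g by (metis dvd_add_triv_right_iff)
  then have 1: "8 * m dvd 7 * exA + k" by (simp only: int_dvd_int_iff)
  have "int (7 * exB + (p * n - k)) = int (8 * m) * int (3 + 4 * m) - (int k - int m)"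
    unfolding pos(3,5) using k(2) unfolding pos(3) unfolding pos(1) by (simp add: of_nat_diff algebra_simps)
  moreover have "int (8 * m) dvd int (8 * m) * int (3 + 4 * m) - (int k - int m)" using g by simp
  ultimately have 2: "8 * m dvd 7 * exB + (p * n - k)" by (metis int_dvd_int_iff)
  obtain q1 q2 where q: "7 * exA + k = 8 * m * q1" "7 * exB + (p * n - k) = 8 * m * q2"
    using 1 2 by (elim dvdE) blast
  have "gcong P ((emb x ^ (8 * m)) ^ q1 * (embc x ^ (8 * m)) ^ q2) (1 ^ q1 * 1 ^ q2)"
    by (intro gcong_mult gcong_power emb_fermat embc_fermat pos(2) x)
  then show ?thesis unfolding monomial_eq q by (simp only: power_mult power_one mult_1)
next
  case neg
  have "int (p + 1) dvd int (k + m)" using k(1)[unfolded good_def, unfolded neg(2)] by (simp add: add.commute)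
  then have "p + 1 dvd k + m" using int_dvd_int_iff by blast
  then obtain q where q: "k + m = (p + 1) * q" by blast
  let ?E = "(7 * exA + k) + p * (7 * exB + (p * n - k))"
  have pp: "(p - 1) * (p + 1) = p * p - 1" using p_gt by (simp add: algebra_simps)
  have e: "?E + (p * p - 1) * q = (p * p - 1) * (1 + n)"
    using monomial_neg_exponent[OF neg(2) k(2)] unfolding q mult.assoc[symmetric] pp .
  have o: "gcong P (emb x ^ ((p * p - 1) * j)) 1" for j
    using gcong_power[OF emb_pow_order_neg[OF neg(2) x], of j] by (simp add: power_mult)
  have "gcong P (emb x ^ ?E * 1) (emb x ^ ?E * emb x ^ ((p * p - 1) * q))"
    by (intro gcong_mult gcong_refl gcong_sym[OF o])
  also have "\<dots> = emb x ^ ((p * p - 1) * (1 + n))" unfolding power_add[symmetric] e ..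
  also have "gcong P \<dots> 1" by (rule o)
  finally have "gcong P (emb x ^ ?E) 1" by simp
  then show ?thesis by (rule gcong_trans[OF monomial_neg[OF neg(2)]])
qed

text \<open>In the split case the unit with projections \<open>g\<close> and \<open>1\<close> tests
  the exponent of \<open>emb\<close> alone. In the field case no generator is at hand; triviality
  gives \<open>\<beta> ^ (k + m) = \<beta>' ^ (k + m)\<close> for all units, and
  \<open>norm_one_order\<close> concludes from the elements \<open>1 + s \<epsilon>\<close>.\<close>

lemma monomial_bad:
  assumes k: "k \<le> p * n" and all: "\<And>x. punit x \<Longrightarrow> gcong P (monomial k x) 1"
  shows "good k"
proof (cases rule: cases_d)
  case pos
  obtain g :: int where g: "\<not> int p dvd g" "\<And>k. [g ^ k = 1] (mod int p) \<longleftrightarrow> (p - 1) dvd k"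
    using primitive_root by blast
  define h where "h = int n + 1"
  have h2: "[2 * h = 1] (mod int p)" using half_cong by (simp add: h_def)
  define x where "x = ((g + 1) * h, (g - 1) * h)"
  have "emb x = of_int (g * (2 * h))" "embc x = of_int (2 * h)"
    unfolding emb_def embc_def x_def unfolding pos(6) by (simp_all add: algebra_simps)
  then have e: "gcong P (emb x) (of_int g)" "gcong P (embc x) 1"
    using gcong_of_int[OF cong_mult[OF cong_refl[of g] h2]] gcong_of_int[OF h2] by simp_all
  have "gcong P (of_int (pnorm x)) (of_int g * 1)"
    unfolding emb_embc[symmetric] by (intro gcong_mult e)
  then have "punit x" unfolding punit_def P_dvd_of_int_iff[symmetric]
    using gcong_dvd_iff g(1) P_dvd_of_int_iff by (metis mult_1_right)
  then have A: "gcong P (monomial k x) 1" by (rule all)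
  have B: "gcong P (monomial k x) (of_int g ^ (7 * exA + k) * 1 ^ (7 * exB + (p * n - k)))"
    unfolding monomial_eq by (intro gcong_mult gcong_power e)
  have "gcong P (of_int (g ^ (7 * exA + k))) 1" using gcong_trans[OF gcong_sym[OF B] A] by simp
  then have "[g ^ (7 * exA + k) = 1] (mod int p)"
    using P_dvd_of_int_iff[of "g ^ (7 * exA + k) - 1"] by (simp add: gcong_def cong_iff_dvd_diff)
  then have "(p - 1) dvd 7 * m + k" using g(2) pos(4) by simp
  then have "8 * m dvd 7 * m + k" using pos(1) by simp
  then have "int (8 * m) dvd int (7 * m + k)" by (simp only: int_dvd_int_iff)
  then have "int (8 * m) dvd int (7 * m + k) - int (8 * m)" by (rule dvd_diff) simp
  then show ?thesis unfolding good_def unfolding pos(1,2) by (simp add: algebra_simps)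
next
  case neg
  let ?E = "(7 * exA + k) + p * (7 * exB + (p * n - k))"
  have "gcong P (emb x ^ (k + m)) (embc x ^ (k + m))" if x: "punit x" for x
  proof -
    have E: "gcong P (emb x ^ ?E) 1"
      using gcong_trans[OF gcong_sym[OF monomial_neg[OF neg(2)]] all[OF x]] .
    have "gcong P (1 * emb x ^ ((p - 1) * (k + m))) (emb x ^ ?E * emb x ^ ((p - 1) * (k + m)))"
      by (intro gcong_mult gcong_refl gcong_sym[OF E])
    also have "\<dots> = (emb x ^ (p * p - 1)) ^ (1 + n)"
      unfolding power_add[symmetric] power_mult[symmetric] monomial_neg_exponent[OF neg(2) k] ..
    also have "gcong P \<dots> (1 ^ (1 + n))" by (intro gcong_power emb_pow_order_neg neg(2) x)
    finally have A: "gcong P (emb x ^ (k + m) * emb x ^ ((p - 1) * (k + m))) (emb x ^ (k + m) * 1)"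
      by (intro gcong_mult gcong_refl) simp
    have B: "emb x ^ (k + m) * emb x ^ ((p - 1) * (k + m)) = (emb x ^ p) ^ (k + m)"
    proof -
      have "(k + m) + (p - 1) * (k + m) = p * (k + m)" using p_gt by (simp add: diff_mult_distrib)
      then show ?thesis by (simp flip: power_add power_mult)
    qed
    have "gcong P ((emb x ^ p) ^ (k + m)) (embc x ^ (k + m))"
      by (intro gcong_power emb_frob_neg neg(2))
    then show ?thesis using gcong_trans[OF gcong_sym[OF A[unfolded B]]] by simp
  qed
  then have "(p + 1) dvd k + m"
    using S_neg[OF neg(2)] S_D(1) by (intro norm_one_order[OF neg(2)]) blast
  then have "int (p + 1) dvd int (k + m)" by (simp only: int_dvd_int_iff)
  then show ?thesis unfolding good_def unfolding neg(2) by (simp add: add.commute)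
qed

end

section \<open>Lifts modulo \<open>p\<^sup>2\<close> and two evaluations of one sum over the
  units\<close>

context frob
begin

text \<open>The lift modulo \<open>p\<^sup>2\<close> obtained from the inverse of
  \<open>zeta\<close>; the seventh power plays the role of the inverse.\<close>

definition eta :: 'a where "eta = (zeta ^ p) ^ 7"
definition two_pow :: 'a where "two_pow = of_int (2 ^ (p * n))"
text \<open>On the pair \<open>(c, e)\<close> the second factor is \<open>(2 c) ^ (p n)\<close>
  modulo \<open>p\<^sup>2\<close>, a lift of the quadratic character of \<open>2 c\<close> that does
  not see \<open>e\<close>. On \<open>1 + s \<epsilon>\<close> it is therefore the constant
  \<open>two_pow\<close>.\<close>

definition summand :: "ipair \<Rightarrow> 'a"
  where "summand x = (theta x ^ p) ^ 7 * (emb x ^ p + embc x ^ p) ^ (p * n)"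

lemma eta_pow4: "gcong (P\<^sup>2) (eta ^ 4) (- 1)"
proof -
  have "gcong (P\<^sup>2) ((zeta ^ 4) ^ p) ((- 1) ^ p)" by (intro gcong_power_lift gen)
  then have "gcong (P\<^sup>2) (((zeta ^ 4) ^ p) ^ 7) ((- 1) ^ 7)"
    using odd_p by (intro gcong_power) simp
  moreover have "((zeta ^ 4) ^ p) ^ 7 = eta ^ 4"
    by (simp add: eta_def mult_ac flip: power_mult)
  ultimately show ?thesis by simp
qed

lemma theta_eta: assumes "punit x" shows "gcong (P\<^sup>2) ((theta x ^ p) ^ 7) (eta ^ char_index x)"
proof -
  have "gcong (P\<^sup>2) ((theta x ^ p) ^ 7) (((zeta ^ char_index x) ^ p) ^ 7)"
    by (intro gcong_power gcong_power_lift char_index assms)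
  also have "((zeta ^ char_index x) ^ p) ^ 7 = eta ^ char_index x"
    by (simp add: eta_def mult_ac flip: power_mult)
  finally show ?thesis .
qed

text \<open>\<open>two_pow\<close> is the quadratic character of \<open>2\<close>; its sign is left
  undetermined, as only squares of the final relation are taken.\<close>

lemma two_pow_sq: "gcong (P\<^sup>2) (two_pow * two_pow) 1"
proof -
  have "[2 ^ (p - 1) = (1 :: int)] (mod int p)"
    using int_fermat[OF prime_p _ p_not_dvd_2] p_gt by simp
  then have "gcong P (of_int (2 ^ (p - 1))) 1" using gcong_of_int by fastforce
  then have "gcong (P\<^sup>2) (of_int (2 ^ (p - 1)) ^ p) (1 ^ p)" by (rule gcong_power_lift)
  moreover have "of_int (2 ^ (p - 1)) ^ p = two_pow * two_pow"
  proof -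
    have "(p - 1) * p = p * n + p * n" using p_eq by (metis add_mult_distrib2 diff_add_inverse2 mult.commute mult_2)
    then show ?thesis by (simp add: two_pow_def flip: power_mult power_add)
  qed
  ultimately show ?thesis by simp
qed

lemma emb_add_embc: "emb x + embc x = of_int (2 * fst x)"
  by (simp add: emb_def embc_def)

lemma trace_pow: "gcong (P\<^sup>2) ((emb x ^ p + embc x ^ p) ^ (p * n)) (of_int (2 * fst x) ^ (p * n))"
proof -
  have "gcong P (emb x ^ p + embc x ^ p) (of_int (2 * fst x) ^ p)"
    using gcong_sym[OF gcong_power_add[OF prime_p, of "emb x" "embc x"]] unfolding emb_add_embc .
  also have "gcong P \<dots> (of_int (2 * fst x))"
    using gcong_of_int[OF int_fermat_power[OF prime_p, of "2 * fst x"]] p_gt unfolding of_int_power by simp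
  finally have "gcong (P\<^sup>2) ((emb x ^ p + embc x ^ p) ^ p) (of_int (2 * fst x) ^ p)"
    by (rule gcong_power_lift)
  then show ?thesis unfolding power_mult by (rule gcong_power)
qed

lemma summand_one: assumes "s \<in> S" shows "gcong (P\<^sup>2) (summand (1, s)) (eta ^ char_index (1, s) * two_pow)"
  using gcong_mult[OF theta_eta[OF S_D(1)[OF assms]] trace_pow[of "(1, s)"]]
  by (simp add: summand_def two_pow_def)

lemma summand_cong: assumes "pcg x y" shows "gcong (P\<^sup>2) (summand x) (summand y)"
  unfolding summand_def
  by (intro gcong_mult gcong_power gcong_add gcong_power_lift theta_cong emb_cong embc_cong assms)

lemma summand_vertical: "summand (0, e) = 0"
proof -
  have "emb (0, e) ^ p + embc (0, e) ^ p = 0"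
    using odd_p by (simp add: emb_def embc_def)
  moreover have "p * n > 0" using p_gt by simp
  ultimately show ?thesis by (simp add: summand_def)
qed

text \<open>This lets a sum over the units with nonzero first coordinate be written as
  \<open>p - 1\<close> copies of the sum over the elements \<open>1 + s \<epsilon>\<close>.\<close>

lemma summand_scale: assumes c: "\<not> int p dvd c" shows "gcong (P\<^sup>2) (summand (pmul (c, 0) x)) (summand x)"
proof -
  have e: "emb (c, 0) = of_int c" "embc (c, 0) = of_int c" by (simp_all add: emb_def embc_def)
  have "summand (pmul (c, 0) x) = (theta (c, 0) ^ p) ^ 7 * (theta x ^ p) ^ 7 *
      (of_int c ^ p * (emb x ^ p + embc x ^ p)) ^ (p * n)"
    unfolding summand_def theta_mul emb_mul embc_mul e by (simp add: power_mult_distrib distrib_left)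
  also have "\<dots> = ((theta (c, 0) ^ p) ^ 7 * (of_int c ^ p) ^ (p * n)) * summand x"
    unfolding summand_def by (simp add: power_mult_distrib mult_ac)
  also have "(theta (c, 0) ^ p) ^ 7 * (of_int c ^ p) ^ (p * n) = (of_int (c ^ (p - 1)) ^ (n + 4)) ^ p"
  proof -
    \<comment> \<open>Here \<open>7 + p = 2 (n + 4)\<close> and \<open>2 n = p - 1\<close>: the
      scalar enters with a multiple of \<open>p - 1\<close>, and a factor \<open>p\<close> of the
      exponent remains for the lift to \<open>p\<^sup>2\<close>.\<close>
    have "n * p * 7 + p * (p * n) = (p - 1) * (n + 4) * p"
      by (subst (2 5) p_eq) (simp add: algebra_simps)
    then show ?thesis by (simp add: theta_scalar flip: power_mult power_add)
  qed
  also have "gcong (P\<^sup>2) (\<dots> * summand x) ((1 ^ (n + 4)) ^ p * summand x)"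
  proof (intro gcong_mult gcong_power_lift gcong_power gcong_refl)
    show "gcong P (of_int (c ^ (p - 1))) 1"
      using gcong_of_int[OF int_fermat[OF prime_p _ c]] p_gt by simp
  qed
  finally show ?thesis by simp
qed

definition U1 :: "ipair set" where "U1 = {x \<in> U. fst x \<noteq> 0}"
definition U0 :: "ipair set" where "U0 = {x \<in> U. fst x = 0}"

lemma U_split: "U = U1 \<union> U0" "U1 \<inter> U0 = {}" "finite U1" "finite U0"
  using finite_U by (auto simp: U1_def U0_def)

lemma U0_eq: "U0 = (\<lambda>e. (0, e)) ` {1..<int p}"
proof -
  have pu: "punit (0, e) \<longleftrightarrow> \<not> int p dvd e" for e
  proof -
    have "int p dvd pnorm (0, e) \<longleftrightarrow> int p dvd d * (e * e)"
      by (simp add: pnorm_def power2_eq_square)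
    also have "\<dots> \<longleftrightarrow> int p dvd e"
    proof
      assume "int p dvd d * (e * e)"
      then have "int p dvd d * (d * (e * e))" by simp
      then have "int p dvd (d * d) * (e * e)" by (simp only: mult.assoc)
      then have "int p dvd e * e" unfolding d_sq by simp
      then show "int p dvd e" using prime_p by (simp add: prime_dvd_mult_iff)
    qed simp
    finally show ?thesis by (simp add: punit_def)
  qed
  show ?thesis
  proof (intro equalityI subsetI)
    fix x assume "x \<in> U0"
    moreover obtain c e where x: "x = (c, e)" by fastforce
    ultimately have "c = 0" and e: "e \<in> {0..<int p}" "\<not> int p dvd e" using pu[of e] by (auto simp: U0_def U_def)
    moreover have "e \<noteq> 0" using e(2) by auto
    ultimately show "x \<in> (\<lambda>e. (0, e)) ` {1..<int p}" unfolding x by auto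
  next
    fix x :: ipair assume "x \<in> (\<lambda>e. (0, e)) ` {1..<int p}"
    then obtain e where e: "e \<in> {1..<int p}" and x: "x = (0, e)" by blast
    then have "\<not> int p dvd e" by (auto dest: zdvd_imp_le)
    then show "x \<in> U0" unfolding x U0_def U_def using e pu[of e] by simp
  qed
qed

lemma scaled_bij: "bij_betw (\<lambda>(c, s). red (pmul (c, 0) (1, s))) ({1..<int p} \<times> S) U1"
proof -
  let ?f = "\<lambda>(c, s). red (pmul (c, 0) (1, s))"
  have f: "?f (c, s) = (c mod int p, (c * s) mod int p)" for c s
    by (simp add: red_def pmul_def)
  have cd: "\<not> int p dvd c" if "c \<in> {1..<int p}" for c using that by (auto dest: zdvd_imp_le)
  show ?thesis unfolding bij_betw_def
  proof
    show "inj_on ?f ({1..<int p} \<times> S)"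
    proof (rule inj_onI, clarify)
      fix c s c' s'
      assume c: "c \<in> {1..<int p}" "c' \<in> {1..<int p}" and s: "s \<in> S" "s' \<in> S"
        and eq: "red (pmul (c, 0) (1, s)) = red (pmul (c', 0) (1, s'))"
      have cc: "c = c'" and "c * s mod int p = c' * s' mod int p"
        using f[of c s] f[of c' s'] eq c by auto
      then have "[c * s = c * s'] (mod int p)" by (simp add: cong_def)
      moreover have "coprime c (int p)" using prime_p cd[OF c(1)] by (rule coprime_int_prime)
      ultimately have "[s = s'] (mod int p)" using cong_mult_lcancel by blast
      then show "c = c' \<and> s = s'" using cc s S_D(2) cong_imp_eq by simp
    qed
    show "?f ` ({1..<int p} \<times> S) = U1"
    proof (intro equalityI subsetI)
      fix x assume "x \<in> ?f ` ({1..<int p} \<times> S)"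
      then obtain c s where cs: "c \<in> {1..<int p}" "s \<in> S" "x = ?f (c, s)" by blast
      then have "x \<in> U" using S_D(1) cd punit_scalar by (auto intro!: red_mem simp: punit_mul)
      moreover have "fst x = c" using cs f by simp
      ultimately show "x \<in> U1" using cs by (auto simp: U1_def)
    next
      fix x assume x: "x \<in> U1"
      obtain c e where ce: "x = (c, e)" by fastforce
      have c: "c \<in> {1..<int p}" and e: "e \<in> {0..<int p}" and pu: "punit (c, e)"
        using x unfolding ce by (auto simp: U1_def U_def)
      have "coprime c (int p)" using prime_p cd[OF c] by (rule coprime_int_prime)
      then obtain i where i: "[c * i = 1] (mod int p)" using cong_solve_coprime_int by blast
      let ?s = "(i * e) mod int p"
      have "[c * ?s = c * (i * e)] (mod int p)" by (intro cong_mult cong_refl) (simp add: cong_def)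
      also have "c * (i * e) = (c * i) * e" by simp
      also have "[\<dots> = 1 * e] (mod int p)" by (intro cong_mult i cong_refl)
      finally have cs: "[c * ?s = e] (mod int p)" by simp
      have fx: "?f (c, ?s) = x" using cs c e unfolding f ce by (simp add: cong_def)
      have "pcg (pmul (c, 0) (1, ?s)) (c, e)" using cs by (simp add: pcg_def pmul_def)
      then have "punit (1, ?s)" using pu punit_cong punit_mul by blast
      then have "?s \<in> S" using p_gt by (simp add: S_def)
      then show "x \<in> ?f ` ({1..<int p} \<times> S)" using c fx by (metis (no_types, lifting) SigmaI image_eqI)
    qed
  qed
qed

lemma nat_pred: "nat (int p - 1) = p - 1"
  by (simp add: nat_diff_distrib')

lemma sum_summand: "gcong (P\<^sup>2) (\<Sum>x\<in>U. summand x) (of_nat (p - 1) * (two_pow * (\<Sum>s\<in>S. eta ^ char_index (1, s))))"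
proof -
  have "(\<Sum>x\<in>U. summand x) = (\<Sum>x\<in>U1. summand x) + (\<Sum>x\<in>U0. summand x)"
    using U_split by (metis sum.union_disjoint)
  also have "(\<Sum>x\<in>U0. summand x) = 0" unfolding U0_eq by (intro sum.neutral) (auto simp: summand_vertical)
  also have "(\<Sum>x\<in>U1. summand x) = (\<Sum>(c, s)\<in>{1..<int p} \<times> S. summand (red (pmul (c, 0) (1, s))))"
    using sum.reindex_bij_betw[OF scaled_bij, of summand] by (simp add: case_prod_unfold)
  also have "\<dots> = (\<Sum>c\<in>{1..<int p}. \<Sum>s\<in>S. summand (red (pmul (c, 0) (1, s))))"
    by (rule sum.cartesian_product[symmetric])
  finally have "(\<Sum>x\<in>U. summand x) = (\<Sum>c\<in>{1..<int p}. \<Sum>s\<in>S. summand (red (pmul (c, 0) (1, s))))" by simp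
  also have "gcong (P\<^sup>2) \<dots> (\<Sum>c\<in>{1..<int p}. \<Sum>s\<in>S. eta ^ char_index (1, s) * two_pow)"
  proof (intro gcong_sum)
    fix c s assume c: "c \<in> {1..<int p}" and s: "s \<in> S"
    have "\<not> int p dvd c" using c by (auto dest: zdvd_imp_le)
    from gcong_trans[OF summand_cong[OF pcg_red] gcong_trans[OF summand_scale[OF this] summand_one[OF s]]]
    show "gcong (P\<^sup>2) (summand (red (pmul (c, 0) (1, s)))) (eta ^ char_index (1, s) * two_pow)" .
  qed
  also have "\<dots> = of_nat (p - 1) * (two_pow * (\<Sum>s\<in>S. eta ^ char_index (1, s)))"
    by (simp add: sum_distrib_left mult_ac nat_pred)
  finally show ?thesis .
qed

lemma card_S: "int (card S) = int p - d - 1"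
proof (cases rule: cases_d)
  case neg
  have "S = {0..<int p}" using S_neg[OF neg(2)] by (auto simp: S_def)
  then show ?thesis unfolding neg(2) by simp
next
  case pos
  have "S = {0..<int p} - {1, int p - 1}"
  proof (intro equalityI subsetI)
    fix s assume s: "s \<in> S"
    have "s \<noteq> 1 \<and> s \<noteq> int p - 1"
    proof (rule ccontr)
      assume "\<not> (s \<noteq> 1 \<and> s \<noteq> int p - 1)"
      then have "int p dvd (1 - s) * (1 + s)" by auto
      then have "int p dvd pnorm (1, s)" unfolding pnorm_pos[OF pos(2)] by (simp add: algebra_simps)
      then show False using S_D(1)[OF s] by (simp add: punit_def)
    qed
    then show "s \<in> {0..<int p} - {1, int p - 1}" using S_D(2)[OF s] by auto
  next
    fix s assume s: "s \<in> {0..<int p} - {1, int p - 1}"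
    show "s \<in> S"
    proof (rule ccontr)
      assume "s \<notin> S"
      then have "[s = 1] (mod int p) \<or> [s = - 1] (mod int p)" using S_pos(2)[OF pos(2)] s by blast
      moreover have "[- 1 = int p - 1] (mod int p)" by (simp add: cong_iff_dvd_diff)
      ultimately have "[s = 1] (mod int p) \<or> [s = int p - 1] (mod int p)" using cong_trans by blast
      then show False using s p_gt cong_imp_eq[of s 1] cong_imp_eq[of s "int p - 1"] by auto
    qed
  qed
  moreover have "card ({0..<int p} - {1, int p - 1}) = card {0..<int p} - card {1, int p - 1}"
    using p_gt by (intro card_Diff_subset) auto
  moreover have "card {1, int p - 1} = 2" using p_gt by auto
  ultimately show ?thesis unfolding pos(2) using p_gt by (simp add: of_nat_diff)
qed

lemma card_U: "int (card U) = (int p - 1) * (int p - d)"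
proof -
  have "card U = card U1 + card U0" using U_split by (metis card_Un_disjoint)
  moreover have "card U0 = p - 1" unfolding U0_eq by (subst card_image) (auto simp: inj_on_def)
  moreover have "card U1 = (p - 1) * card S"
    using bij_betw_same_card[OF scaled_bij] by (simp add: card_cartesian_product nat_pred)
  ultimately have "int (card U) = (int p - 1) * int (card S) + (int p - 1)"
    using p_gt by (simp add: of_nat_diff)
  then show ?thesis unfolding card_S by (simp add: algebra_simps)
qed

definition section_sum :: nat where "section_sum = (\<Sum>k | k \<le> p * n \<and> good k. (p * n) choose k)"

text \<open>Translation by a unit \<open>g\<close> gives \<open>(1 - monomial k g ^ p)\<close> times
  the sum equal to \<open>0\<close>. That factor must be prime to \<open>p\<close>, not merely
  nonzero: by additivity of the \<open>p\<close>-th power it is congruent to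
  \<open>- (monomial k g - 1) ^ p\<close>, and \<open>g\<close> was chosen with
  \<open>monomial k g\<close> different from \<open>1\<close> modulo \<open>p\<close>.\<close>

lemma sum_monomial_bad:
  assumes k: "k \<le> p * n" "\<not> good k"
  shows "gcong (P\<^sup>2) (\<Sum>x\<in>U. monomial k x ^ p) 0"
proof -
  obtain g where g: "punit g" "\<not> gcong P (monomial k g) 1" using monomial_bad[OF k(1)] k(2) by blast
  let ?S = "\<Sum>x\<in>U. monomial k x ^ p"
  have mul: "monomial k (pmul x y) = monomial k x * monomial k y" for x y
    by (simp add: monomial_eq emb_mul embc_mul power_mult_distrib mult_ac)
  have cg: "gcong P (monomial k x) (monomial k y)" if "pcg x y" for x y
    unfolding monomial_eq by (intro gcong_mult gcong_power emb_cong embc_cong that)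
  have "?S = (\<Sum>x\<in>U. monomial k (red (pmul g x)) ^ p)"
    using g(1) U_D by (intro sum_pmul_invariant(1)[symmetric] subset_refl red_mem) (auto simp: punit_mul)
  also have "gcong (P\<^sup>2) \<dots> (\<Sum>x\<in>U. (monomial k (pmul g x)) ^ p)"
    by (intro gcong_sum gcong_power_lift cg pcg_red)
  also have "\<dots> = monomial k g ^ p * ?S"
    by (simp add: mul power_mult_distrib sum_distrib_left)
  finally have "P\<^sup>2 dvd (1 - monomial k g ^ p) * ?S" by (simp add: gcong_def algebra_simps)
  moreover have "\<not> P dvd 1 - monomial k g ^ p"
  proof
    assume "P dvd 1 - monomial k g ^ p"
    then have "P dvd monomial k g ^ p - 1" by (metis dvd_minus_iff minus_diff_eq)
    then have "gcong P (monomial k g ^ p + (- 1) ^ p) 0"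
      using odd_p by (simp add: gcong_0_iff)
    then have "gcong P ((monomial k g + - 1) ^ p) 0"
      using gcong_trans[OF gcong_power_add[OF prime_p]] by blast
    then have "P dvd monomial k g - 1" using P_dvd_power by (simp add: gcong_0_iff)
    then show False using g(2) by (simp add: gcong_def)
  qed
  ultimately show ?thesis unfolding gcong_0_iff using P_sq_dvd_cancel by blast
qed

text \<open>The second evaluation of the sum that \<open>sum_summand\<close> computes by scaling:
  expand binomially and apply orthogonality to each monomial, whose \<open>p\<close>-th power makes
  this valid modulo \<open>p\<^sup>2\<close>.\<close>

lemma sum_summand_expand: "gcong (P\<^sup>2) (\<Sum>x\<in>U. summand x) (of_nat (card U * section_sum))"
proof -
  have expand: "summand x = (\<Sum>k\<le>p * n. of_nat ((p * n) choose k) * monomial k x ^ p)" for x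
  proof -
    have "monomial k x ^ p = (theta x ^ p) ^ 7 * ((emb x ^ p) ^ k * (embc x ^ p) ^ (p * n - k))" for k
      by (simp add: monomial_def power_mult_distrib mult.commute flip: power_mult)
    then show ?thesis unfolding summand_def binomial_ring by (simp add: sum_distrib_left mult_ac)
  qed
  have "(\<Sum>x\<in>U. summand x) = (\<Sum>k\<le>p * n. of_nat ((p * n) choose k) * (\<Sum>x\<in>U. monomial k x ^ p))"
    unfolding expand sum_distrib_left by (rule sum.swap)
  also have "gcong (P\<^sup>2) \<dots> (\<Sum>k\<le>p * n. of_nat ((p * n) choose k) * (if good k then of_nat (card U) else 0))"
  proof (intro gcong_sum gcong_mult gcong_refl)
    fix k assume "k \<in> {..p * n}"
    then have k: "k \<le> p * n" by simp
    show "gcong (P\<^sup>2) (\<Sum>x\<in>U. monomial k x ^ p) (if good k then of_nat (card U) else 0)"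
    proof (cases "good k")
      case True
      have "gcong (P\<^sup>2) (\<Sum>x\<in>U. monomial k x ^ p) (\<Sum>x\<in>U. 1 ^ p)"
        using U_D monomial_good[OF True k] by (intro gcong_sum gcong_power_lift) blast
      then show ?thesis using True by simp
    qed (use sum_monomial_bad[OF k] in simp)
  qed
  also have "\<dots> = (\<Sum>k\<in>{k. k \<le> p * n \<and> good k}. of_nat ((p * n) choose k) * of_nat (card U))"
    by (rule sum.mono_neutral_cong_right) auto
  also have "\<dots> = of_nat (card U * section_sum)"
    by (simp add: section_sum_def sum_distrib_right sum_distrib_left mult.commute)
  finally show ?thesis .
qed

lemma eta_sum: "gcong (P\<^sup>2) (two_pow * (\<Sum>s\<in>S. eta ^ char_index (1, s))) (of_int ((int p - d) * int section_sum))"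
proof -
  have eq: "of_nat (card U * section_sum) = of_nat (p - 1) * of_int ((int p - d) * int section_sum)"
  proof -
    have "int (card U * section_sum) = int (p - 1) * ((int p - d) * int section_sum)"
      using card_U p_gt by (simp add: of_nat_diff)
    then show ?thesis by (metis of_int_mult of_int_of_nat_eq)
  qed
  have "gcong (P\<^sup>2) (of_nat (p - 1) * (two_pow * (\<Sum>s\<in>S. eta ^ char_index (1, s)))) (of_nat (p - 1) * of_int ((int p - d) * int section_sum))"
    using gcong_trans[OF gcong_sym[OF sum_summand] sum_summand_expand] unfolding eq .
  moreover have "\<not> P dvd of_nat (p - 1)" using p_gt by (intro not_P_dvd_small) auto
  ultimately show ?thesis using P_sq_cancel by blast
qed

text \<open>A square root of \<open>- 2\<close> modulo \<open>p\<^sup>2\<close>, the counterpart of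
  \<open>omega + omega ^ 3\<close>.\<close>

definition W :: 'a where "W = eta + eta ^ 3"

lemma W_sq: "gcong (P\<^sup>2) (W * W) (- 2)"
proof -
  have "W * W = eta ^ 2 * (1 + eta ^ 4) + 2 * eta ^ 4"
    by (simp add: W_def algebra_simps power_numeral_reduce)
  also have "gcong (P\<^sup>2) \<dots> (eta ^ 2 * (1 + - 1) + 2 * (- 1))"
    by (intro gcong_add gcong_mult gcong_refl eta_pow4)
  finally show ?thesis by simp
qed

lemma char_index_cong: assumes "pcg x y" "punit x" shows "char_index x = char_index y"
proof -
  have y: "punit y" using assms punit_cong by blast
  have "gcong P (theta x) (zeta ^ char_index y)" using theta_cong[OF assms(1)] char_index(2)[OF y] gcong_trans by blast
  then show ?thesis using char_index_eqI[OF assms(2)] char_index(1)[OF assms(2)] char_index(1)[OF y] by (simp add: cong_def)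
qed

lemma eta_sum_X_Y: "gcong (P\<^sup>2) (2 * (\<Sum>s\<in>S. eta ^ char_index (1, s))) (2 * of_int X + of_int Y * W)"
proof -
  have "(\<Sum>s\<in>S. eta ^ char_index (1, s)) = (\<Sum>s\<in>S. eta ^ char_index (pconj (1, s)))"
    by (rule sum_S_conj[of "\<lambda>x. eta ^ char_index x"]) (simp add: char_index_cong)
  also have "gcong (P\<^sup>2) \<dots> (\<Sum>s\<in>S. eta ^ (3 * char_index (1, s)))"
  proof (intro gcong_sum gcong_root8_mod[OF eta_pow4])
    fix s assume s: "s \<in> S"
    have pu: "punit (1, s)" by (rule S_D(1)[OF s])
    have "gcong P (theta (pconj (1, s))) (zeta ^ (3 * char_index (1, s)))"
      using gcong_trans[OF theta_conj[OF pu] gcong_power[OF char_index(2)[OF pu], of 3]]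
      by (simp add: mult.commute flip: power_mult)
    then show "[char_index (pconj (1, s)) = 3 * char_index (1, s)] (mod 8)" using char_index_eqI pu by simp
  qed
  finally have "gcong (P\<^sup>2) ((\<Sum>s\<in>S. eta ^ char_index (1, s)) + (\<Sum>s\<in>S. eta ^ char_index (1, s)))
      ((\<Sum>s\<in>S. eta ^ char_index (1, s)) + (\<Sum>s\<in>S. eta ^ (3 * char_index (1, s))))"
    by (intro gcong_add gcong_refl)
  also have "\<dots> = (\<Sum>s\<in>S. eta ^ char_index (1, s) + eta ^ (3 * char_index (1, s)))" by (simp add: sum.distrib)
  also have "gcong (P\<^sup>2) \<dots> (\<Sum>s\<in>S. 2 * of_int (cA (char_index (1, s))) + of_int (cB (char_index (1, s))) * W)"
    unfolding W_def by (intro gcong_sum gcong_root_sum eta_pow4 char_index S_D)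
  also have "\<dots> = 2 * of_int X + of_int Y * W"
    by (simp add: X_def Y_def sum.distrib sum_distrib_left sum_distrib_right)
  finally show ?thesis by (simp only: mult_2)
qed

lemma of_int_gcong: "gcong (P\<^sup>2) (of_int a) (of_int b) \<Longrightarrow> (int p)\<^sup>2 dvd a - b"
  unfolding gcong_def of_int_diff[symmetric] by (rule of_int_dvd)

lemma section_sum_square:
  assumes Q: "\<not> p dvd section_sum"
  shows "(int p)\<^sup>2 dvd ((int p - d) * int section_sum)\<^sup>2 - (4 * X\<^sup>2 - 2 * int p)"
proof -
  define T where "T = (int p - d) * int section_sum"
  define \<alpha> where "\<alpha> = 2 * of_int X + of_int Y * W"
  define \<beta> where "\<beta> = 2 * of_int X - of_int Y * W"
  have a: "gcong (P\<^sup>2) (two_pow * \<alpha>) (2 * of_int T)"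
  proof -
    have "gcong (P\<^sup>2) (two_pow * \<alpha>) (two_pow * (2 * (\<Sum>s\<in>S. eta ^ char_index (1, s))))"
      unfolding \<alpha>_def by (intro gcong_mult gcong_refl gcong_sym[OF eta_sum_X_Y])
    also have "\<dots> = 2 * (two_pow * (\<Sum>s\<in>S. eta ^ char_index (1, s)))" by (simp only: mult_ac)
    also have "gcong (P\<^sup>2) \<dots> (2 * of_int T)"
      unfolding T_def by (intro gcong_mult gcong_refl eta_sum)
    finally show ?thesis .
  qed
  have a2: "gcong (P\<^sup>2) (\<alpha> * \<alpha>) (4 * of_int (T * T))"
  proof -
    have "gcong (P\<^sup>2) (1 * (\<alpha> * \<alpha>)) ((two_pow * two_pow) * (\<alpha> * \<alpha>))"
      by (intro gcong_mult gcong_refl gcong_sym[OF two_pow_sq])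
    also have "\<dots> = (two_pow * \<alpha>) * (two_pow * \<alpha>)" by (simp only: mult_ac)
    also have "gcong (P\<^sup>2) \<dots> ((2 * of_int T) * (2 * of_int T))" by (intro gcong_mult a)
    finally show ?thesis by (simp add: mult_ac)
  qed
  have P2: "\<not> P dvd 2" using P_dvd_of_int_iff[of 2] p_not_dvd_2 by simp
  have "\<not> int p dvd int p - d"
  proof
    assume h: "int p dvd int p - d"
    have "int p dvd int p - (int p - d)" by (rule dvd_diff[OF dvd_refl h])
    then have "int p dvd d * d" by simp
    then show False unfolding d_sq using p_gt by simp
  qed
  then have "\<not> int p dvd T" unfolding T_def using Q prime_p by (simp add: prime_dvd_mult_iff)
  then have "\<not> P dvd 2 * of_int T" using P2 P_dvd_of_int_iff P_dvd_mult by blast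
  then have na: "\<not> P dvd \<alpha>" using gcong_dvd_iff[OF gcong_P_sq[OF a]] by auto
  have ab: "gcong (P\<^sup>2) (\<alpha> * \<beta>) (4 * P)"
  proof -
    have "\<alpha> * \<beta> = 4 * of_int (X * X) - of_int (Y * Y) * (W * W)"
      by (simp add: \<alpha>_def \<beta>_def algebra_simps)
    also have "gcong (P\<^sup>2) \<dots> (4 * of_int (X * X) - of_int (Y * Y) * (- 2))"
      by (intro gcong_diff gcong_mult gcong_refl W_sq)
    also have "\<dots> = of_int (4 * X\<^sup>2 + 2 * Y\<^sup>2)" by (simp add: power2_eq_square)
    also have "\<dots> = 4 * P" unfolding X_Y by simp
    finally show ?thesis .
  qed
  \<comment> \<open>Since \<open>\<alpha>\<close> is prime to \<open>p\<close>,
    \<open>\<beta>\<close> absorbs the factor \<open>p\<close> and its square vanishes modulo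
    \<open>p\<^sup>2\<close>. So \<open>\<alpha> * \<alpha>\<close> may be completed to the
    symmetric sum with \<open>\<beta> * \<beta>\<close>, from which the odd powers of
    \<open>W\<close> drop out.\<close>
  then have "P dvd \<alpha> * \<beta>" using gcong_dvd_iff[OF gcong_P_sq[OF ab]] by simp
  then have "P dvd \<beta>" using na P_dvd_mult by blast
  then have b2: "gcong (P\<^sup>2) (\<beta> * \<beta>) 0" by (simp add: gcong_0_iff power2_eq_square mult_dvd_mono)
  have "gcong (P\<^sup>2) (4 * of_int (T * T) + 0) (\<alpha> * \<alpha> + \<beta> * \<beta>)"
    by (intro gcong_add gcong_sym[OF a2] gcong_sym[OF b2])
  also have "\<alpha> * \<alpha> + \<beta> * \<beta> = 8 * of_int (X * X) + 2 * of_int (Y * Y) * (W * W)"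
    by (simp add: \<alpha>_def \<beta>_def algebra_simps)
  also have "gcong (P\<^sup>2) \<dots> (8 * of_int (X * X) + 2 * of_int (Y * Y) * (- 2))"
    by (intro gcong_add gcong_mult gcong_refl W_sq)
  also have "\<dots> = of_int (8 * X\<^sup>2 - 4 * Y\<^sup>2)" by (simp add: power2_eq_square)
  also have "8 * X\<^sup>2 - 4 * Y\<^sup>2 = 4 * (4 * X\<^sup>2 - 2 * int p)" using X_Y by (simp add: algebra_simps)
  finally have "gcong (P\<^sup>2) (of_int (4 * T\<^sup>2)) (of_int (4 * (4 * X\<^sup>2 - 2 * int p)))"
    by (simp add: power2_eq_square)
  then have "(int p)\<^sup>2 dvd 4 * (T\<^sup>2 - (4 * X\<^sup>2 - 2 * int p))"
    using of_int_gcong by (fastforce simp: algebra_simps)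
  moreover have "coprime ((int p)\<^sup>2) 4"
  proof -
    have "coprime (int p) 2" using p_not_dvd_2 prime_p
      by (metis prime_imp_coprime prime_nat_int_transfer)
    then have "coprime (int p) (2 ^ 2)" by (simp only: coprime_power_right_iff) simp
    then show ?thesis by simp
  qed
  ultimately show ?thesis unfolding T_def using coprime_dvd_mult_right_iff by blast
qed

end

section \<open>Gaussian integers and the main theorem\<close>

text \<open>A lift of the field with \<open>p\<^sup>2\<close> elements to characteristic zero, where
  congruences modulo \<open>p\<^sup>2\<close> make sense.\<close>

datatype gint = Gint (gre: int) (gim: int)

instantiation gint :: idom
begin

definition "0 = Gint 0 0"
definition "1 = Gint 1 0"
definition "z + w = Gint (gre z + gre w) (gim z + gim w)"
definition "z - w = Gint (gre z - gre w) (gim z - gim w)"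
definition "- z = Gint (- gre z) (- gim z)"
definition "z * w = Gint (gre z * gre w - gim z * gim w) (gre z * gim w + gim z * gre w)"

instance
proof
  fix a b :: gint
  assume "a \<noteq> 0" "b \<noteq> 0"
  then have "(gre a)\<^sup>2 + (gim a)\<^sup>2 \<noteq> 0" "(gre b)\<^sup>2 + (gim b)\<^sup>2 \<noteq> 0"
    by (auto simp: zero_gint_def sum_power2_eq_zero_iff intro: gint.expand)
  moreover have "((gre a)\<^sup>2 + (gim a)\<^sup>2) * ((gre b)\<^sup>2 + (gim b)\<^sup>2) = (gre (a * b))\<^sup>2 + (gim (a * b))\<^sup>2"
    by (simp add: times_gint_def power2_eq_square algebra_simps)
  ultimately have "(gre (a * b))\<^sup>2 + (gim (a * b))\<^sup>2 \<noteq> 0" by (metis mult_eq_0_iff)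
  then show "a * b \<noteq> 0" by (auto simp: zero_gint_def)
qed (auto simp: zero_gint_def one_gint_def plus_gint_def minus_gint_def uminus_gint_def times_gint_def
    algebra_simps intro: gint.expand)

end

lemma gint_of_nat: "of_nat k = Gint (int k) 0"
  by (induction k) (simp_all add: zero_gint_def one_gint_def plus_gint_def)

lemma gint_of_int: "of_int k = Gint k 0"
  by (cases k) (simp_all add: gint_of_nat uminus_gint_def one_gint_def minus_gint_def)

lemma gint_of_int_dvd_iff: "of_int a dvd z \<longleftrightarrow> a dvd gre z \<and> a dvd gim z"
proof
  assume "of_int a dvd z"
  then show "a dvd gre z \<and> a dvd gim z" by (auto simp: gint_of_int times_gint_def)
next
  assume "a dvd gre z \<and> a dvd gim z"
  then obtain x y where "gre z = a * x" "gim z = a * y" by blast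
  then have "z = of_int a * Gint x y" by (simp add: gint_of_int times_gint_def gint.expand)
  then show "of_int a dvd z" by simp
qed

text \<open>As \<open>- 1\<close> is no square modulo \<open>p\<close>, \<open>p\<close> divides a
  Gaussian integer as soon as it divides the norm. Multiplicativity of the norm then transfers
  primality from the integers.\<close>

lemma gint_prime_elem:
  assumes "prime p" "p = 8 * m + 3"
  shows "prime_elem (of_nat p :: gint)"
proof -
  have dvd: "of_nat p dvd z \<longleftrightarrow> int p dvd (gre z)\<^sup>2 + (gim z)\<^sup>2" for z
  proof -
    have "of_nat p dvd z \<longleftrightarrow> int p dvd gre z \<and> int p dvd gim z"
      using gint_of_int_dvd_iff[of "int p" z] by simp
    also have "\<dots> \<longleftrightarrow> int p dvd (gre z)\<^sup>2 + (gim z)\<^sup>2"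
    proof
      assume "int p dvd gre z \<and> int p dvd gim z"
      then show "int p dvd (gre z)\<^sup>2 + (gim z)\<^sup>2" unfolding power2_eq_square by (intro dvd_add dvd_mult) auto
    qed (rule prime_dvd_sum_two_squares[OF assms])
    finally show ?thesis .
  qed
  show ?thesis
  proof (rule prime_elemI)
    show "(of_nat p :: gint) \<noteq> 0" using assms by (simp add: gint_of_nat zero_gint_def)
    show "\<not> (of_nat p :: gint) dvd 1"
      unfolding dvd using assms by (simp add: one_gint_def)
  next
    fix a b :: gint
    assume "of_nat p dvd a * b"
    then have "int p dvd (gre (a * b))\<^sup>2 + (gim (a * b))\<^sup>2" unfolding dvd .
    also have "(gre (a * b))\<^sup>2 + (gim (a * b))\<^sup>2 = ((gre a)\<^sup>2 + (gim a)\<^sup>2) * ((gre b)\<^sup>2 + (gim b)\<^sup>2)"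
      by (simp add: times_gint_def power2_eq_square algebra_simps)
    finally show "of_nat p dvd a \<or> of_nat p dvd b"
      unfolding dvd using assms(1) by (simp add: prime_dvd_mult_iff)
  qed
qed

lemma frob_int:
  assumes "prime p" "p = 8 * m + 1" "m > 0"
  shows "frob p m 1 (1 :: int)"
proof
  show "prime_elem (of_nat p :: int)" using assms(1) by simp
qed (use assms in auto)

lemma frob_gint:
  assumes "prime p" "p = 8 * m + 3" "m > 0"
  shows "frob p m (- 1) (Gint 0 1)"
proof
  show "prime_elem (of_nat p :: gint)" by (rule gint_prime_elem[OF assms(1,2)])
  show "p = 8 * m + 1 \<and> - 1 = (1 :: int) \<and> Gint 0 1 = 1 \<or> p = 8 * m + 3 \<and> - 1 = (- 1 :: int) \<and> Gint 0 1 * Gint 0 1 = - 1"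
    using assms by (simp add: times_gint_def one_gint_def uminus_gint_def)
  fix k x assume "of_nat p ^ k dvd (of_int x :: gint)"
  then have "of_int (int p ^ k) dvd (of_int x :: gint)" by simp
  then show "int p ^ k dvd x" unfolding gint_of_int_dvd_iff by (simp add: gint_of_int)
qed (use assms in auto)

text \<open>The character sum yields some representation of \<open>p\<close>, the theorem speaks of
  a given one. For a suitable sign \<open>e\<close>, \<open>p\<close> divides
  \<open>D = X y - e x Z\<close>, while the composition identity bounds \<open>2 D\<^sup>2\<close>
  by \<open>p\<^sup>2\<close>; this forces \<open>D = 0\<close>.\<close>

lemma x2_2y2_unique:
  fixes X Z x y :: int
  assumes p: "prime p" and 1: "int p = X\<^sup>2 + 2 * Z\<^sup>2" and 2: "int p = x\<^sup>2 + 2 * y\<^sup>2"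
  shows "X\<^sup>2 = x\<^sup>2"
proof -
  have p0: "int p > 0" using p prime_gt_0_nat by simp
  have "(X * y - x * Z) * (X * y + x * Z) = (X\<^sup>2 + 2 * Z\<^sup>2) * y\<^sup>2 - (x\<^sup>2 + 2 * y\<^sup>2) * Z\<^sup>2"
    by (simp add: power2_eq_square algebra_simps)
  also have "\<dots> = int p * (y\<^sup>2 - Z\<^sup>2)" unfolding 1[symmetric] 2[symmetric] by (simp add: algebra_simps)
  finally have "int p dvd (X * y - x * Z) * (X * y + x * Z)" by simp
  then have "int p dvd X * y - x * Z \<or> int p dvd X * y + x * Z"
    using p by (simp add: prime_dvd_mult_iff)
  then have "\<exists>e. (e = 1 \<or> e = - 1) \<and> int p dvd X * y - e * (x * Z)"
    by (elim disjE) (rule exI[of _ 1], simp, rule exI[of _ "- 1"], simp)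
  then obtain e :: int where e: "e = 1 \<or> e = - 1" "int p dvd X * y - e * (x * Z)" by blast
  define D where "D = X * y - e * (x * Z)"
  have "(int p)\<^sup>2 = (X * x + 2 * e * (y * Z))\<^sup>2 + 2 * D\<^sup>2"
  proof -
    have "(int p)\<^sup>2 = (X\<^sup>2 + 2 * Z\<^sup>2) * (x\<^sup>2 + 2 * y\<^sup>2)"
      unfolding 1[symmetric] 2[symmetric] by (simp add: power2_eq_square)
    also have "\<dots> = (X * x + 2 * e * (y * Z))\<^sup>2 + 2 * D\<^sup>2"
      using e(1) unfolding D_def by (auto simp: power2_eq_square algebra_simps)
    finally show ?thesis .
  qed
  then have D2: "2 * D\<^sup>2 \<le> (int p)\<^sup>2" by simp
  have "D = 0"
  proof (rule ccontr)
    assume "D \<noteq> 0"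
    then have "int p \<le> \<bar>D\<bar>" using e(2) unfolding D_def by (intro zdvd_imp_le) auto
    then have "(int p)\<^sup>2 \<le> \<bar>D\<bar>\<^sup>2" using p0 by (intro power_mono) auto
    then have "(int p)\<^sup>2 \<le> D\<^sup>2" by simp
    moreover have "(int p)\<^sup>2 > 0" using p0 by simp
    ultimately show False using D2 by linarith
  qed
  then have "(X * y)\<^sup>2 = (e * (x * Z))\<^sup>2" unfolding D_def by simp
  then have "X\<^sup>2 * y\<^sup>2 = x\<^sup>2 * Z\<^sup>2" using e(1) by (auto simp: power_mult_distrib)
  then have "X\<^sup>2 * (2 * y\<^sup>2) = x\<^sup>2 * (2 * Z\<^sup>2)" by simp
  moreover have "2 * y\<^sup>2 = int p - x\<^sup>2" "2 * Z\<^sup>2 = int p - X\<^sup>2" using 1 2 by simp_all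
  ultimately have "X\<^sup>2 * (int p - x\<^sup>2) = x\<^sup>2 * (int p - X\<^sup>2)" by (simp only:)
  then have "int p * X\<^sup>2 = int p * x\<^sup>2" by (simp add: algebra_simps)
  then show ?thesis using p0 by simp
qed

context frob
begin

text \<open>The norm equation makes \<open>Y\<close> even, so \<open>X\<close> and
  \<open>Y / 2\<close> represent \<open>p\<close>, and uniqueness identifies
  \<open>X\<^sup>2\<close> with the given \<open>x\<^sup>2\<close>.\<close>

lemma section_sum_square_represented:
  assumes "\<not> p dvd section_sum" "int p = x\<^sup>2 + 2 * y\<^sup>2"
  shows "(int p)\<^sup>2 dvd ((int p - d) * int section_sum)\<^sup>2 - (4 * x\<^sup>2 - 2 * int p)"
proof -
  have eq: "2 * X\<^sup>2 + Y\<^sup>2 = 2 * int p" using X_Y by simp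
  then have "even (Y\<^sup>2)" by (metis dvd_add_right_iff dvd_triv_left)
  then have "even Y" by simp
  then obtain Z where Z: "Y = 2 * Z" by blast
  have "int p = X\<^sup>2 + 2 * Z\<^sup>2" using eq unfolding Z by (simp add: power_mult_distrib)
  then have "X\<^sup>2 = x\<^sup>2" using x2_2y2_unique prime_p assms(2) by blast
  then show ?thesis using section_sum_square[OF assms(1)] by simp
qed

end

theorem theorem4p3:
  fixes p :: nat and x y :: int
  assumes "prime p" and "p > 3"
    and "[p = 1] (mod 8) \<or> [p = 3] (mod 8)"
    and "int p = x\<^sup>2 + 2 * y\<^sup>2"
  shows "p_integral_cong p
      ((2 - (- 1) ^ ((p - 1) div 2)) *
        (\<Sum>k = 0..p - 1. (of_nat ((2 * k) choose k))\<^sup>2 * (1 / 16 ^ k) * (of_nat p / of_nat (8 * k + 1))))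
      ((2 + (- 1) ^ ((p - 1) div 2)) *
        (\<Sum>k = 0..p - 1. (of_nat ((2 * k) choose k))\<^sup>2 * (1 / 16 ^ k) * (of_nat p / of_nat (8 * k + 3))))
      (of_nat p ^ 2)
    \<and> p_integral_cong p
      ((2 + (- 1) ^ ((p - 1) div 2)) *
        (\<Sum>k = 0..p - 1. (of_nat ((2 * k) choose k))\<^sup>2 * (1 / 16 ^ k) * (of_nat p / of_nat (8 * k + 3))))
      (of_int (4 * x\<^sup>2 - 2 * int p))
      (of_nat p ^ 2)"
proof -
  interpret prime_rat p by unfold_locales (rule assms(1))
  define m where "m = p div 8"
  consider (one) "p = 8 * m + 1" | (three) "p = 8 * m + 3"
  proof -
    have "p mod 8 = 1 \<or> p mod 8 = 3" using assms(3) by (auto simp: cong_def)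
    moreover have "p = 8 * m + p mod 8" by (simp add: m_def)
    ultimately show thesis using one three by metis
  qed
  then show ?thesis
  proof cases
    case one
    have m: "m > 0" using one assms(2) by simp
    interpret frob p m 1 "1 :: int" by (rule frob_int[OF assms(1) one m])
    have n: "(p - 1) div 2 = 4 * m" using one by simp
    have Q: "section_sum = (\<Sum>k | k \<le> p * (4 * m) \<and> (int p - 1) dvd int k - int m. (p * (4 * m)) choose k)"
      unfolding section_sum_def good_def n by simp
    note sec = section_pos[OF one assms(2) refl Q]
    have "int p ^ 2 dvd ((int p - 1) * int section_sum)\<^sup>2 - (4 * x\<^sup>2 - 2 * int p)"
      by (rule section_sum_square_represented[OF sec(2) assms(4)])
    from pcong_of_int[OF this]
    have T: "pcong 2 (((of_nat p - 1) * of_nat section_sum)\<^sup>2) (of_int (4 * x\<^sup>2 - 2 * int p))" by simp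
    note V = pcong_trans[OF pcong_sym[OF sec(1)] T]
    have p2: "p = 2 * (4 * m) + 1" using one by simp
    have A: "pcong 2 (hyp_sum 1) (of_int (4 * x\<^sup>2 - 2 * int p))"
      by (rule pcong_trans[OF hyp_sum_1[OF p2 assms(2)] V]) (use one in auto)
    have B: "pcong 2 (3 * hyp_sum 3) (of_int (4 * x\<^sup>2 - 2 * int p))"
      by (rule pcong_trans[OF hyp_sum_3[OF p2 assms(2)] V]) (use one in auto)
    \<comment> \<open>These factors are the numbers \<open>h\<close> at the poles:
      \<open>8 m + 1 = p\<close> and \<open>8 (n - m) + 3 = 3 p\<close>.\<close>
    have signs: "2 - (- 1) ^ ((p - 1) div 2) = (1 :: rat)" "2 + (- 1) ^ ((p - 1) div 2) = (3 :: rat)"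
      unfolding n by simp_all
    show ?thesis unfolding pcong_def[symmetric] signs mult_1_left
      by (intro conjI pcong_trans[OF A pcong_sym[OF B]] B)
  next
    case three
    have m: "m > 0" using three assms(2) by simp
    interpret frob p m "- 1" "Gint 0 1" by (rule frob_gint[OF assms(1) three m])
    have n: "(p - 1) div 2 = 4 * m + 1" using three by simp
    have Q: "section_sum = (\<Sum>k | k \<le> p * (4 * m + 1) \<and> (int p + 1) dvd int k + int m. (p * (4 * m + 1)) choose k)"
      unfolding section_sum_def good_def n by simp
    note sec = section_neg[OF three assms(2) refl Q]
    have "int p ^ 2 dvd ((int p - - 1) * int section_sum)\<^sup>2 - (4 * x\<^sup>2 - 2 * int p)"
      by (rule section_sum_square_represented[OF sec(2) assms(4)])
    from pcong_of_int[OF this]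
    have T: "pcong 2 (((of_nat p - - 1) * of_nat section_sum)\<^sup>2) (of_int (4 * x\<^sup>2 - 2 * int p))" by simp
    note V = pcong_trans[OF pcong_sym[OF sec(1)] T]
    have p2: "p = 2 * (4 * m + 1) + 1" using three by simp
    have A: "pcong 2 (3 * hyp_sum 1) (of_int (4 * x\<^sup>2 - 2 * int p))"
      by (rule pcong_trans[OF hyp_sum_3[OF p2 assms(2)] V]) (use three in auto)
    have B: "pcong 2 (hyp_sum 3) (of_int (4 * x\<^sup>2 - 2 * int p))"
      by (rule pcong_trans[OF hyp_sum_1[OF p2 assms(2)] V]) (use three in auto)
    \<comment> \<open>With \<open>n\<close> odd the poles trade roles: \<open>8 m + 3 = p\<close>
      and \<open>8 (n - m) + 1 = 3 p\<close>.\<close>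
    have signs: "2 - (- 1) ^ ((p - 1) div 2) = (3 :: rat)" "2 + (- 1) ^ ((p - 1) div 2) = (1 :: rat)"
      unfolding n by simp_all
    show ?thesis unfolding pcong_def[symmetric] signs mult_1_left
      by (intro conjI pcong_trans[OF A pcong_sym[OF B]] B)
  qed
qed

end
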